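(* There is an $\epsilon>0$ such that the following holds. Let $0<T\le\infty$ and let $u$ be a Leray-Hopf solution on $[0,T)$ of the Navier-Stokes system on $\mathbb{T}^3$ with initial data $\psi\in L^2(\mathbb{T}^3)$. Suppose that for some $K>0$ independent of time $$\sup_{\mathbf{k}\in\mathbb{Z}^3,\ |\mathbf{k}|\ge K}|\mathbf{k}|^2\,|u_{\mathbf{k}}(t)|<\epsilon\qquad\text{for all } t\in(0,T).$$ Then $u$ is smooth for every $0<t<T$, i.e. $u$ is $C^\infty$ on $\mathbb{T}^3\times(0,T)$.
   Context: $\mathbb{T}^3=[0,1]^3$ with periodic boundary conditions. The Navier-Stokes system is $$u_t-\Delta u+u\cdot\nabla u+\nabla p=0\ \text{ in }\ \mathbb{T}^3\times(0,\infty),\qquad u(x,0)=\psi,\quad \operatorname{div}u=0,$$ for vector fields $u$ with three components. The Fourier expansion of $u(\cdot,t)\in L^2(\mathbb{T}^3)$ is $\sum_{\mathbf{k}\in\mathbb{Z}^3}u_{\mathbf{k}}(t)\exp(2\pi i\langle x,\mathbf{k}\rangle)$, and $|u_{\mathbf{k}}|$ is the Euclidean norm of the vector $u_{\mathbf{k}}\in\mathbb{C}^3$. A Leray-Hopf solution with (real-valued, divergence-free) initial data $\psi\in L^2(\mathbb{T}^3)$ is a (real-valued, divergence-free) function $u:[0,T)\to L^2(\mathbb{T}^3)$ such that: (1) $u$ is weakly continuous; (2) $u\in L^\infty(0,T;L^2(\mathbb{T}^3))\cap L^2(0,T;H^1(\mathbb{T}^3))$; (3) for all divergence-free $\varphi\in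 C^\infty(\mathbb{T}^3\times[0,T))$ and all $t\in[0,T)$, $$\langle u(t),\varphi(t)\rangle+\int_0^t\Big(-\langle u(\tau),\partial_\tau\varphi(\tau)\rangle+\langle\nabla u(\tau),\nabla\varphi(\tau)\rangle+\langle u\cdot\nabla u,\varphi\rangle\Big)d\tau=\langle\psi,\varphi(0)\rangle;$$ (4) the energy inequality $\|u(t)\|_{L^2(\mathbb{T}^3)}^2+2\int_0^t\|\nabla u(\tau)\|_{L^2(\mathbb{T}^3)}^2\,d\tau\le\|\psi\|_{L^2(\mathbb{T}^3)}^2$ holds for $t\in[0,T)$. *)

theory Defs
  imports "HOL-Analysis.Analysis"
begin

text \<open>
  Elements of \<open>L\<^sup>2\<close> of the torus are represented by functions on \<^typ>\<open>real^3\<close> of which only the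
  values on the unit cube matter, up to null sets.  Smooth functions on the torus are represented
  by 1-periodic functions.
\<close>

subsection \<open>Smooth functions\<close>

text \<open>
  Derivatives are taken within \<open>S\<close>, so that one-sided derivatives are used at boundary points.  The
  definition is meant for sets on which such derivatives are unique, e.g. convex sets with nonempty
  interior.
\<close>

primrec Ck_on :: "nat \<Rightarrow> 'a::euclidean_space set \<Rightarrow> ('a \<Rightarrow> 'b::real_normed_vector) \<Rightarrow> bool" where
  "Ck_on 0 S f \<longleftrightarrow> continuous_on S f"
| "Ck_on (Suc k) S f \<longleftrightarrow>
     (\<exists>f'. (\<forall>x\<in>S. (f has_derivative f' x) (at x within S)) \<and> (\<forall>h. Ck_on k S (\<lambda>x. f' x h)))"

definition smooth_on :: "'a::euclidean_space set \<Rightarrow> ('a \<Rightarrow> 'b::real_normed_vector) \<Rightarrow> bool" where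
  "smooth_on S f \<longleftrightarrow> (\<forall>k. Ck_on k S f)"

definition periodic :: "(real^3 \<Rightarrow> 'b) \<Rightarrow> bool" where
  "periodic f \<longleftrightarrow> (\<forall>x i. f (x + axis i 1) = f x)"

definition torus_smooth :: "(real^3 \<Rightarrow> 'b::real_normed_vector) \<Rightarrow> bool" where
  "torus_smooth f \<longleftrightarrow> periodic f \<and> smooth_on UNIV f"

definition torus_time_smooth :: "real set \<Rightarrow> (real \<Rightarrow> real^3 \<Rightarrow> 'b::real_normed_vector) \<Rightarrow> bool" where
  "torus_time_smooth I f \<longleftrightarrow>
     (\<forall>t\<in>I. periodic (f t)) \<and> smooth_on (I \<times> UNIV) (\<lambda>(t, x). f t x)"

definition gradient :: "(real^3 \<Rightarrow> real) \<Rightarrow> real^3 \<Rightarrow> real^3" where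
  "gradient g x = (\<chi> j. frechet_derivative g (at x) (axis j 1))"

text \<open>The entry \<open>$ i $ j\<close> is the \<open>j\<close>-th partial derivative of the \<open>i\<close>-th component.\<close>

definition jacobian :: "(real^3 \<Rightarrow> real^3) \<Rightarrow> real^3 \<Rightarrow> real^3^3" where
  "jacobian f x = matrix (frechet_derivative f (at x))"

definition divergence :: "(real^3 \<Rightarrow> real^3) \<Rightarrow> real^3 \<Rightarrow> real" where
  "divergence f x = trace (jacobian f x)"


subsection \<open>Function spaces on the torus\<close>

definition unit_cube :: "(real^3) set" where
  "unit_cube = cbox 0 1"

definition in_L2 :: "(real^3 \<Rightarrow> 'b::euclidean_space) \<Rightarrow> bool" where
  "in_L2 f \<longleftrightarrow> set_borel_measurable lebesgue unit_cube f \<and>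
     set_integrable lebesgue unit_cube (\<lambda>x. (norm (f x))\<^sup>2)"

definition torus_inner :: "(real^3 \<Rightarrow> 'b::euclidean_space) \<Rightarrow> (real^3 \<Rightarrow> 'b) \<Rightarrow> real" where
  "torus_inner f g = (LINT x:unit_cube|lebesgue. f x \<bullet> g x)"

definition torus_norm :: "(real^3 \<Rightarrow> 'b::euclidean_space) \<Rightarrow> real" where
  "torus_norm f = sqrt (torus_inner f f)"

definition weakly_div_free :: "(real^3 \<Rightarrow> real^3) \<Rightarrow> bool" where
  "weakly_div_free f \<longleftrightarrow> (\<forall>g. torus_smooth g \<longrightarrow> torus_inner f (gradient g) = 0)"

definition has_weak_gradient :: "(real^3 \<Rightarrow> real^3) \<Rightarrow> (real^3 \<Rightarrow> real^3^3) \<Rightarrow> bool" where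
  "has_weak_gradient f G \<longleftrightarrow> in_L2 G \<and>
     (\<forall>g i j. torus_smooth g \<longrightarrow>
        torus_inner (\<lambda>x. f x $ i) (\<lambda>x. gradient g x $ j) = - torus_inner (\<lambda>x. G x $ i $ j) g)"

definition in_H1 :: "(real^3 \<Rightarrow> real^3) \<Rightarrow> bool" where
  "in_H1 f \<longleftrightarrow> in_L2 f \<and> (\<exists>G. has_weak_gradient f G)"

text \<open>For a function in \<open>H\<^sup>1\<close> the choice is unique up to a null set.\<close>

definition weak_gradient :: "(real^3 \<Rightarrow> real^3) \<Rightarrow> real^3 \<Rightarrow> real^3^3" where
  "weak_gradient f = (SOME G. has_weak_gradient f G)"

definition freq :: "int^3 \<Rightarrow> real^3" where
  "freq k = (\<chi> i. real_of_int (k $ i))"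

definition fourier_coeff :: "(real^3 \<Rightarrow> real^3) \<Rightarrow> int^3 \<Rightarrow> complex^3" where
  "fourier_coeff f k = (\<chi> i. LINT x:unit_cube|lebesgue.
     complex_of_real (f x $ i) * exp (- (2 * of_real pi * \<i> * of_real (x \<bullet> freq k))))"


subsection \<open>Leray-Hopf solutions\<close>

text \<open>The final time is an extended real, to allow \<open>T = \<infinity>\<close>.\<close>

definition time_co :: "ereal \<Rightarrow> real set" where
  "time_co T = {t. 0 \<le> t \<and> ereal t < T}"

definition time_oo :: "ereal \<Rightarrow> real set" where
  "time_oo T = {t. 0 < t \<and> ereal t < T}"

definition weakly_continuous :: "real set \<Rightarrow> (real \<Rightarrow> real^3 \<Rightarrow> real^3) \<Rightarrow> bool" where
  "weakly_continuous I u \<longleftrightarrow> (\<forall>w. in_L2 w \<longrightarrow> continuous_on I (\<lambda>t. torus_inner (u t) w))"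

text \<open>
  Strong measurability of \<open>u\<close> in time is not part of the next two definitions: for weakly
  continuous \<open>u\<close> it is automatic, \<open>L\<^sup>2\<close> and \<open>H\<^sup>1\<close> of the torus being separable.
\<close>

definition Linf_L2 :: "ereal \<Rightarrow> (real \<Rightarrow> real^3 \<Rightarrow> real^3) \<Rightarrow> bool" where
  "Linf_L2 T u \<longleftrightarrow> (\<exists>C. AE t in lebesgue. t \<in> time_oo T \<longrightarrow> in_L2 (u t) \<and> torus_norm (u t) \<le> C)"

definition L2_H1 :: "ereal \<Rightarrow> (real \<Rightarrow> real^3 \<Rightarrow> real^3) \<Rightarrow> bool" where
  "L2_H1 T u \<longleftrightarrow> (AE t in lebesgue. t \<in> time_oo T \<longrightarrow> in_H1 (u t)) \<and>
     set_integrable lebesgue (time_oo T)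
       (\<lambda>t. (torus_norm (u t))\<^sup>2 + (torus_norm (weak_gradient (u t)))\<^sup>2)"

text \<open>The vector field \<open>u \<cdot> \<nabla>u\<close>, with components \<open>\<Sum>j. u\<^sub>j \<partial>\<^sub>j u\<^sub>i\<close>.\<close>

definition convection :: "(real^3 \<Rightarrow> real^3) \<Rightarrow> real^3 \<Rightarrow> real^3" where
  "convection f x = weak_gradient f x *v f x"

definition weak_NS ::
  "ereal \<Rightarrow> (real^3 \<Rightarrow> real^3) \<Rightarrow> (real \<Rightarrow> real^3 \<Rightarrow> real^3) \<Rightarrow> bool" where
  "weak_NS T \<psi> u \<longleftrightarrow>
     (\<forall>\<phi>. torus_time_smooth (time_co T) \<phi> \<and> (\<forall>t\<in>time_co T. \<forall>x. divergence (\<phi> t) x = 0) \<longrightarrow>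
       (\<forall>t\<in>time_co T.
          torus_inner (u t) (\<phi> t)
          + (LINT \<tau>:{0..t}|lebesgue.
               - torus_inner (u \<tau>)
                   (\<lambda>x. vector_derivative (\<lambda>s. \<phi> s x) (at \<tau> within time_co T))
               + torus_inner (weak_gradient (u \<tau>)) (jacobian (\<phi> \<tau>))
               + torus_inner (convection (u \<tau>)) (\<phi> \<tau>))
          = torus_inner \<psi> (\<phi> 0)))"

definition energy_inequality ::
  "ereal \<Rightarrow> (real^3 \<Rightarrow> real^3) \<Rightarrow> (real \<Rightarrow> real^3 \<Rightarrow> real^3) \<Rightarrow> bool" where
  "energy_inequality T \<psi> u \<longleftrightarrow>
     (\<forall>t\<in>time_co T.
        (torus_norm (u t))\<^sup>2
        + 2 * (LINT \<tau>:{0..t}|lebesgue. (torus_norm (weak_gradient (u \<tau>)))\<^sup>2)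
        \<le> (torus_norm \<psi>)\<^sup>2)"

definition leray_hopf ::
  "ereal \<Rightarrow> (real^3 \<Rightarrow> real^3) \<Rightarrow> (real \<Rightarrow> real^3 \<Rightarrow> real^3) \<Rightarrow> bool" where
  "leray_hopf T \<psi> u \<longleftrightarrow>
     in_L2 \<psi> \<and> weakly_div_free \<psi> \<and>
     (\<forall>t\<in>time_co T. in_L2 (u t) \<and> weakly_div_free (u t)) \<and>
     weakly_continuous (time_co T) u \<and>
     Linf_L2 T u \<and> L2_H1 T u \<and>
     weak_NS T \<psi> u \<and>
     energy_inequality T \<psi> u"

text \<open>
  As \<open>u t\<close> stands for a class of functions modulo null sets, smoothness of \<open>u\<close> on the product of the
  torus and \<open>I\<close> means that it has a smooth representative.
\<close>

definition has_smooth_version_on :: "real set \<Rightarrow> (real \<Rightarrow> real^3 \<Rightarrow> real^3) \<Rightarrow> bool" where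
  "has_smooth_version_on I u \<longleftrightarrow>
     (\<exists>v. torus_time_smooth I v \<and>
        (\<forall>t\<in>I. AE x in lebesgue. x \<in> unit_cube \<longrightarrow> u t x = v t x))"

end

theory Submission
  imports Defs
begin

text \<open>
  Write \<open>u\<^sub>k(t)\<close> for the Fourier coefficients and \<open>a\<^sub>k = |u\<^sub>k|\<close>.  Testing the weak formulation with
  trigonometric fields shows that \<open>u\<^sub>k' = - 4\<pi>\<^sup>2|k|\<^sup>2 u\<^sub>k - N\<^sub>k\<close> with \<open>|N\<^sub>k| \<le> 4\<pi>|k| (a * a)\<^sub>k\<close>; the
  convolutions converge uniformly in time because \<open>a\<^sub>k = O(|k|\<^sup>-\<^sup>2)\<close>.

  This decay is scaling-critical, and smallness at high frequencies is used to gain two orders.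
  In \<open>(a * a)\<^sub>k = \<Sum>\<^sub>l a\<^sub>k\<^sub>-\<^sub>l a\<^sub>l\<close> the larger of the two frequencies is at least \<open>|k|/2\<close> and can carry a
  weight \<open>w\<^sub>k = min(|k|, R)\<^sup>2\<close>, while the smaller one only contributes \<open>\<epsilon>|l|\<^sup>-\<^sup>2\<close>; since
  \<open>\<Sum>\<^sub>l |l|\<^sup>-\<^sup>2|k - l|\<^sup>-\<^sup>2 = O(1/|k|)\<close>, Duhamel's formula from time \<open>t/2\<close> to \<open>t\<close> bounds
  \<open>B = sup t w\<^sub>k |k|\<^sup>2 a\<^sub>k(t)\<close> by \<open>const + B/2\<close>, uniformly in \<open>R\<close>.  Letting \<open>R\<close> tend to infinity,
  \<open>a\<^sub>k = O(|k|\<^sup>-\<^sup>4)\<close>, which is summable, and from there each use of Duhamel's formula gains one more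
  power of \<open>|k|\<close>.  Differentiating the equation in time preserves rapid decay, so the Fourier
  series is smooth in space and time, and it represents \<open>u\<close> by completeness of the trigonometric
  system.
\<close>

subsection \<open>Lattice sums\<close>

text \<open>The obstacle is criticality. If the coefficients are bounded by
  \<open>\<eta> |k|^-2\<close>, their convolution has size \<open>\<eta>^2 / |k|\<close>, the
  derivative contributes \<open>|k|\<close> and the heat semigroup returns \<open>1 / |k|^2\<close>:
  the outcome is again of order \<open>|k|^-2\<close>, so iteration alone gains nothing. The gain
  comes from absorbing a term linear in \<open>B\<close>. That is legitimate only if
  \<open>B\<close> is finite beforehand, hence the truncation at \<open>R\<close>; the factor t and
  the halved time interval make up for data that have only the critical decay. Frequencies below
  \<open>K\<close> are not small, but being finitely many they contribute one power of
  \<open>|k|\<close> less to the convolution and are dominated once \<open>|k| >= K1\<close>. In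
  three dimensions \<open>|k|^-2\<close> is square-summable but not summable. Square-summability
  makes the convolutions converge uniformly in time, so the coefficient equation holds at every time
  although the weak gradient is available only at almost every time. The value
  \<open>\<epsilon> = 1 / (96 * conv_const)\<close> arises from
  \<open>\<eta> = 3 * \<epsilon>\<close>, summing over three components, and from the requirement
  \<open>\<eta> * conv_const <= 1 / 32\<close> of the absorption.\<close>

lemma freq_simps [simp]:
  "freq 0 = 0" "freq (k - l) = freq k - freq l" "freq (k + l) = freq k + freq l" "freq (- k) = - freq k"
  by (simp_all add: freq_def vec_eq_iff)

lemma freq_nth [simp]: "freq k $ i = real_of_int (k $ i)"
  by (simp add: freq_def)

lemma freq_eq_iff [simp]: "freq k = freq l \<longleftrightarrow> k = l"
  by (simp add: vec_eq_iff)

lemma freq_eq_0_iff [simp]: "freq k = 0 \<longleftrightarrow> k = 0"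
  using freq_eq_iff[of k 0] by (simp del: freq_eq_iff)

lemma abs_le_norm_freq: "\<bar>real_of_int (k $ i)\<bar> \<le> norm (freq k)"
  using component_le_norm_cart[of "freq k" i] by simp

lemma norm_freq_ge_1:
  assumes "k \<noteq> 0"
  shows "1 \<le> norm (freq k)"
proof -
  obtain i where "k $ i \<noteq> 0"
    using assms by (auto simp: vec_eq_iff)
  then have "1 \<le> \<bar>real_of_int (k $ i)\<bar>"
    by linarith
  then show ?thesis
    using abs_le_norm_freq[of k i] by linarith
qed

text \<open>The maximum norm replaces the Euclidean one for counting: its balls are boxes with an
  exact number of lattice points, and the two norms differ by at most a factor 2, a convenient bound
  for the square root of 3.\<close>

definition sup_norm :: "int^3 \<Rightarrow> nat" where
  "sup_norm k = Max (range (\<lambda>i. nat \<bar>k $ i\<bar>))"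

lemma sup_norm_le_iff: "sup_norm k \<le> n \<longleftrightarrow> (\<forall>i. \<bar>k $ i\<bar> \<le> int n)"
  unfolding sup_norm_def by (subst Max_le_iff) (auto simp: nat_le_iff)

lemma sup_norm_le_norm: "real (sup_norm k) \<le> norm (freq k)"
proof -
  have "sup_norm k \<in> range (\<lambda>i. nat \<bar>k $ i\<bar>)"
    unfolding sup_norm_def by (rule Max_in) auto
  then obtain i where "sup_norm k = nat \<bar>k $ i\<bar>" by auto
  then show ?thesis
    using abs_le_norm_freq[of k i] by simp
qed

lemma norm_le_sup_norm: "norm (freq k) \<le> 2 * real (sup_norm k)"
proof -
  have i: "(real_of_int (k $ i))\<^sup>2 \<le> (real (sup_norm k))\<^sup>2" for i
  proof -
    have "\<bar>k $ i\<bar> \<le> int (sup_norm k)"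
      using sup_norm_le_iff by blast
    then have "\<bar>real_of_int (k $ i)\<bar> \<le> real (sup_norm k)" by linarith
    then show ?thesis by (metis abs_le_square_iff abs_of_nat)
  qed
  have "(norm (freq k))\<^sup>2 = (\<Sum>i\<in>UNIV. (real_of_int (k $ i))\<^sup>2)"
    by (simp add: norm_vec_def L2_set_def sum_nonneg)
  also have "\<dots> \<le> (\<Sum>i\<in>(UNIV::3 set). (real (sup_norm k))\<^sup>2)"
    by (intro sum_mono i)
  also have "\<dots> \<le> (2 * real (sup_norm k))\<^sup>2"
    by (simp add: power2_eq_square)
  finally show ?thesis
    by (rule power2_le_imp_le) simp
qed

lemma sup_norm_box_card:
  "finite {k. sup_norm k \<le> n}" "card {k. sup_norm k \<le> n} = (2 * n + 1) ^ 3"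
proof -
  let ?J = "{- int n..int n}"
  let ?f = "\<lambda>(a, b, c). vector [a, b, c] :: int^3"
  have bij: "bij_betw ?f (?J \<times> ?J \<times> ?J) {k. sup_norm k \<le> n}"
    by (rule bij_betw_byWitness[where f' = "\<lambda>k. (k $ 1, k $ 2, k $ 3)"])
       (auto simp: sup_norm_le_iff vec_eq_iff forall_3 abs_le_iff)
  show "finite {k. sup_norm k \<le> n}"
    using bij_betw_finite[OF bij] by simp
  show "card {k. sup_norm k \<le> n} = (2 * n + 1) ^ 3"
  proof -
    have "card {k. sup_norm k \<le> n} = card (?J \<times> ?J \<times> ?J)"
      using bij_betw_same_card[OF bij] by simp
    moreover have "card ?J = 2 * n + 1" by (simp add: nat_add_distrib)
    ultimately show ?thesis
      by (simp only: card_cartesian_product power3_eq_cube mult.assoc)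
  qed
qed

lemma finite_freq_le: "finite {k. norm (freq k) \<le> r}"
proof (rule finite_subset)
  show "{k. norm (freq k) \<le> r} \<subseteq> {k. sup_norm k \<le> nat \<lfloor>r\<rfloor>}"
  proof
    fix k assume "k \<in> {k. norm (freq k) \<le> r}"
    then have "real (sup_norm k) \<le> r"
      using sup_norm_le_norm[of k] by simp
    then show "k \<in> {k. sup_norm k \<le> nat \<lfloor>r\<rfloor>}"
      by (simp add: le_nat_floor)
  qed
qed (rule sup_norm_box_card)

text \<open>The shell is a difference of boxes, \<open>(2n+1)^3 - (2n-1)^3 = 24 n^2 + 2\<close>, and
  \<open>n >= 1\<close> absorbs the 2.\<close>

lemma sup_norm_shell:
  assumes "n > 0"
  shows "finite {k. sup_norm k = n}" "real (card {k. sup_norm k = n}) \<le> 26 * (real n)\<^sup>2"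
proof -
  obtain m where n: "n = Suc m" using assms gr0_implies_Suc by blast
  have eq: "{k. sup_norm k = n} = {k. sup_norm k \<le> n} - {k. sup_norm k \<le> m}"
    using n by auto
  show "finite {k. sup_norm k = n}"
    unfolding eq using sup_norm_box_card by simp
  have "card {k. sup_norm k = n} = (2 * n + 1) ^ 3 - (2 * m + 1) ^ 3"
    unfolding eq using n by (subst card_Diff_subset) (auto simp: sup_norm_box_card)
  then have "real (card {k. sup_norm k = n}) = real ((2 * n + 1) ^ 3) - real ((2 * m + 1) ^ 3)"
    using n by (simp add: of_nat_diff power_mono)
  also have "\<dots> \<le> 26 * (real n)\<^sup>2"
    unfolding n by (simp add: power3_eq_cube power2_eq_square algebra_simps)
  finally show "real (card {k. sup_norm k = n}) \<le> 26 * (real n)\<^sup>2" .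
qed

text \<open>Polar coordinates on the lattice: a function of the maximum norm is summed shell by
  shell, and \<open>X\<close> may fill its shells only partly, hence an inequality and the
  nonnegativity of \<open>f\<close>.\<close>

lemma sum_shells_le:
  fixes f :: "nat \<Rightarrow> real"
  assumes "finite X" "0 \<notin> X" "\<And>n. f n \<ge> 0"
  shows "(\<Sum>k\<in>X. f (sup_norm k)) \<le> (\<Sum>n\<in>sup_norm ` X. 26 * (real n)\<^sup>2 * f n)"
proof -
  have "(\<Sum>k\<in>X. f (sup_norm k)) = (\<Sum>n\<in>sup_norm ` X. \<Sum>k\<in>{k\<in>X. sup_norm k = n}. f (sup_norm k))"
    by (rule sum.image_gen[OF assms(1)])
  also have "\<dots> \<le> (\<Sum>n\<in>sup_norm ` X. 26 * (real n)\<^sup>2 * f n)"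
  proof (rule sum_mono)
    fix n assume "n \<in> sup_norm ` X"
    then obtain k where k: "k \<in> X" "n = sup_norm k" by auto
    have "k \<noteq> 0" using k assms by auto
    then have "n > 0"
      using norm_freq_ge_1[of k] norm_le_sup_norm[of k] k(2) by (cases "sup_norm k") auto
    have "(\<Sum>k\<in>{k\<in>X. sup_norm k = n}. f (sup_norm k)) = real (card {k\<in>X. sup_norm k = n}) * f n"
      by simp
    also have "card {k\<in>X. sup_norm k = n} \<le> card {k. sup_norm k = n}"
      using sup_norm_shell[OF \<open>n > 0\<close>] by (intro card_mono) auto
    then have "real (card {k\<in>X. sup_norm k = n}) * f n \<le> real (card {k. sup_norm k = n}) * f n"
      by (intro mult_right_mono assms) auto
    also have "\<dots> \<le> 26 * (real n)\<^sup>2 * f n"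
      by (intro mult_right_mono assms sup_norm_shell \<open>n > 0\<close>)
    finally show "(\<Sum>k\<in>{k\<in>X. sup_norm k = n}. f (sup_norm k)) \<le> 26 * (real n)\<^sup>2 * f n" .
  qed
  finally show ?thesis .
qed

text \<open>Division by zero gives \<open>inv_sq 0 = 0\<close>, so the zero frequency never contributes.\<close>

definition inv_sq :: "int^3 \<Rightarrow> real" where
  "inv_sq k = 1 / (norm (freq k))\<^sup>2"

lemma inv_sq_0 [simp]: "inv_sq 0 = 0"
  by (simp add: inv_sq_def)

lemma inv_sq_nonneg [simp]: "inv_sq k \<ge> 0"
  by (simp add: inv_sq_def)

lemma inv_sq_le_sup_norm: 
  assumes "k \<noteq> 0"
  shows "inv_sq k \<le> 1 / (real (sup_norm k))\<^sup>2" "sup_norm k > 0"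
proof -
  show *: "sup_norm k > 0"
    using norm_freq_ge_1[OF assms] norm_le_sup_norm[of k] by (cases "sup_norm k") auto
  show "inv_sq k \<le> 1 / (real (sup_norm k))\<^sup>2"
    unfolding inv_sq_def using * sup_norm_le_norm[of k]
    by (intro divide_left_mono power_mono mult_pos_pos zero_less_power) auto
qed

text \<open>The shell size \<open>26 n^2\<close> cancels the decay \<open>n^-2\<close>, so each of
  the at most \<open>r\<close> shells that meet the ball contributes at most 26.\<close>

lemma sum_inv_sq_ball:
  assumes "finite X" "\<And>k. k \<in> X \<Longrightarrow> norm (freq k) \<le> r" "r \<ge> 0"
  shows "(\<Sum>k\<in>X. inv_sq k) \<le> 26 * r"
proof -
  let ?X = "X - {0}"
  have "(\<Sum>k\<in>X. inv_sq k) = (\<Sum>k\<in>?X. inv_sq k)"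
    by (rule sum.mono_neutral_right) (use assms in auto)
  also have "\<dots> \<le> (\<Sum>k\<in>?X. 1 / (real (sup_norm k))\<^sup>2)"
    by (intro sum_mono inv_sq_le_sup_norm) auto
  also have "\<dots> \<le> (\<Sum>n\<in>sup_norm ` ?X. 26 * (real n)\<^sup>2 * (1 / (real n)\<^sup>2))"
    by (rule sum_shells_le) (use assms in auto)
  also have "\<dots> \<le> (\<Sum>n\<in>sup_norm ` ?X. 26)"
    by (intro sum_mono) auto
  also have "\<dots> \<le> (\<Sum>n\<in>{1..nat \<lfloor>r\<rfloor>}. 26)"
  proof (rule sum_mono2, simp, rule subsetI)
    fix n assume "n \<in> sup_norm ` ?X"
    then obtain k where k: "k \<in> X" "k \<noteq> 0" "n = sup_norm k" by auto
    have "real n \<le> r" using k assms(2)[of k] sup_norm_le_norm[of k] by simp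
    then show "n \<in> {1..nat \<lfloor>r\<rfloor>}"
      using inv_sq_le_sup_norm(2)[of k] k by (simp add: le_nat_iff le_floor_iff)
  qed auto
  also have "\<dots> \<le> 26 * r"
    using assms(3) by simp
  finally show ?thesis .
qed

text \<open>Each term satisfies \<open>1/n^2 <= 2/n - 2/(n+1)\<close> because
  \<open>n + 1 <= 2n\<close>, and the right-hand sides telescope.\<close>

lemma sum_telescope_inv_sq:
  fixes a b :: nat
  assumes "a > 0"
  shows "(\<Sum>n\<in>{a..<a+b}. 1 / (real n)\<^sup>2) \<le> 2 / real a - 2 / real (a + b)"
proof (induction b)
  case (Suc b)
  define c where "c = real (a + b)"
  have c: "c \<ge> 1" using assms by (simp add: c_def)
  have "1 / c\<^sup>2 \<le> 2 / c - 2 / (c + 1)"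
  proof -
    have "2 / c - 2 / (c + 1) - 1 / c\<^sup>2 = (c - 1) / (c\<^sup>2 * (c + 1))"
      using c by (simp add: divide_simps) (simp add: algebra_simps power2_eq_square)
    also have "\<dots> \<ge> 0" using c by (intro divide_nonneg_nonneg mult_nonneg_nonneg) auto
    finally show ?thesis by simp
  qed
  then show ?case
    using Suc by (simp add: c_def algebra_simps)
qed simp

text \<open>A shell contributes at most \<open>26 n^2 / n^4\<close>, and only shells with
  \<open>n > r/2\<close> occur, since the Euclidean norm is at most twice the maximum norm.
  Telescoping from about \<open>r/2\<close> gives \<open>26 * 2 / (r/2)\<close>.\<close>

lemma sum_inv_sq_sq_tail:
  assumes "finite X" "\<And>k. k \<in> X \<Longrightarrow> norm (freq k) > r" "r > 0"
  shows "(\<Sum>k\<in>X. (inv_sq k)\<^sup>2) \<le> 104 / r"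
proof -
  have X0: "k \<noteq> 0" if "k \<in> X" for k
    using assms(2)[OF that] assms(3) by auto
  \<comment> \<open>The \<open>max 1\<close> provides the positive starting point that the
    telescoping bound demands, also for the conclusion \<open>real a >= r / 2\<close> with small
    \<open>r\<close>.\<close>
  define a where "a = max 1 (nat \<lceil>r / 2\<rceil>)"
  have a: "a > 0" "real a \<ge> r / 2" unfolding a_def by (simp, linarith)
  obtain b where b: "\<And>k. k \<in> X \<Longrightarrow> sup_norm k < a + b"
  proof
    fix k assume "k \<in> X"
    then have "sup_norm k \<le> (\<Sum>k\<in>X. sup_norm k)"
      using assms(1) by (intro member_le_sum) auto
    then show "sup_norm k < a + (\<Sum>k\<in>X. sup_norm k)"
      using a(1) by linarith
  qed
  have "(\<Sum>k\<in>X. (inv_sq k)\<^sup>2) \<le> (\<Sum>k\<in>X. (1 / (real (sup_norm k))\<^sup>2)\<^sup>2)"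
    by (intro sum_mono power_mono inv_sq_le_sup_norm X0) auto
  also have "\<dots> \<le> (\<Sum>n\<in>sup_norm ` X. 26 * (real n)\<^sup>2 * (1 / (real n)\<^sup>2)\<^sup>2)"
    by (rule sum_shells_le) (use assms X0 in auto)
  also have "\<dots> = (\<Sum>n\<in>sup_norm ` X. 26 * (1 / (real n)\<^sup>2))"
    by (intro sum.cong) (auto simp: power2_eq_square)
  also have "\<dots> \<le> (\<Sum>n\<in>{a..<a+b}. 26 * (1 / (real n)\<^sup>2))"
  proof (rule sum_mono2)
    show "sup_norm ` X \<subseteq> {a..<a+b}"
    proof
      fix n assume "n \<in> sup_norm ` X"
      then obtain k where k: "k \<in> X" "n = sup_norm k" by auto
      have "r < 2 * real n" using k assms(2)[of k] norm_le_sup_norm[of k] by simp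
      then have "a \<le> n" using inv_sq_le_sup_norm(2)[OF X0[OF k(1)]] k(2) unfolding a_def by linarith
      then show "n \<in> {a..<a+b}" using b[OF k(1)] k(2) by simp
    qed
  qed auto
  also have "\<dots> \<le> 26 * (2 / real a)"
    unfolding sum_distrib_left[symmetric]
  proof (rule mult_left_mono)
    show "(\<Sum>n\<in>{a..<a+b}. 1 / (real n)\<^sup>2) \<le> 2 / real a"
      by (rule order_trans[OF sum_telescope_inv_sq[OF a(1)]]) simp
  qed simp
  also have "\<dots> \<le> 26 * (2 / (r / 2))"
    using a assms(3) by (intro mult_left_mono divide_left_mono) auto
  finally show ?thesis by simp
qed

lemma inv_sq_sq_summable: "(\<lambda>k. (inv_sq k)\<^sup>2) summable_on UNIV"
proof (rule nonneg_bdd_above_summable_on)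
  show "bdd_above (sum (\<lambda>k. (inv_sq k)\<^sup>2) ` {F. F \<subseteq> UNIV \<and> finite F})"
  proof (rule bdd_aboveI2)
    fix F :: "(int^3) set" assume "F \<in> {F. F \<subseteq> UNIV \<and> finite F}"
    then have F: "finite F" by simp
    have "(\<Sum>k\<in>F. (inv_sq k)\<^sup>2) = (\<Sum>k\<in>F-{0}. (inv_sq k)\<^sup>2)"
      by (rule sum.mono_neutral_right) (use F in auto)
    \<comment> \<open>Every nonzero frequency has norm at least 1, so the tail beyond radius 1/2 is
      the whole sum.\<close>
    also have "\<dots> \<le> 104 / (1/2)"
    proof (rule sum_inv_sq_sq_tail)
      fix k assume "k \<in> F - {0}"
      then show "1/2 < norm (freq k)" using norm_freq_ge_1[of k] by auto
    qed (use F in auto)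
    finally show "(\<Sum>k\<in>F. (inv_sq k)\<^sup>2) \<le> 208" by simp
  qed
qed auto

text \<open>Twice 104 + 104: a ball and a tail estimate, for each of the two choices of the shorter
  frequency.\<close>

definition conv_const :: real where "conv_const = 416"

text \<open>The longer of \<open>l\<close> and \<open>k - l\<close> has length at least
  \<open>r/2\<close>. If the shorter one lies in the ball of radius \<open>r\<close>, the longer
  factor is at most \<open>4 / r^2\<close> and the rest sums to \<open>26 r\<close>; otherwise the
  product is at most the square of the shorter frequency's factor, summed by the tail
  estimate.\<close>

lemma sum_inv_sq_conv:
  assumes "k \<noteq> 0" "finite X"
  shows "(\<Sum>l\<in>X. inv_sq l * inv_sq (k - l)) \<le> conv_const / norm (freq k)"
proof -
  define r where "r = norm (freq k)"
  have r: "r \<ge> 1" unfolding r_def using norm_freq_ge_1[OF assms(1)] .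
  \<comment> \<open>A majorant of the product in terms of the shorter frequency \<open>m\<close>
    alone. Adding \<open>F l\<close> and \<open>F (k - l)\<close> covers both cases without
    splitting the sum.\<close>
  define F where "F m = (if norm (freq m) \<le> r then 4 / r\<^sup>2 * inv_sq m else (inv_sq m)\<^sup>2)" for m
  have F0: "F m \<ge> 0" for m unfolding F_def by simp
  have main: "inv_sq l * inv_sq (k - l) \<le> F (k - l)" if le: "norm (freq (k - l)) \<le> norm (freq l)"
    and kr: "r = norm (freq k)" for k l
  proof (cases "k = l")
    case True
    then show ?thesis using F0 by simp
  next
    case False
    then have kl: "norm (freq (k - l)) \<ge> 1" using norm_freq_ge_1[of "k - l"] by simp
    have "r \<le> norm (freq l) + norm (freq (k - l))"
      unfolding kr using norm_triangle_ineq[of "freq l" "freq (k - l)"] by simp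
    then have r2: "r \<le> 2 * norm (freq l)" using le by simp
    have 1: "inv_sq l \<le> 4 / r\<^sup>2"
    proof -
      have "inv_sq l \<le> 1 / (r / 2)\<^sup>2"
        unfolding inv_sq_def using r r2 by (intro divide_left_mono power_mono mult_pos_pos zero_less_power) auto
      then show ?thesis by (simp add: power_divide)
    qed
    have 2: "inv_sq l \<le> inv_sq (k - l)"
      unfolding inv_sq_def using kl le by (intro divide_left_mono power_mono mult_pos_pos zero_less_power) auto
    show ?thesis
      unfolding F_def power2_eq_square[of "inv_sq (k - l)"]
      using mult_right_mono[OF 1 inv_sq_nonneg[of "k - l"]] mult_right_mono[OF 2 inv_sq_nonneg[of "k - l"]]
      by simp
  qed
  have "inv_sq l * inv_sq (k - l) \<le> F l + F (k - l)" for l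
  proof (cases "norm (freq (k - l)) \<le> norm (freq l)")
    case True
    then show ?thesis using main[OF True r_def] F0[of l] by linarith
  next
    case False
    then have "inv_sq (k - l) * inv_sq (k - (k - l)) \<le> F (k - (k - l))"
      by (intro main r_def) auto
    then show ?thesis using F0[of "k - l"] by (simp add: mult.commute)
  qed
  then have "(\<Sum>l\<in>X. inv_sq l * inv_sq (k - l)) \<le> (\<Sum>l\<in>X. F l + F (k - l))"
    by (intro sum_mono)
  also have "\<dots> = (\<Sum>l\<in>X. F l) + (\<Sum>l\<in>(\<lambda>l. k - l) ` X. F l)"
    by (simp add: sum.distrib sum.reindex inj_on_def)
  also have "\<dots> \<le> 208 / r + 208 / r"
  proof -
    have "(\<Sum>l\<in>Y. F l) \<le> 208 / r" if Y: "finite Y" for Y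
    proof -
      let ?Y1 = "{l\<in>Y. norm (freq l) \<le> r}" and ?Y2 = "{l\<in>Y. \<not> norm (freq l) \<le> r}"
      have "(\<Sum>l\<in>Y. F l) = (\<Sum>l\<in>?Y1. F l) + (\<Sum>l\<in>?Y2. F l)"
        by (subst sum.union_disjoint[symmetric]) (use Y in \<open>auto intro!: sum.cong\<close>)
      also have "(\<Sum>l\<in>?Y1. F l) = 4 / r\<^sup>2 * (\<Sum>l\<in>?Y1. inv_sq l)"
        unfolding sum_distrib_left F_def by (intro sum.cong) auto
      also have "\<dots> \<le> 4 / r\<^sup>2 * (26 * r)"
        by (intro mult_left_mono sum_inv_sq_ball) (use Y r in auto)
      also have "\<dots> = 104 / r" using r by (simp add: power2_eq_square)
      also have "(\<Sum>l\<in>?Y2. F l) = (\<Sum>l\<in>?Y2. (inv_sq l)\<^sup>2)"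
        unfolding F_def by (intro sum.cong) auto
      also have "\<dots> \<le> 104 / r"
        by (intro sum_inv_sq_sq_tail) (use Y r in auto)
      finally show ?thesis by simp
    qed
    from this[of X] this[of "(\<lambda>l. k - l) ` X"] show ?thesis using assms(2) by simp
  qed
  also have "\<dots> = conv_const / r" by (simp add: conv_const_def)
  finally show ?thesis unfolding r_def .
qed

section \<open>Square-integrable functions on the unit cube\<close>

abbreviation cube_measure :: "(real^3) measure" where
  "cube_measure \<equiv> lebesgue_on unit_cube"

definition square_integrable :: "(real^3 \<Rightarrow> complex) \<Rightarrow> bool" where
  "square_integrable f \<longleftrightarrow>
     f \<in> borel_measurable cube_measure \<and> integrable cube_measure (\<lambda>x. (norm (f x))\<^sup>2)"

lemma unit_cube_sets [simp, measurable]: "unit_cube \<in> sets lebesgue" "unit_cube \<in> sets lborel" "unit_cube \<in> sets borel"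
  by (simp_all add: unit_cube_def)

lemma emeasure_unit_cube: "emeasure lborel unit_cube = 1"
proof -
  have "emeasure lborel (cbox 0 (1::real^3)) = (\<Prod>b\<in>Basis. ((1::real^3) - 0) \<bullet> b)"
    by (rule emeasure_lborel_cbox) (auto simp: Basis_vec_def inner_axis)
  also have "(\<Prod>b\<in>Basis. ((1::real^3) - 0) \<bullet> b) = (\<Prod>b\<in>(Basis::(real^3) set). 1)"
    by (rule prod.cong) (auto simp: Basis_vec_def inner_axis)
  finally show ?thesis by (simp add: unit_cube_def)
qed

lemma emeasure_cube_measure: "emeasure cube_measure (space cube_measure) = 1"
  by (simp add: emeasure_restrict_space emeasure_unit_cube)

interpretation cube: finite_measure cube_measure
  by (rule finite_measureI, subst emeasure_cube_measure) simp

lemma measure_cube [simp]: "measure lebesgue unit_cube = 1"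
  by (simp add: measure_def emeasure_unit_cube)

lemma measurable_cube_borel:
  fixes f :: "real^3 \<Rightarrow> 'b::topological_space"
  assumes "f \<in> borel_measurable borel"
  shows "f \<in> borel_measurable cube_measure"
proof (rule measurable_restrict_space1)
  show "f \<in> borel_measurable lebesgue"
    using assms by (auto intro: measurable_completion)
qed

text \<open>For Borel integrands the completed measure may be exchanged for \<open>lborel\<close>,
  whose product structure is used to compute \<open>integral_wave\<close>.\<close>

lemma integral_cube_lborel:
  fixes f :: "real^3 \<Rightarrow> 'b::{banach, second_countable_topology}"
  assumes "f \<in> borel_measurable borel"
  shows "integral\<^sup>L cube_measure f = integral\<^sup>L lborel (\<lambda>x. indicator unit_cube x *\<^sub>R f x)"
  using assms by (subst integral_restrict_space) (auto intro!: integral_completion)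

lemma integrable_cube_bounded:
  fixes f :: "real^3 \<Rightarrow> 'b::{banach, second_countable_topology}"
  assumes "f \<in> borel_measurable cube_measure" "\<And>x. x \<in> unit_cube \<Longrightarrow> norm (f x) \<le> B"
  shows "integrable cube_measure f"
  by (rule cube.integrable_const_bound[where B = B]) (use assms in \<open>auto intro!: AE_I2\<close>)

lemma square_integrable_bounded:
  assumes "f \<in> borel_measurable cube_measure" "\<And>x. x \<in> unit_cube \<Longrightarrow> norm (f x) \<le> B"
  shows "square_integrable f"
  unfolding square_integrable_def
proof
  show "integrable cube_measure (\<lambda>x. (norm (f x))\<^sup>2)"
    by (rule integrable_cube_bounded[where B = "B\<^sup>2"]) (use assms in \<open>auto intro!: power_mono\<close>)
qed (rule assms)

lemma norm_mult_le_sq: "norm (x * y :: complex) \<le> (norm x)\<^sup>2 + (norm y)\<^sup>2"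
proof -
  have "2 * norm x * norm y \<le> (norm x)\<^sup>2 + (norm y)\<^sup>2" "0 \<le> norm x * norm y"
    by (rule sum_squares_bound) simp
  then show ?thesis unfolding norm_mult by linarith
qed

lemma norm_add_sq_le: "(norm (x + y :: 'a::real_normed_vector))\<^sup>2 \<le> 2 * (norm x)\<^sup>2 + 2 * (norm y)\<^sup>2"
proof -
  have "(norm (x + y))\<^sup>2 \<le> (norm x + norm y)\<^sup>2"
    by (intro power_mono norm_triangle_ineq) auto
  also have "\<dots> \<le> 2 * (norm x)\<^sup>2 + 2 * (norm y)\<^sup>2"
    using sum_squares_bound[of "norm x" "norm y"] by (simp add: power2_sum)
  finally show ?thesis .
qed

lemma square_integrable_mult:
  assumes "square_integrable f" "square_integrable g"
  shows "integrable cube_measure (\<lambda>x. f x * g x)"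
proof (rule Bochner_Integration.integrable_bound)
  show "integrable cube_measure (\<lambda>x. (norm (f x))\<^sup>2 + (norm (g x))\<^sup>2)"
    using assms by (auto simp: square_integrable_def)
  show "AE x in cube_measure. norm (f x * g x) \<le> norm ((norm (f x))\<^sup>2 + (norm (g x))\<^sup>2)"
    using norm_mult_le_sq by (intro AE_I2) (simp add: order_trans[OF _ abs_ge_self])
qed (use assms in \<open>auto simp: square_integrable_def\<close>)

lemma square_integrable_const [simp]: "square_integrable (\<lambda>x. c)"
  by (rule square_integrable_bounded[where B = "norm c"]) auto

lemma square_integrable_integrable:
  assumes "square_integrable f"
  shows "integrable cube_measure f"
  using square_integrable_mult[OF assms square_integrable_const[of 1]] by simp

lemma square_integrable_add:
  assumes "square_integrable f" "square_integrable g"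
  shows "square_integrable (\<lambda>x. f x + g x)"
  unfolding square_integrable_def
proof
  show meas: "(\<lambda>x. f x + g x) \<in> borel_measurable cube_measure"
    using assms by (auto simp: square_integrable_def)
  show "integrable cube_measure (\<lambda>x. (norm (f x + g x))\<^sup>2)"
  proof (rule Bochner_Integration.integrable_bound)
    show "integrable cube_measure (\<lambda>x. 2 * (norm (f x))\<^sup>2 + 2 * (norm (g x))\<^sup>2)"
      using assms by (auto simp: square_integrable_def)
    show "AE x in cube_measure. norm ((norm (f x + g x))\<^sup>2) \<le> norm (2 * (norm (f x))\<^sup>2 + 2 * (norm (g x))\<^sup>2)"
      using norm_add_sq_le by (intro AE_I2) (simp add: order_trans[OF _ abs_ge_self])
  qed (use meas in auto)
qed

lemma square_integrable_mult_bounded: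
  assumes "square_integrable f" "g \<in> borel_measurable cube_measure" "\<And>x. x \<in> unit_cube \<Longrightarrow> norm (g x) \<le> B"
  shows "square_integrable (\<lambda>x. g x * f x)"
  unfolding square_integrable_def
proof
  show meas: "(\<lambda>x. g x * f x) \<in> borel_measurable cube_measure"
    using assms by (auto simp: square_integrable_def)
  show "integrable cube_measure (\<lambda>x. (norm (g x * f x))\<^sup>2)"
  proof (rule Bochner_Integration.integrable_bound)
    show "integrable cube_measure (\<lambda>x. B\<^sup>2 * (norm (f x))\<^sup>2)"
      using assms by (auto simp: square_integrable_def)
    show "AE x in cube_measure. norm ((norm (g x * f x))\<^sup>2) \<le> norm (B\<^sup>2 * (norm (f x))\<^sup>2)"
      using assms(3) by (intro AE_I2) (auto simp: norm_mult power_mult_distrib intro!: mult_right_mono power_mono)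
  qed (use meas in auto)
qed

lemma square_integrable_cmult:
  assumes "square_integrable f"
  shows "square_integrable (\<lambda>x. c * f x)"
  by (rule square_integrable_mult_bounded[where B = "norm c"]) (use assms in auto)

lemma square_integrable_diff:
  assumes "square_integrable f" "square_integrable g"
  shows "square_integrable (\<lambda>x. f x - g x)"
  using square_integrable_add[OF assms(1) square_integrable_cmult[OF assms(2), of "-1"]] by simp

lemma square_integrable_sum:
  assumes "finite F" "\<And>l. l \<in> F \<Longrightarrow> square_integrable (f l)"
  shows "square_integrable (\<lambda>x. \<Sum>l\<in>F. f l x)"
  using assms by (induction F rule: finite_induct) (auto intro: square_integrable_add)

lemma square_integrable_cnj:
  assumes "square_integrable f"
  shows "square_integrable (\<lambda>x. cnj (f x))"
proof -
  have "cnj \<in> borel_measurable borel"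
    by (intro borel_measurable_continuous_onI continuous_intros)
  from measurable_compose[OF _ this] show ?thesis
    using assms unfolding square_integrable_def complex_mod_cnj by blast
qed

subsection \<open>The trigonometric system\<close>

definition wave :: "int^3 \<Rightarrow> real^3 \<Rightarrow> complex" where
  "wave k x = cis (2 * pi * (x \<bullet> freq k))"

lemma norm_wave [simp]: "norm (wave k x) = 1"
  by (simp add: wave_def)

lemma wave_0 [simp]: "wave 0 x = 1"
  by (simp add: wave_def)

lemma wave_add: "wave (k + l) x = wave k x * wave l x"
  by (simp add: wave_def cis_mult inner_add_right distrib_left)

lemma cnj_wave: "cnj (wave k x) = wave (- k) x"
  by (simp add: wave_def cis_cnj)

lemma wave_diff: "wave (k - l) x = wave k x * cnj (wave l x)"
  using wave_add[of k "- l" x] by (simp add: cnj_wave)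

lemma continuous_wave: "continuous_on S (wave k)"
  unfolding wave_def by (intro continuous_intros)

lemma wave_borel [measurable]: "wave k \<in> borel_measurable borel"
  by (rule borel_measurable_continuous_onI) (rule continuous_wave)

lemma wave_measurable [measurable]: "wave k \<in> borel_measurable cube_measure"
  by (rule measurable_cube_borel) measurable

lemma square_integrable_wave: "square_integrable (wave k)"
  by (rule square_integrable_bounded[where B = 1]) auto

lemma integral_cis_period:
  "(LINT x:{0..1}|lborel. cis (2 * pi * real_of_int n * x)) = (if n = 0 then 1 else 0)"
proof (cases "n = 0")
  case False
  define a where "a = 2 * pi * real_of_int n"
  have a: "a \<noteq> 0" using False by (simp add: a_def)
  have der: "((\<lambda>x. cis (a * x) / (\<i> * of_real a)) has_vector_derivative cis (a * x)) (at x within {0..1})" for x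
  proof -
    have "((\<lambda>x. cis (a * x)) has_vector_derivative (a *\<^sub>R (\<i> * cis (a * x)))) (at x within {0..1})"
      by (rule has_vector_derivative_eq_rhs, rule vector_diff_chain_within[of "\<lambda>x. a * x" a x _ cis "\<i> * cis (a * x)", unfolded o_def])
        (auto intro!: derivative_eq_intros has_vector_derivative_at_within simp: has_vector_derivative_def cis_conv_exp scaleR_conv_of_real algebra_simps)
    then have "((\<lambda>x. cis (a * x) / (\<i> * of_real a)) has_vector_derivative (a *\<^sub>R (\<i> * cis (a * x))) / (\<i> * of_real a)) (at x within {0..1})"
      by (rule has_vector_derivative_divide)
    then show ?thesis using a by (simp add: scaleR_conv_of_real)
  qed
  have "(LINT x:{0..1}|lborel. cis (a * x)) = cis (a * 1) / (\<i> * of_real a) - cis (a * 0) / (\<i> * of_real a)"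
    unfolding set_lebesgue_integral_def
    by (rule integral_FTC_atLeastAtMost) (use der in \<open>auto intro!: continuous_intros\<close>)
  also have "cis (a * 1) = 1"
    unfolding a_def using cis_multiple_2pi[of "real_of_int n"] by (simp add: mult.commute mult.left_commute)
  finally show ?thesis using False by (simp add: a_def)
qed (simp add: set_integral_const)

text \<open>Cube indicator and exponential both factor over the coordinates, so the integral is a
  product of integrals over one period, each of which vanishes unless its component of
  \<open>k\<close> does.\<close>

lemma integral_wave: "integral\<^sup>L cube_measure (wave k) = (if k = 0 then 1 else 0)"
proof -
  interpret P: product_sigma_finite "\<lambda>_::real^3. lborel :: real measure" ..
  define f where "f b y = indicator {0..1} y *\<^sub>R cis (2 * pi * (freq k \<bullet> b) * y)" for b y
  have eq: "indicator unit_cube x *\<^sub>R wave k x = (\<Prod>b\<in>Basis. f b (x \<bullet> b))" for x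
  proof -
    have ind: "indicator unit_cube x = (\<Prod>b\<in>Basis. indicator {0..1} (x \<bullet> b) :: real)"
    proof -
      have "x \<in> unit_cube \<longleftrightarrow> (\<forall>b\<in>Basis. x \<bullet> b \<in> {0..1})"
        by (auto simp: unit_cube_def mem_box Basis_vec_def inner_axis)
      then show ?thesis
        by (cases "x \<in> unit_cube") (auto simp: indicator_def)
    qed
    have "wave k x = cis (\<Sum>b\<in>Basis. 2 * pi * (freq k \<bullet> b) * (x \<bullet> b))"
      unfolding wave_def by (subst euclidean_inner) (simp add: sum_distrib_left mult_ac)
    also have "\<dots> = (\<Prod>b\<in>Basis. cis (2 * pi * (freq k \<bullet> b) * (x \<bullet> b)))"
      by (simp add: cis_conv_exp exp_sum sum_distrib_left)
    finally show ?thesis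
      unfolding f_def ind by (simp add: scaleR_conv_of_real prod.distrib)
  qed
  have f_int: "integrable lborel (f b)" for b
    unfolding f_def by (rule borel_integrable_compact[of "{0..1}", unfolded set_integrable_def]) (auto intro!: continuous_intros)
  have f_val: "integral\<^sup>L lborel (f (axis i 1)) = (if k $ i = 0 then 1 else 0)" for i
    using integral_cis_period[of "k $ i"] unfolding f_def set_lebesgue_integral_def by (simp add: inner_axis)
  have "integral\<^sup>L cube_measure (wave k) = integral\<^sup>L lborel (\<lambda>x. \<Prod>b\<in>Basis. f b (x \<bullet> b))"
    by (subst integral_cube_lborel) (auto simp: eq)
  also have "\<dots> = (\<integral>x. (\<Prod>b\<in>Basis. f b (x b)) \<partial>(\<Pi>\<^sub>M b\<in>Basis. lborel))"
  proof -
    have [measurable]: "(\<lambda>x. \<Prod>b\<in>Basis. f b (x \<bullet> b)) \<in> borel_measurable borel"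
      unfolding eq[symmetric] by measurable
    show ?thesis
      by (subst lborel_eq, subst integral_distr) (auto intro!: Bochner_Integration.integral_cong prod.cong)
  qed
  also have "\<dots> = (\<Prod>b\<in>Basis. integral\<^sup>L lborel (f b))"
    by (rule P.product_integral_prod) (auto simp: f_int)
  also have "\<dots> = (\<Prod>i\<in>UNIV. if k $ i = 0 then 1 else 0)"
    unfolding Basis_vec_def by (simp add: f_val prod.reindex UNION_singleton_eq_range inj_on_def axis_eq_axis)
  also have "\<dots> = (if k = 0 then 1 else 0)"
    by (auto simp: vec_eq_iff)
  finally show ?thesis .
qed

subsection \<open>Fourier coefficients\<close>

definition fcoeff :: "(real^3 \<Rightarrow> complex) \<Rightarrow> int^3 \<Rightarrow> complex" where
  "fcoeff f k = (\<integral>x. f x * cnj (wave k x) \<partial>cube_measure)"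

lemma square_integrable_mult_wave:
  assumes "square_integrable f"
  shows "square_integrable (\<lambda>x. f x * wave k x)" "square_integrable (\<lambda>x. f x * cnj (wave k x))"
proof -
  show *: "square_integrable (\<lambda>x. f x * wave k x)" for k
    using square_integrable_mult_bounded[OF assms wave_measurable[of k], of 1] by (simp add: mult.commute)
  show "square_integrable (\<lambda>x. f x * cnj (wave k x))"
    unfolding cnj_wave by (rule *)
qed

lemma integrable_mult_wave:
  assumes "square_integrable f"
  shows "integrable cube_measure (\<lambda>x. f x * cnj (wave k x))"
  by (intro square_integrable_integrable square_integrable_mult_wave assms)

lemma fcoeff_add:
  assumes "square_integrable f" "square_integrable g"
  shows "fcoeff (\<lambda>x. f x + g x) k = fcoeff f k + fcoeff g k"
  unfolding fcoeff_def using integrable_mult_wave[OF assms(1)] integrable_mult_wave[OF assms(2)]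
  by (simp add: distrib_right)

lemma fcoeff_cmult: "fcoeff (\<lambda>x. c * f x) k = c * fcoeff f k"
  unfolding fcoeff_def by (simp add: mult.assoc)

lemma fcoeff_diff:
  assumes "square_integrable f" "square_integrable g"
  shows "fcoeff (\<lambda>x. f x - g x) k = fcoeff f k - fcoeff g k"
  using fcoeff_add[OF assms(1) square_integrable_cmult[OF assms(2), of "-1"], of k]
    fcoeff_cmult[of "-1" g k] by simp

lemma fcoeff_sum:
  assumes "finite F" "\<And>l. l \<in> F \<Longrightarrow> square_integrable (f l)"
  shows "fcoeff (\<lambda>x. \<Sum>l\<in>F. f l x) k = (\<Sum>l\<in>F. fcoeff (f l) k)"
  using assms
proof (induction F rule: finite_induct)
  case (insert l F)
  then show ?case
    by (simp add: fcoeff_add square_integrable_sum)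
qed (simp add: fcoeff_def)

lemma fcoeff_wave: "fcoeff (wave l) k = (if k = l then 1 else 0)"
  unfolding fcoeff_def wave_diff[symmetric] using integral_wave[of "l - k"] by simp

text \<open>Only uniformity in \<open>k\<close> matters, so the pointwise inequality
  \<open>|f| <= 1 + |f|^2\<close> on a cube of measure one takes the place of
  Cauchy-Schwarz.\<close>

lemma norm_fcoeff_le:
  assumes "square_integrable f"
  shows "norm (fcoeff f k) \<le> 1 + (\<integral>x. (norm (f x))\<^sup>2 \<partial>cube_measure)"
proof -
  have int: "integrable cube_measure (\<lambda>x. (norm (f x))\<^sup>2)"
    using assms by (simp add: square_integrable_def)
  have "norm (fcoeff f k) \<le> (\<integral>x. 1 + (norm (f x))\<^sup>2 \<partial>cube_measure)"
    unfolding fcoeff_def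
  proof (rule Bochner_Integration.integral_norm_bound_integral)
    show "integrable cube_measure (\<lambda>x. 1 + (norm (f x))\<^sup>2)"
      using int by simp
    fix x
    show "norm (f x * cnj (wave k x)) \<le> 1 + (norm (f x))\<^sup>2"
    proof -
      have "2 * norm (f x) \<le> 1 + (norm (f x))\<^sup>2"
        using sum_squares_bound[of 1 "norm (f x)"] by simp
      moreover have "norm (f x * cnj (wave k x)) = norm (f x)" by (simp add: norm_mult)
      ultimately show ?thesis using norm_ge_zero[of "f x"] by linarith
    qed
  qed (rule integrable_mult_wave[OF assms])
  then show ?thesis using int by (simp add: measure_restrict_space)
qed

definition partial_fourier :: "(int^3) set \<Rightarrow> (real^3 \<Rightarrow> complex) \<Rightarrow> real^3 \<Rightarrow> complex" where
  "partial_fourier F f x = (\<Sum>l\<in>F. fcoeff f l * wave l x)"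

lemma square_integrable_partial_fourier:
  assumes "finite F"
  shows "square_integrable (partial_fourier F f)"
  unfolding partial_fourier_def
  using assms by (intro square_integrable_sum square_integrable_cmult square_integrable_wave)

lemma fcoeff_partial_fourier:
  assumes "finite F"
  shows "fcoeff (partial_fourier F f) k = (if k \<in> F then fcoeff f k else 0)"
proof -
  have "fcoeff (partial_fourier F f) k = (\<Sum>l\<in>F. if k = l then fcoeff f l else 0)"
    unfolding partial_fourier_def using assms
    by (subst fcoeff_sum)
       (simp_all add: fcoeff_cmult fcoeff_wave square_integrable_cmult square_integrable_wave if_distrib[of "(*) _"] cong: if_cong)
  also have "\<dots> = (if k \<in> F then fcoeff f k else 0)"
    using assms by simp
  finally show ?thesis .
qed

definition sq_norm :: "(real^3 \<Rightarrow> complex) \<Rightarrow> real" where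
  "sq_norm f = (\<integral>x. (norm (f x))\<^sup>2 \<partial>cube_measure)"

lemma sq_norm_nonneg [simp]: "sq_norm f \<ge> 0"
  by (simp add: sq_norm_def)

lemma sq_norm_add_le:
  assumes "square_integrable f" "square_integrable g"
  shows "sq_norm (\<lambda>x. f x + g x) \<le> 2 * sq_norm f + 2 * sq_norm g"
proof -
  have "sq_norm (\<lambda>x. f x + g x) \<le> (\<integral>x. 2 * (norm (f x))\<^sup>2 + 2 * (norm (g x))\<^sup>2 \<partial>cube_measure)"
    unfolding sq_norm_def
    by (rule integral_mono) (use assms square_integrable_add[OF assms] norm_add_sq_le in \<open>auto simp: square_integrable_def\<close>)
  then show ?thesis
    using assms by (simp add: sq_norm_def square_integrable_def)
qed

lemma sq_norm_cmult: "sq_norm (\<lambda>x. c * f x) = (norm c)\<^sup>2 * sq_norm f"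
  by (simp add: sq_norm_def norm_mult power_mult_distrib)

lemma integral_mult_partial_fourier:
  assumes "finite F" "square_integrable g"
  shows "(\<integral>x. partial_fourier F f x * g x \<partial>cube_measure) = (\<Sum>l\<in>F. fcoeff f l * (\<integral>x. wave l x * g x \<partial>cube_measure))"
proof -
  have int: "integrable cube_measure (\<lambda>x. fcoeff f l * (wave l x * g x))" for l
    using square_integrable_integrable[OF square_integrable_mult_wave(1)[OF assms(2)]] by (simp add: mult.commute)
  have "(\<integral>x. partial_fourier F f x * g x \<partial>cube_measure) = (\<integral>x. (\<Sum>l\<in>F. fcoeff f l * (wave l x * g x)) \<partial>cube_measure)"
    by (simp add: partial_fourier_def sum_distrib_right mult.assoc)
  also have "\<dots> = (\<Sum>l\<in>F. fcoeff f l * (\<integral>x. wave l x * g x \<partial>cube_measure))"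
    by (subst Bochner_Integration.integral_sum) (auto simp: int)
  finally show ?thesis .
qed

text \<open>The partial Fourier sum is an orthogonal projection, so it does not increase the norm of the remainder.\<close>

lemma sq_norm_diff_partial_fourier_le:
  assumes F: "finite F" and f: "square_integrable f"
  shows "sq_norm (\<lambda>x. f x - partial_fourier F f x) \<le> sq_norm f"
proof -
  define P where "P = partial_fourier F f"
  define g where "g x = f x - P x" for x
  have P: "square_integrable P" unfolding P_def by (rule square_integrable_partial_fourier[OF F])
  have g: "square_integrable g" unfolding g_def by (rule square_integrable_diff[OF f P])
  have "fcoeff g l = 0" if "l \<in> F" for l
    unfolding g_def using that by (subst fcoeff_diff[OF f P]) (simp add: P_def fcoeff_partial_fourier[OF F])
  then have 0: "(\<integral>x. wave l x * cnj (g x) \<partial>cube_measure) = 0" if "l \<in> F" for l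
  proof -
    have "cnj (fcoeff g l) = (\<integral>x. wave l x * cnj (g x) \<partial>cube_measure)"
      unfolding fcoeff_def
      by (subst integral_bounded_linear[OF bounded_linear_cnj integrable_mult_wave[OF g], symmetric])
         (simp add: mult.commute)
    then show ?thesis using \<open>\<And>l. l \<in> F \<Longrightarrow> fcoeff g l = 0\<close>[OF that] by simp
  qed
  have orth: "(\<integral>x. P x * cnj (g x) \<partial>cube_measure) = 0"
    unfolding P_def using integral_mult_partial_fourier[OF F square_integrable_cnj[OF g], of f] 0 by simp
  have int1: "integrable cube_measure (\<lambda>x. P x * cnj (g x))"
    by (intro square_integrable_mult P square_integrable_cnj g)
  have orth': "(\<integral>x. Re (P x * cnj (g x)) \<partial>cube_measure) = 0"
    using integral_Re[OF int1] orth by simp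
  have "(norm (f x))\<^sup>2 = (norm (g x))\<^sup>2 + (norm (P x))\<^sup>2 + 2 * Re (P x * cnj (g x))" for x
  proof -
    have "(norm (f x))\<^sup>2 = (norm (g x + P x))\<^sup>2" by (simp add: g_def)
    then show ?thesis by (simp add: cmod_power2 power2_sum)
  qed
  then have "sq_norm f = (\<integral>x. (norm (g x))\<^sup>2 + (norm (P x))\<^sup>2 + 2 * Re (P x * cnj (g x)) \<partial>cube_measure)"
    by (simp add: sq_norm_def)
  also have "\<dots> = sq_norm g + sq_norm P + 2 * (\<integral>x. Re (P x * cnj (g x)) \<partial>cube_measure)"
    using g P integrable_Re[OF int1] by (simp add: square_integrable_def sq_norm_def del: times_complex.sel)
  finally have "sq_norm g \<le> sq_norm f" using orth' by simp
  then show ?thesis unfolding g_def P_def .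
qed

subsection \<open>Density of trigonometric polynomials\<close>

inductive trig_poly :: "(real^3 \<Rightarrow> complex) \<Rightarrow> bool" where
  wave: "trig_poly (wave k)"
| cmult: "trig_poly p \<Longrightarrow> trig_poly (\<lambda>x. c * p x)"
| add: "trig_poly p \<Longrightarrow> trig_poly q \<Longrightarrow> trig_poly (\<lambda>x. p x + q x)"

lemma trig_poly_const: "trig_poly (\<lambda>x. c)"
  using trig_poly.cmult[OF trig_poly.wave[of 0], of c] by simp

lemma trig_poly_wave_mult: "trig_poly p \<Longrightarrow> trig_poly (\<lambda>x. wave k x * p x)"
proof (induction rule: trig_poly.induct)
  case (wave l)
  then show ?case using trig_poly.wave[of "k + l"] by (simp add: wave_add[abs_def])
next
  case (cmult p c)
  then show ?case using trig_poly.cmult[of "\<lambda>x. wave k x * p x" c] by (simp add: mult_ac)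
next
  case (add p q)
  then show ?case using trig_poly.add[OF add.IH] by (simp add: distrib_left)
qed

lemma trig_poly_mult: "trig_poly p \<Longrightarrow> trig_poly q \<Longrightarrow> trig_poly (\<lambda>x. p x * q x)"
proof (induction rule: trig_poly.induct)
  case (wave l)
  then show ?case by (rule trig_poly_wave_mult)
next
  case (cmult p c)
  then show ?case using trig_poly.cmult[of "\<lambda>x. p x * q x" c] by (simp add: mult_ac)
next
  case (add p p')
  then show ?case using trig_poly.add[OF add.IH(1) add.IH(2)] by (simp add: distrib_right)
qed

lemma trig_poly_sum:
  "finite F \<Longrightarrow> (\<And>l. l \<in> F \<Longrightarrow> trig_poly (f l)) \<Longrightarrow> trig_poly (\<lambda>x. \<Sum>l\<in>F. f l x)"
  by (induction F rule: finite_induct) (auto intro: trig_poly_const trig_poly.add)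

lemma trig_poly_square_integrable: "trig_poly p \<Longrightarrow> square_integrable p"
  by (induction rule: trig_poly.induct)
     (auto intro: square_integrable_wave square_integrable_cmult square_integrable_add)

text \<open>The set \<open>F\<close> collects the finitely many frequencies of \<open>p\<close>. The
  claim for every larger \<open>G\<close> is what convergence along finite subsets asks for.\<close>

lemma trig_poly_partial_fourier:
  "trig_poly p \<Longrightarrow> \<exists>F. finite F \<and> (\<forall>G. finite G \<longrightarrow> F \<subseteq> G \<longrightarrow> partial_fourier G p = p)"
proof (induction rule: trig_poly.induct)
  case (wave k)
  have "partial_fourier G (wave k) = wave k" if "finite G" "k \<in> G" for G
  proof
    fix x
    have "partial_fourier G (wave k) x = (\<Sum>l\<in>G. if l = k then wave l x else 0)"
      unfolding partial_fourier_def by (intro sum.cong) (auto simp: fcoeff_wave)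
    then show "partial_fourier G (wave k) x = wave k x" using that by simp
  qed
  then show ?case by (intro exI[of _ "{k}"]) auto
next
  case (cmult p c)
  have "partial_fourier G (\<lambda>x. c * p x) x = c * partial_fourier G p x" for G x
    by (simp add: partial_fourier_def fcoeff_cmult sum_distrib_left mult.assoc)
  then have "partial_fourier G (\<lambda>x. c * p x) = (\<lambda>x. c * partial_fourier G p x)" for G
    by (rule ext)
  then show ?case using cmult.IH by metis
next
  case (add p q)
  then obtain F1 F2 where F: "finite F1" "finite F2"
      "\<And>G. finite G \<Longrightarrow> F1 \<subseteq> G \<Longrightarrow> partial_fourier G p = p"
      "\<And>G. finite G \<Longrightarrow> F2 \<subseteq> G \<Longrightarrow> partial_fourier G q = q"
    by blast
  have "partial_fourier G (\<lambda>x. p x + q x) x = partial_fourier G p x + partial_fourier G q x" for G x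
    using add.hyps
    by (simp add: partial_fourier_def fcoeff_add trig_poly_square_integrable distrib_right sum.distrib)
  then have eq: "partial_fourier G (\<lambda>x. p x + q x) = (\<lambda>x. partial_fourier G p x + partial_fourier G q x)" for G
    by (rule ext)
  show ?case
  proof (intro exI[of _ "F1 \<union> F2"] conjI allI impI)
    fix G assume "finite G" "F1 \<union> F2 \<subseteq> G"
    then show "partial_fourier G (\<lambda>x. p x + q x) = (\<lambda>x. p x + q x)"
      unfolding eq using F(3)[of G] F(4)[of G] by simp
  qed (use F in simp)
qed

definition trig_approx :: "(real^3 \<Rightarrow> complex) \<Rightarrow> bool" where
  "trig_approx f \<longleftrightarrow> (\<forall>e>0. \<exists>p. trig_poly p \<and> sq_norm (\<lambda>x. f x - p x) < e)"

lemma trig_approx_closure: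
  assumes f: "square_integrable f"
    and g: "\<And>e. e > 0 \<Longrightarrow> \<exists>g. square_integrable g \<and> trig_approx g \<and> sq_norm (\<lambda>x. f x - g x) < e"
  shows "trig_approx f"
  unfolding trig_approx_def
proof (intro allI impI)
  fix e :: real assume "e > 0"
  then obtain g where g: "square_integrable g" "trig_approx g" "sq_norm (\<lambda>x. f x - g x) < e / 4"
    using g[of "e / 4"] by auto
  then obtain p where p: "trig_poly p" "sq_norm (\<lambda>x. g x - p x) < e / 4"
    using \<open>e > 0\<close> unfolding trig_approx_def by (meson divide_pos_pos zero_less_numeral)
  have "sq_norm (\<lambda>x. (f x - g x) + (g x - p x)) \<le> 2 * sq_norm (\<lambda>x. f x - g x) + 2 * sq_norm (\<lambda>x. g x - p x)"
    by (intro sq_norm_add_le square_integrable_diff f g p trig_poly_square_integrable)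
  also have "\<dots> < e" using g(3) p(2) by linarith
  finally show "\<exists>p. trig_poly p \<and> sq_norm (\<lambda>x. f x - p x) < e"
    using p(1) by auto
qed

lemma trig_approx_limit:
  assumes s: "\<And>n::nat. square_integrable (s n)" "\<And>n. trig_approx (s n)"
    and f: "square_integrable f"
    and lim: "AE x in cube_measure. (\<lambda>n. s n x) \<longlonglongrightarrow> f x"
    and dom: "\<And>n x. x \<in> unit_cube \<Longrightarrow> norm (f x - s n x) \<le> w x"
    and w: "integrable cube_measure (\<lambda>x. (w x)\<^sup>2)"
  shows "trig_approx f"
proof (rule trig_approx_closure[OF f])
  fix e :: real assume "e > 0"
  have "(\<lambda>n. \<integral>x. (norm (f x - s n x))\<^sup>2 \<partial>cube_measure) \<longlonglongrightarrow> (\<integral>x. 0 \<partial>cube_measure)"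
  proof (rule integral_dominated_convergence[where w = "\<lambda>x. (w x)\<^sup>2"])
    show "(\<lambda>x. (norm (f x - s n x))\<^sup>2) \<in> borel_measurable cube_measure" for n
      using square_integrable_diff[OF f s(1)[of n]] unfolding square_integrable_def by auto
    show "AE x in cube_measure. (\<lambda>n. (norm (f x - s n x))\<^sup>2) \<longlonglongrightarrow> 0"
      using lim
    proof eventually_elim
      case (elim x)
      then have "(\<lambda>n. (norm (f x - s n x))\<^sup>2) \<longlonglongrightarrow> (norm (f x - f x))\<^sup>2"
        by (intro tendsto_intros)
      then show ?case by simp
    qed
    show "AE x in cube_measure. norm ((norm (f x - s n x))\<^sup>2) \<le> (w x)\<^sup>2" for n
      using dom by (intro AE_I2) (auto intro!: power_mono)
  qed (use w in auto)
  then have "(\<lambda>n. sq_norm (\<lambda>x. f x - s n x)) \<longlonglongrightarrow> 0"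
    by (simp add: sq_norm_def)
  then have "\<forall>\<^sub>F n in sequentially. sq_norm (\<lambda>x. f x - s n x) < e"
    using \<open>e > 0\<close> by (auto dest: order_tendstoD)
  then obtain n where "sq_norm (\<lambda>x. f x - s n x) < e"
    by (auto simp: eventually_sequentially)
  then show "\<exists>g. square_integrable g \<and> trig_approx g \<and> sq_norm (\<lambda>x. f x - g x) < e"
    using s by blast
qed

text \<open>The embedding of the torus into \<open>\<complex>\<^sup>3\<close>, on which Stone--Weierstrass applies.\<close>

definition torus_map :: "real^3 \<Rightarrow> complex^3" where
  "torus_map x = (\<chi> i. wave (axis i 1) x)"

lemma continuous_torus_map: "continuous_on S torus_map"
  unfolding torus_map_def by (intro continuous_on_vec_lambda continuous_wave)

lemma freq_axis [simp]: "freq (axis i 1) = axis i 1"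
  by (auto simp: vec_eq_iff axis_def)

text \<open>The real coordinates of \<open>torus_map\<close> are cosines and sines, that is,
  combinations of \<open>wave (axis i 1)\<close> and \<open>wave (- axis i 1)\<close>; products stay
  trigonometric because frequencies add.\<close>

lemma trig_poly_polynomial:
  fixes p :: "complex^3 \<Rightarrow> real"
  assumes "real_polynomial_function p"
  shows "trig_poly (\<lambda>x. complex_of_real (p (torus_map x)))"
  using assms
proof (induction rule: real_polynomial_function.induct)
  case (linear p)
  have comp: "trig_poly (\<lambda>x. complex_of_real (torus_map x \<bullet> b))" if bB: "b \<in> Basis" for b
  proof -
    obtain i c where "c \<in> Basis" and b1: "b = axis i c"
      using bB unfolding Basis_vec_def by blast
    then have b: "b = axis i c" "c = 1 \<or> c = \<i>"
      by (simp_all add: Basis_complex_def)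
    let ?w = "wave (axis i 1)" and ?w' = "wave (- axis i 1)"
    show ?thesis
    proof (cases "c = 1")
      case True
      have eq: "complex_of_real (torus_map x \<bullet> b) = 1/2 * ?w x + 1/2 * ?w' x" for x
        unfolding cnj_wave[symmetric] b(1) True inner_axis torus_map_def
        by (simp add: complex_eq_iff)
      show ?thesis unfolding eq by (intro trig_poly.intros)
    next
      case False
      then have c: "c = \<i>" using b(2) by simp
      have eq: "complex_of_real (torus_map x \<bullet> b) = (-\<i>/2) * ?w x + (\<i>/2) * ?w' x" for x
        unfolding cnj_wave[symmetric] b(1) c inner_axis torus_map_def
        by (simp add: complex_eq_iff)
      show ?thesis unfolding eq by (intro trig_poly.intros)
    qed
  qed
  have "p z = (\<Sum>b\<in>Basis. (z \<bullet> b) * p b)" for z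
  proof -
    have "p z = p (\<Sum>b\<in>Basis. (z \<bullet> b) *\<^sub>R b)" by (simp add: euclidean_representation)
    also have "\<dots> = (\<Sum>b\<in>Basis. (z \<bullet> b) * p b)"
      using linear by (simp add: linear_sum linear_scale bounded_linear.linear)
    finally show ?thesis .
  qed
  then have eq: "complex_of_real (p (torus_map x)) = (\<Sum>b\<in>Basis. complex_of_real (p b) * complex_of_real (torus_map x \<bullet> b))" for x
    by (metis (no_types, lifting) mult.commute of_real_mult of_real_sum sum.cong)
  show ?case
    unfolding eq by (intro trig_poly_sum trig_poly.cmult comp finite_Basis)
next
  case (const c)
  then show ?case by (rule trig_poly_const)
next
  case (add f g)
  then show ?case using trig_poly.add[OF add.IH] by simp
next
  case (mult f g)
  then show ?case using trig_poly_mult[OF mult.IH] by simp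
qed

text \<open>Equal images force integer differences of coordinates, and a nonzero integer difference
  inside the unit cube joins opposite faces. So \<open>torus_map\<close> is injective up to the
  boundary.\<close>

lemma torus_map_eqD:
  assumes x: "x \<in> unit_cube" and y: "y \<in> unit_cube" and eq: "torus_map x = torus_map y"
  shows "x = y \<or> (x \<notin> box 0 1 \<and> y \<notin> box 0 1)"
proof (cases "x = y")
  case False
  then obtain i where i: "x $ i \<noteq> y $ i" by (auto simp: vec_eq_iff)
  have "wave (axis i 1) x = wave (axis i 1) y"
    using arg_cong[OF eq, of "\<lambda>z. z $ i"] by (simp add: torus_map_def)
  then have "cis (2 * pi * (x $ i)) = cis (2 * pi * (y $ i))"
    by (simp add: wave_def inner_axis)
  then have "sin (2 * pi * (x $ i)) = sin (2 * pi * (y $ i)) \<and> cos (2 * pi * (x $ i)) = cos (2 * pi * (y $ i))"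
    by (simp add: complex_eq_iff)
  then obtain n :: int where "2 * pi * (x $ i) = 2 * pi * (y $ i) + 2 * pi * real_of_int n"
    unfolding sin_cos_eq_iff by blast
  then have "pi * (x $ i - y $ i - real_of_int n) = 0" by (simp add: algebra_simps)
  then have n: "x $ i - y $ i = real_of_int n" by simp
  have b: "0 \<le> x $ i" "x $ i \<le> 1" "0 \<le> y $ i" "y $ i \<le> 1"
    using x y by (auto simp: unit_cube_def mem_box_cart)
  have "n \<noteq> 0" using n i by auto
  moreover have "-1 \<le> real_of_int n" "real_of_int n \<le> 1" using n b by linarith+
  ultimately have "real_of_int n = 1 \<or> real_of_int n = -1" by linarith
  then have "\<not> (0 < x $ i \<and> x $ i < 1)" "\<not> (0 < y $ i \<and> y $ i < 1)"
    using n b by linarith+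
  then show ?thesis by (auto simp: mem_box_cart)
qed simp

lemma compact_unit_cube: "compact unit_cube"
  by (simp add: unit_cube_def)

text \<open>Vanishing on the boundary lets \<open>h\<close> descend to a function \<open>H\<close>
  on the image of \<open>torus_map\<close>. A polynomial uniformly close to \<open>H\<close> there
  pulls back to a trigonometric polynomial, and uniform closeness gives closeness in the mean
  because the cube has measure one.\<close>

lemma trig_approx_continuous:
  fixes h :: "real^3 \<Rightarrow> real"
  assumes cont: "continuous_on unit_cube h" and bd: "\<And>x. x \<in> unit_cube \<Longrightarrow> x \<notin> box 0 1 \<Longrightarrow> h x = 0"
  shows "trig_approx (\<lambda>x. complex_of_real (h x))"
proof -
  define S where "S = torus_map ` unit_cube"
  define H where "H z = h (SOME x. x \<in> unit_cube \<and> torus_map x = z)" for z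
  have H: "H (torus_map x) = h x" if x: "x \<in> unit_cube" for x
  proof -
    define y where "y = (SOME y. y \<in> unit_cube \<and> torus_map y = torus_map x)"
    have "y \<in> unit_cube \<and> torus_map y = torus_map x"
      unfolding y_def by (rule someI[of _ x]) (use x in auto)
    then have "h y = h x"
      using torus_map_eqD[of y x] x bd by auto
    then show ?thesis by (simp add: H_def y_def)
  qed
  have S: "compact S"
    unfolding S_def by (intro compact_continuous_image continuous_torus_map compact_unit_cube)
  \<comment> \<open>A continuous map from a compact space is closed: preimages of closed sets under
    \<open>H\<close> are images of compact subsets of the cube.\<close>
  have contH: "continuous_on S H"
    unfolding continuous_on_closed_vimage[OF compact_imp_closed[OF S]]
  proof (intro allI impI)
    fix B :: "real set" assume B: "closed B"
    have eq: "H -` B \<inter> S = torus_map ` (h -` B \<inter> unit_cube)"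
      unfolding S_def using H by auto
    have "closed (h -` B \<inter> unit_cube)"
      using cont B compact_imp_closed[OF compact_unit_cube] continuous_on_closed_vimage by blast
    then have "compact (h -` B \<inter> unit_cube)"
      using compact_Int_closed[OF compact_unit_cube, of "h -` B \<inter> unit_cube"] by (simp add: inf.absorb2)
    then show "closed (H -` B \<inter> S)"
      unfolding eq by (intro compact_imp_closed compact_continuous_image continuous_torus_map)
  qed
  show ?thesis
    unfolding trig_approx_def
  proof (intro allI impI)
    fix e :: real assume e: "e > 0"
    define d where "d = sqrt (e / 2)"
    have d: "d > 0" "d\<^sup>2 < e" using e by (auto simp: d_def)
    obtain p where p: "real_polynomial_function p" "\<And>z. z \<in> S \<Longrightarrow> \<bar>H z - p z\<bar> < d"
      using Stone_Weierstrass_real_polynomial_function[OF S contH d(1)] by blast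
    have tp: "trig_poly (\<lambda>x. complex_of_real (p (torus_map x)))"
      by (rule trig_poly_polynomial[OF p(1)])
    have "(\<lambda>x. complex_of_real (h x)) \<in> borel_measurable cube_measure"
      by (intro continuous_imp_measurable_on_sets_lebesgue continuous_on_of_real cont unit_cube_sets)
    moreover obtain B where B: "\<And>x. x \<in> unit_cube \<Longrightarrow> norm (h x) \<le> B"
      using compact_imp_bounded[OF compact_continuous_image[OF cont compact_unit_cube]]
      unfolding bounded_iff by auto
    ultimately have sq: "square_integrable (\<lambda>x. complex_of_real (h x) - complex_of_real (p (torus_map x)))"
      by (intro square_integrable_diff trig_poly_square_integrable[OF tp])
         (rule square_integrable_bounded[where B = B], auto)
    have "sq_norm (\<lambda>x. complex_of_real (h x) - complex_of_real (p (torus_map x))) \<le> (\<integral>x. d\<^sup>2 \<partial>cube_measure)"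
      unfolding sq_norm_def
    proof (rule integral_mono)
      fix x assume "x \<in> space cube_measure"
      then have "\<bar>h x - p (torus_map x)\<bar> \<le> d"
        using p(2)[of "torus_map x"] H[of x] by (auto simp: S_def)
      then have "(cmod (complex_of_real (h x - p (torus_map x))))\<^sup>2 \<le> d\<^sup>2"
        unfolding norm_of_real by (intro power_mono) auto
      then show "(cmod (complex_of_real (h x) - complex_of_real (p (torus_map x))))\<^sup>2 \<le> d\<^sup>2" by simp
    qed (use sq in \<open>auto simp: square_integrable_def\<close>)
    also have "\<dots> = d\<^sup>2" by (simp add: measure_restrict_space)
    finally have "sq_norm (\<lambda>x. complex_of_real (h x) - complex_of_real (p (torus_map x))) < e"
      using d(2) by simp
    then show "\<exists>p. trig_poly p \<and> sq_norm (\<lambda>x. complex_of_real (h x) - p x) < e"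
      using tp by (intro exI[of _ "\<lambda>x. complex_of_real (p (torus_map x))"]) simp
  qed
qed

lemma AE_cube_interior: "AE x in cube_measure. x \<in> box 0 1"
proof -
  have "negligible (frontier (cbox 0 (1::real^3)))"
    by (rule negligible_convex_frontier) simp
  then have "AE x in lebesgue. x \<notin> frontier (cbox 0 (1::real^3))"
    by (intro AE_not_in) (simp add: negligible_iff_null_sets)
  then have "AE x in lebesgue. x \<in> unit_cube \<longrightarrow> x \<in> box 0 1"
    by eventually_elim (auto simp: frontier_cbox unit_cube_def box_ne_empty split: if_splits)
  then show ?thesis by (simp add: AE_restrict_space_iff)
qed

text \<open>A measurable function is an almost everywhere limit of continuous ones. Clipping these
  to \<open>[-B, B]\<close> provides domination, and a cutoff near the boundary makes them
  admissible for the continuous case.\<close>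

lemma trig_approx_bounded:
  fixes f :: "real^3 \<Rightarrow> real"
  assumes f: "f \<in> borel_measurable cube_measure" and B: "\<And>x. x \<in> unit_cube \<Longrightarrow> \<bar>f x\<bar> \<le> B"
  shows "trig_approx (\<lambda>x. complex_of_real (f x))"
proof -
  have "f measurable_on unit_cube"
    using f by (simp add: measurable_on_iff_borel_measurable)
  then obtain N g where N: "negligible N" and g: "\<And>n. continuous_on UNIV (g n :: real^3 \<Rightarrow> real)"
    and lim: "\<And>x. x \<notin> N \<Longrightarrow> (\<lambda>n. g n x) \<longlonglongrightarrow> (if x \<in> unit_cube then f x else 0)"
    unfolding measurable_on_def by blast
  \<comment> \<open>Positive inside the cube and zero on its faces, so
    \<open>min 1 (real n * q x)\<close> vanishes on the boundary and is eventually 1 at each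
    interior point.\<close>
  define q where "q x = (\<Prod>i\<in>UNIV. x $ i * (1 - x $ i))" for x :: "real^3"
  define s where "s n x = max (- B) (min B (g n x)) * min 1 (real n * q x)" for n x
  have B0: "B \<ge> 0" using B[of 0] by (simp add: unit_cube_def mem_box_cart) 
  have q_cont: "continuous_on S q" for S unfolding q_def by (intro continuous_intros)
  have q0: "q x \<ge> 0" if "x \<in> unit_cube" for x
    using that unfolding q_def unit_cube_def by (intro prod_nonneg) (auto simp: mem_box_cart)
  have q_pos: "q x > 0" if "x \<in> box 0 1" for x
    using that unfolding q_def by (intro prod_pos) (auto simp: mem_box_cart)
  have q_zero: "q x = 0" if x: "x \<in> unit_cube" "x \<notin> box 0 1" for x
  proof -
    obtain i where "\<not> (0 < x $ i \<and> x $ i < 1)" using x(2) by (auto simp: mem_box_cart)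
    moreover have "0 \<le> x $ i \<and> x $ i \<le> 1" using x(1) by (auto simp: unit_cube_def mem_box_cart)
    ultimately have "x $ i * (1 - x $ i) = 0" by auto
    then show ?thesis unfolding q_def by (meson UNIV_I finite prod_zero)
  qed
  have s_cont: "continuous_on unit_cube (s n)" for n
    unfolding s_def by (intro continuous_intros q_cont continuous_on_subset[OF g]) auto
  have s_le: "\<bar>s n x\<bar> \<le> B" if "x \<in> unit_cube" for n x
  proof -
    have "\<bar>max (- B) (min B (g n x))\<bar> \<le> B" using B0 by auto
    moreover have "\<bar>min 1 (real n * q x)\<bar> \<le> 1" using q0[OF that] by auto
    ultimately have "\<bar>s n x\<bar> \<le> B * 1" unfolding s_def abs_mult using B0 by (intro mult_mono) auto
    then show ?thesis by simp
  qed
  show ?thesis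
  proof (rule trig_approx_limit[where s = "\<lambda>n x. complex_of_real (s n x)" and w = "\<lambda>_. 2 * B"])
    show "square_integrable (\<lambda>x. complex_of_real (s n x))" for n
      by (rule square_integrable_bounded[where B = B])
         (use s_le in \<open>auto intro!: borel_measurable_of_real continuous_imp_measurable_on_sets_lebesgue s_cont\<close>)
    show "trig_approx (\<lambda>x. complex_of_real (s n x))" for n
      by (rule trig_approx_continuous[OF s_cont]) (simp add: s_def q_zero)
    show "square_integrable (\<lambda>x. complex_of_real (f x))"
      by (rule square_integrable_bounded[where B = B]) (use f B in auto)
    have "AE x in lebesgue. x \<notin> N"
      using N by (intro AE_not_in) (simp add: negligible_iff_null_sets)
    then have "AE x in cube_measure. x \<notin> N"
      by (simp add: AE_restrict_space_iff) (auto elim: eventually_mono)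
    with AE_cube_interior show "AE x in cube_measure. (\<lambda>n. complex_of_real (s n x)) \<longlonglongrightarrow> complex_of_real (f x)"
    proof eventually_elim
      case (elim x)
      have xc: "x \<in> unit_cube" using elim(1) box_subset_cbox by (auto simp: unit_cube_def)
      have "\<forall>\<^sub>F n in sequentially. real n * q x \<ge> 1"
      proof -
        have "filterlim (\<lambda>n. real n * q x) at_top sequentially"
          by (rule filterlim_at_top_mult_tendsto_pos[OF tendsto_const q_pos[OF elim(1)] filterlim_real_sequentially])
        then show ?thesis by (simp add: filterlim_at_top)
      qed
      then have "\<forall>\<^sub>F n in sequentially. min 1 (real n * q x) = 1"
        by eventually_elim auto
      then have 1: "(\<lambda>n. min 1 (real n * q x)) \<longlonglongrightarrow> 1"
        by (rule tendsto_eventually)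
      have "(\<lambda>n. s n x) \<longlonglongrightarrow> max (- B) (min B (f x)) * 1"
        unfolding s_def using lim[OF elim(2)] xc by (intro tendsto_intros 1) auto
      moreover have "max (- B) (min B (f x)) = f x" using B[OF xc] by auto
      ultimately show ?case by (simp add: tendsto_of_real)
    qed
    show "norm (complex_of_real (f x) - complex_of_real (s n x)) \<le> 2 * B" if "x \<in> unit_cube" for n x
      using B[OF that] s_le[OF that, of n] by (simp flip: of_real_diff)
  qed auto
qed

lemma trig_approx_real:
  fixes f :: "real^3 \<Rightarrow> real"
  assumes f: "square_integrable (\<lambda>x. complex_of_real (f x))"
  shows "trig_approx (\<lambda>x. complex_of_real (f x))"
proof (rule trig_approx_limit[where s = "\<lambda>n x. complex_of_real (max (- real n) (min (real n) (f x)))" and w = "\<lambda>x. \<bar>f x\<bar>"])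
  have "(\<lambda>x. Re (complex_of_real (f x))) \<in> borel_measurable cube_measure"
  proof (rule measurable_compose[where g = Re])
    show "(\<lambda>x. complex_of_real (f x)) \<in> borel_measurable cube_measure"
      using f unfolding square_integrable_def by blast
  qed (intro borel_measurable_continuous_onI continuous_intros)
  then have [measurable]: "f \<in> borel_measurable cube_measure" by simp
  show "square_integrable (\<lambda>x. complex_of_real (max (- real n) (min (real n) (f x))))" for n
    by (rule square_integrable_bounded[where B = "real n"]) auto
  show "trig_approx (\<lambda>x. complex_of_real (max (- real n) (min (real n) (f x))))" for n
    by (rule trig_approx_bounded[where B = "real n"]) auto
  show "AE x in cube_measure. (\<lambda>n. complex_of_real (max (- real n) (min (real n) (f x)))) \<longlonglongrightarrow> complex_of_real (f x)"
  proof (rule AE_I2, rule tendsto_of_real, rule tendsto_eventually)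
    fix x
    obtain N :: nat where "\<bar>f x\<bar> \<le> real N" using real_arch_simple by blast
    then show "\<forall>\<^sub>F n in sequentially. max (- real n) (min (real n) (f x)) = f x"
      by (intro eventually_sequentiallyI[of N]) auto
  qed
  show "norm (complex_of_real (f x) - complex_of_real (max (- real n) (min (real n) (f x)))) \<le> \<bar>f x\<bar>" if "x \<in> unit_cube" for n x
    unfolding of_real_diff[symmetric] norm_of_real by (auto simp: max_def min_def abs_if)
  show "integrable cube_measure (\<lambda>x. \<bar>f x\<bar>\<^sup>2)"
    using f unfolding square_integrable_def by simp
qed fact

theorem trig_approx_square_integrable:
  assumes f: "square_integrable f"
  shows "trig_approx f"
  unfolding trig_approx_def
proof (intro allI impI)
  fix e :: real assume e: "e > 0"
  have meas: "f \<in> borel_measurable cube_measure" and int: "integrable cube_measure (\<lambda>x. (norm (f x))\<^sup>2)"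
    using f by (auto simp: square_integrable_def)
  have Re: "square_integrable (\<lambda>x. complex_of_real (Re (f x)))"
    unfolding square_integrable_def
    by (intro conjI Bochner_Integration.integrable_bound[OF int])
       (use meas abs_Re_le_cmod in \<open>auto simp flip: abs_le_square_iff\<close>)
  have Im: "square_integrable (\<lambda>x. complex_of_real (Im (f x)))"
    unfolding square_integrable_def
    by (intro conjI Bochner_Integration.integrable_bound[OF int])
       (use meas abs_Im_le_cmod in \<open>auto simp flip: abs_le_square_iff\<close>)
  obtain p q where p: "trig_poly p" "sq_norm (\<lambda>x. complex_of_real (Re (f x)) - p x) < e / 4"
    and q: "trig_poly q" "sq_norm (\<lambda>x. complex_of_real (Im (f x)) - q x) < e / 4"
    using trig_approx_real[OF Re] trig_approx_real[OF Im] e unfolding trig_approx_def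
    by (meson divide_pos_pos zero_less_numeral)
  have eq: "f x - (p x + \<i> * q x) = (complex_of_real (Re (f x)) - p x) + \<i> * (complex_of_real (Im (f x)) - q x)" for x
    by (simp add: complex_eq_iff)
  have "sq_norm (\<lambda>x. f x - (p x + \<i> * q x)) \<le>
      2 * sq_norm (\<lambda>x. complex_of_real (Re (f x)) - p x) + 2 * sq_norm (\<lambda>x. \<i> * (complex_of_real (Im (f x)) - q x))"
    unfolding eq by (intro sq_norm_add_le square_integrable_diff square_integrable_cmult Re Im trig_poly_square_integrable p q)
  also have "\<dots> < e"
    using p(2) q(2) by (simp only: sq_norm_cmult) simp
  finally show "\<exists>p. trig_poly p \<and> sq_norm (\<lambda>x. f x - p x) < e"
    using p(1) q(1) by (blast intro: trig_poly.intros)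
qed

section \<open>Completeness and the convolution theorem\<close>

text \<open>Once \<open>F\<close> contains the frequencies of an approximating \<open>p\<close>, the
  remainder of \<open>f\<close> equals the remainder of \<open>f - p\<close>, whose norm is at most
  that of \<open>f - p\<close>.\<close>

lemma sq_norm_partial_fourier_tendsto:
  assumes f: "square_integrable f" and e: "e > 0"
  shows "\<exists>F0. finite F0 \<and> (\<forall>F. finite F \<longrightarrow> F0 \<subseteq> F \<longrightarrow> sq_norm (\<lambda>x. f x - partial_fourier F f x) < e)"
proof -
  obtain p where p: "trig_poly p" "sq_norm (\<lambda>x. f x - p x) < e"
    using trig_approx_square_integrable[OF f] e unfolding trig_approx_def by blast
  obtain F0 where F0: "finite F0" "\<And>G. finite G \<Longrightarrow> F0 \<subseteq> G \<Longrightarrow> partial_fourier G p = p"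
    using trig_poly_partial_fourier[OF p(1)] by blast
  have ps: "square_integrable p" by (rule trig_poly_square_integrable[OF p(1)])
  have "sq_norm (\<lambda>x. f x - partial_fourier F f x) < e" if F: "finite F" "F0 \<subseteq> F" for F
  proof -
    have "partial_fourier F (\<lambda>x. f x - p x) x = partial_fourier F f x - partial_fourier F p x" for x
      unfolding partial_fourier_def by (simp add: fcoeff_diff[OF f ps] left_diff_distrib sum_subtractf)
    then have "(\<lambda>x. f x - partial_fourier F f x) = (\<lambda>x. (f x - p x) - partial_fourier F (\<lambda>x. f x - p x) x)"
      using F0(2)[OF F] by auto
    then show ?thesis
      using sq_norm_diff_partial_fourier_le[OF F(1) square_integrable_diff[OF f ps]] p(2) by simp
  qed
  then show ?thesis using F0(1) by blast
qed

text \<open>The coefficient of the product is a pairing of \<open>f\<close> with \<open>h\<close>,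
  the function \<open>g\<close> times a conjugate wave. The partial sums of the convolution are the
  same pairing with \<open>f\<close> replaced by its partial Fourier sums, which converge in the
  mean.\<close>

theorem fcoeff_mult_has_sum:
  assumes f: "square_integrable f" and g: "square_integrable g"
  shows "((\<lambda>l. fcoeff f l * fcoeff g (k - l)) has_sum fcoeff (\<lambda>x. f x * g x) k) UNIV"
proof -
  define h where "h x = g x * cnj (wave k x)" for x
  have h: "square_integrable h"
    unfolding h_def by (rule square_integrable_mult_wave(2)[OF g])
  have part: "(\<Sum>l\<in>F. fcoeff f l * fcoeff g (k - l)) = (\<integral>x. partial_fourier F f x * h x \<partial>cube_measure)" if "finite F" for F
  proof -
    have "fcoeff g (k - l) = (\<integral>x. wave l x * h x \<partial>cube_measure)" for l
      unfolding fcoeff_def h_def wave_diff by (simp add: mult_ac)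
    then show ?thesis
      by (simp add: integral_mult_partial_fourier[OF that h])
  qed
  have full: "fcoeff (\<lambda>x. f x * g x) k = (\<integral>x. f x * h x \<partial>cube_measure)"
    by (simp add: fcoeff_def h_def mult.assoc)
  show ?thesis
    unfolding has_sum_def tendsto_iff eventually_finite_subsets_at_top
  proof (intro allI impI)
    fix e :: real assume e: "e > 0"
    \<comment> \<open>The product of the remainder \<open>d\<close> and \<open>h\<close> is bounded
      by \<open>|d|^2 / s + s |h|^2\<close>. The choice of \<open>s\<close> makes the second
      integral less than \<open>e/2\<close>; \<open>F0\<close> is then taken large enough for the
      first. The added 1 excludes division by zero.\<close>
    define s where "s = e / (2 * (sq_norm h + 1))"
    have s: "s > 0" unfolding s_def using e sq_norm_nonneg[of h] by (intro divide_pos_pos mult_pos_pos add_nonneg_pos) auto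
    have sh: "s * sq_norm h < e / 2"
    proof -
      have "s * sq_norm h < s * (sq_norm h + 1)" using s by simp
      also have "\<dots> = e / 2"
      proof -
        have "sq_norm h + 1 \<noteq> 0" using sq_norm_nonneg[of h] by linarith
        moreover have "e / (2 * a) * a = e / 2" if "a \<noteq> 0" for a :: real using that by simp
        ultimately show ?thesis unfolding s_def by blast
      qed
      finally show ?thesis by simp
    qed
    obtain F0 where F0: "finite F0"
        "\<And>F. finite F \<Longrightarrow> F0 \<subseteq> F \<Longrightarrow> sq_norm (\<lambda>x. f x - partial_fourier F f x) < s * e / 2"
      using sq_norm_partial_fourier_tendsto[OF f, of "s * e / 2"] s e by auto
    show "\<exists>X. finite X \<and> X \<subseteq> UNIV \<and> (\<forall>Y. finite Y \<and> X \<subseteq> Y \<and> Y \<subseteq> UNIV \<longrightarrow>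
        dist (\<Sum>l\<in>Y. fcoeff f l * fcoeff g (k - l)) (fcoeff (\<lambda>x. f x * g x) k) < e)"
    proof (intro exI[of _ F0] conjI allI impI)
      fix Y assume "finite Y \<and> F0 \<subseteq> Y \<and> Y \<subseteq> (UNIV :: (int^3) set)"
      then have Y: "finite Y" "F0 \<subseteq> Y" by auto
      define d where "d x = f x - partial_fourier Y f x" for x
      have d: "square_integrable d"
        unfolding d_def by (intro square_integrable_diff f square_integrable_partial_fourier Y)
      have int: "integrable cube_measure (\<lambda>x. f x * h x)" "integrable cube_measure (\<lambda>x. partial_fourier Y f x * h x)"
        by (intro square_integrable_mult f h square_integrable_partial_fourier Y)+
      have "dist (\<Sum>l\<in>Y. fcoeff f l * fcoeff g (k - l)) (fcoeff (\<lambda>x. f x * g x) k) = norm (\<integral>x. d x * h x \<partial>cube_measure)"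
        unfolding part[OF Y(1)] full dist_norm d_def using int by (simp add: left_diff_distrib norm_minus_commute)
      also have "\<dots> \<le> (\<integral>x. (1 / s) * (norm (d x))\<^sup>2 + s * (norm (h x))\<^sup>2 \<partial>cube_measure)"
      proof (rule Bochner_Integration.integral_norm_bound_integral)
        show "integrable cube_measure (\<lambda>x. d x * h x)" by (rule square_integrable_mult[OF d h])
        show "integrable cube_measure (\<lambda>x. (1 / s) * (norm (d x))\<^sup>2 + s * (norm (h x))\<^sup>2)"
          using d h by (auto simp: square_integrable_def)
        fix x
        have "norm (d x) * norm (h x) = (norm (d x) / sqrt s) * (sqrt s * norm (h x))" using s by simp
        also have "\<dots> \<le> (norm (d x) / sqrt s)\<^sup>2 + (sqrt s * norm (h x))\<^sup>2"
        proof -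
          have "a * b \<le> a\<^sup>2 + b\<^sup>2" if "a \<ge> 0" "b \<ge> 0" for a b :: real
            using sum_squares_bound[of a b] mult_nonneg_nonneg[OF that] by linarith
          from this[of "norm (d x) / sqrt s" "sqrt s * norm (h x)"] show ?thesis using s by fastforce
        qed
        also have "\<dots> = (1 / s) * (norm (d x))\<^sup>2 + s * (norm (h x))\<^sup>2"
          using s by (simp add: power_divide power_mult_distrib)
        finally show "norm (d x * h x) \<le> (1 / s) * (norm (d x))\<^sup>2 + s * (norm (h x))\<^sup>2"
          by (simp add: norm_mult)
      qed
      also have "\<dots> = (1 / s) * sq_norm d + s * sq_norm h"
        using d h by (simp add: sq_norm_def square_integrable_def)
      also have "(1 / s) * sq_norm d \<le> (1 / s) * (s * e / 2)"
        using F0(2)[OF Y] s unfolding d_def by (intro mult_left_mono) auto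
      finally show "dist (\<Sum>l\<in>Y. fcoeff f l * fcoeff g (k - l)) (fcoeff (\<lambda>x. f x * g x) k) < e"
        using sh s by simp
    qed (use F0 in auto)
  qed
qed

theorem fcoeff_eq_0_imp_AE_0:
  assumes f: "square_integrable f" and 0: "\<And>k. fcoeff f k = 0"
  shows "AE x in cube_measure. f x = 0"
proof -
  have "partial_fourier F f x = 0" for F x by (simp add: partial_fourier_def 0)
  then have "sq_norm f < e" if "e > 0" for e
    using sq_norm_partial_fourier_tendsto[OF f that] by auto
  then have "sq_norm f = 0"
    using sq_norm_nonneg[of f] by (metis less_irrefl order_le_less)
  then have "AE x in cube_measure. (norm (f x))\<^sup>2 = 0"
    using f unfolding sq_norm_def square_integrable_def
    by (subst (asm) integral_nonneg_eq_0_iff_AE) auto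
  then show ?thesis by simp
qed

subsection \<open>Decay of the Fourier coefficients\<close>

text \<open>With the integrating factor \<open>exp (\<kappa> * r)\<close> the mean value inequality
  compares the growth of \<open>f\<close> with that of \<open>\<phi>\<close>. No integral of
  \<open>n\<close> is formed, so a pointwise bound on \<open>n\<close> suffices.\<close>

lemma duhamel_bound:
  fixes c n :: "real \<Rightarrow> complex"
  assumes st: "s < t" and lam: "\<kappa> > 0"
    and der: "\<And>r. r \<in> {s..t} \<Longrightarrow> (c has_vector_derivative (- of_real \<kappa> * c r - n r)) (at r)"
    and n: "\<And>r. r \<in> {s..t} \<Longrightarrow> norm (n r) \<le> \<nu>"
  shows "norm (c t) \<le> exp (- \<kappa> * (t - s)) * norm (c s) + \<nu> / \<kappa>"
proof -
  define f where "f r = exp (\<kappa> * r) *\<^sub>R c r" for r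
  define \<phi> where "\<phi> r = \<nu> / \<kappa> * exp (\<kappa> * r)" for r
  have \<nu>: "\<nu> \<ge> 0" using order_trans[OF norm_ge_zero n[of s]] st by simp
  have e: "((\<lambda>r. exp (\<kappa> * r)) has_real_derivative \<kappa> * exp (\<kappa> * r)) (at r)" for r
    by (auto intro!: derivative_eq_intros)
  have f: "(f has_vector_derivative (- (exp (\<kappa> * r) *\<^sub>R n r))) (at r)" if "r \<in> {s..t}" for r
    unfolding f_def
    by (rule has_vector_derivative_eq_rhs, rule has_vector_derivative_scaleR[OF e der[OF that]])
       (simp add: scaleR_conv_of_real algebra_simps)
  have \<phi>: "(\<phi> has_vector_derivative (\<nu> * exp (\<kappa> * r))) (at r)" for r
    unfolding \<phi>_def has_real_derivative_iff_has_vector_derivative[symmetric]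
    using lam by (auto intro!: derivative_eq_intros)
  have "norm (f t - f s) \<le> \<phi> t - \<phi> s"
  proof (rule differentiable_bound_general[OF st, where f' = "\<lambda>r. - (exp (\<kappa> * r) *\<^sub>R n r)" and \<phi>' = "\<lambda>r. \<nu> * exp (\<kappa> * r)"])
    show "continuous_on {s..t} f"
      by (rule continuous_on_vector_derivative) (use f has_vector_derivative_at_within in blast)
    show "continuous_on {s..t} \<phi>"
      unfolding \<phi>_def by (intro continuous_intros)
    show "norm (- (exp (\<kappa> * r) *\<^sub>R n r)) \<le> \<nu> * exp (\<kappa> * r)" if "s < r" "r < t" for r
      using n[of r] that by simp
  qed (use f \<phi> in auto)
  then have "norm (f t) \<le> norm (f s) + \<phi> t - \<phi> s"
    using norm_triangle_ineq2[of "f t" "f s"] by linarith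
  moreover have "\<phi> s \<ge> 0" using \<nu> lam by (simp add: \<phi>_def)
  ultimately have "exp (\<kappa> * t) * norm (c t) \<le> exp (\<kappa> * s) * norm (c s) + \<nu> / \<kappa> * exp (\<kappa> * t)"
    by (simp add: f_def \<phi>_def)
  then have "exp (- \<kappa> * t) * (exp (\<kappa> * t) * norm (c t)) \<le> exp (- \<kappa> * t) * (exp (\<kappa> * s) * norm (c s) + \<nu> / \<kappa> * exp (\<kappa> * t))"
    by (intro mult_left_mono) auto
  also have "exp (- \<kappa> * t) * (exp (\<kappa> * t) * norm (c t)) = norm (c t)"
    by (simp add: mult.assoc[symmetric] exp_add[symmetric])
  also have "exp (- \<kappa> * t) * (exp (\<kappa> * s) * norm (c s) + \<nu> / \<kappa> * exp (\<kappa> * t))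
      = (exp (- \<kappa> * t) * exp (\<kappa> * s)) * norm (c s) + \<nu> / \<kappa> * (exp (- \<kappa> * t) * exp (\<kappa> * t))"
    by (simp only: algebra_simps)
  also have "\<dots> = exp (- \<kappa> * (t - s)) * norm (c s) + \<nu> / \<kappa>"
    by (simp add: exp_add[symmetric] algebra_simps)
  finally show ?thesis .
qed

lemma infsum_finite_sum:
  fixes f :: "'a \<Rightarrow> 'b \<Rightarrow> 'c::{t2_space, topological_comm_monoid_add}"
  assumes "finite F" "\<And>x. x \<in> F \<Longrightarrow> f x summable_on S"
  shows "(\<lambda>l. \<Sum>x\<in>F. f x l) summable_on S \<and> (\<Sum>\<^sub>\<infinity>l\<in>S. \<Sum>x\<in>F. f x l) = (\<Sum>x\<in>F. infsum (f x) S)"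
  using assms by (induction F rule: finite_induct) (auto simp: summable_on_add infsum_add)

text \<open>At the critical decay the coefficients are square-summable only; the product is
  dominated by the sum of the squares.\<close>

lemma mult_summable_conv:
  fixes f g :: "int^3 \<Rightarrow> real"
  assumes "(\<lambda>l. (f l)\<^sup>2) summable_on UNIV" "(\<lambda>l. (g l)\<^sup>2) summable_on UNIV"
    and "\<And>l. f l \<ge> 0" "\<And>l. g l \<ge> 0"
  shows "(\<lambda>l. f (k - l) * g l) summable_on UNIV"
proof (rule summable_on_comparison_test)
  have "bij_betw (\<lambda>l. k - l) UNIV (UNIV :: (int^3) set)"
    by (rule bij_betw_byWitness[where f' = "\<lambda>l. k - l"]) auto
  from summable_on_reindex_bij_betw[OF this, of "\<lambda>l. (f l)\<^sup>2"]
  show "(\<lambda>l. (f (k - l))\<^sup>2 + (g l)\<^sup>2) summable_on UNIV"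
    using assms(1,2) by (intro summable_on_add) simp_all
  show "f (k - l) * g l \<le> (f (k - l))\<^sup>2 + (g l)\<^sup>2" for l
    using sum_squares_bound[of "f (k - l)" "g l"] mult_nonneg_nonneg[OF assms(3)[of "k - l"] assms(4)[of l]] by linarith
  show "0 \<le> f (k - l) * g l" for l using assms(3,4) by simp
qed

text \<open>Matrix entry of the projection onto the plane orthogonal to \<open>k\<close>, the symbol
  of the Leray projection. At \<open>k = 0\<close> division by zero yields the identity matrix, as
  it should, since constant fields are divergence-free.\<close>

definition leray :: "3 \<Rightarrow> int^3 \<Rightarrow> 3 \<Rightarrow> real" where
  "leray i k m = (if i = m then 1 else 0) - real_of_int (k $ i) * real_of_int (k $ m) / (norm (freq k))\<^sup>2"

lemma abs_leray_le: "\<bar>leray i k m\<bar> \<le> 2"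
proof -
  have "\<bar>real_of_int (k $ i)\<bar> * \<bar>real_of_int (k $ m)\<bar> \<le> norm (freq k) * norm (freq k)"
    by (intro mult_mono abs_le_norm_freq) auto
  then have "\<bar>real_of_int (k $ i) * real_of_int (k $ m) / (norm (freq k))\<^sup>2\<bar> \<le> 1"
    by (simp add: abs_mult power2_eq_square divide_le_eq_1) auto
  then have "\<bar>x - real_of_int (k $ i) * real_of_int (k $ m) / (norm (freq k))\<^sup>2\<bar> \<le> 2" if "x = 0 \<or> x = 1" for x
    using that by linarith
  then show ?thesis unfolding leray_def by simp
qed

definition convol :: "(int^3 \<Rightarrow> real \<Rightarrow> complex) \<Rightarrow> (int^3 \<Rightarrow> real \<Rightarrow> complex) \<Rightarrow> int^3 \<Rightarrow> real \<Rightarrow> complex" where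
  "convol f g k t = (\<Sum>\<^sub>\<infinity>l. f (k - l) t * g l t)"

text \<open>Fourier side of the Leray projection of the divergence of the tensor product of
  \<open>u\<close> with itself. In divergence form the derivative becomes the output frequency
  \<open>k\<close> and leaves the convolution.\<close>

definition nonlin :: "(3 \<Rightarrow> int^3 \<Rightarrow> real \<Rightarrow> complex) \<Rightarrow> 3 \<Rightarrow> int^3 \<Rightarrow> real \<Rightarrow> complex" where
  "nonlin U i k t = (\<Sum>m\<in>UNIV. \<Sum>j\<in>UNIV.
     of_real (leray i k m * (2 * pi * real_of_int (k $ j))) * \<i> * convol (U j) (U m) k t)"

lemma continuous_on_infsum:
  fixes f :: "int^3 \<Rightarrow> 'a::topological_space \<Rightarrow> 'b::banach"
  assumes "\<And>k. continuous_on S (f k)" "\<And>k z. z \<in> S \<Longrightarrow> norm (f k z) \<le> N k" "N summable_on UNIV"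
  shows "continuous_on S (\<lambda>z. \<Sum>\<^sub>\<infinity>k. f k z)"
proof (rule uniform_limit_theorem)
  show "uniform_limit S (\<lambda>F z. \<Sum>k\<in>F. f k z) (\<lambda>z. \<Sum>\<^sub>\<infinity>k. f k z) (finite_subsets_at_top UNIV)"
    by (rule Weierstrass_m_test_general) (use assms in auto)
  show "\<forall>\<^sub>F F in finite_subsets_at_top UNIV. continuous_on S (\<lambda>z. \<Sum>k\<in>F. f k z)"
    by (rule always_eventually) (use assms(1) in \<open>auto intro!: continuous_intros\<close>)
qed auto

text \<open>Kept apart from the differential equation, since the convergence of the convolutions and
  the continuity of \<open>nonlin\<close> are needed, on an interval containing time 0, in order to
  derive that equation.\<close>

locale bounded_coefficients =
  fixes U :: "3 \<Rightarrow> int^3 \<Rightarrow> real \<Rightarrow> complex" and I :: "real set" and M \<eta> K :: real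
  assumes bounded: "\<And>t k. t \<in> I \<Longrightarrow> (\<Sum>i\<in>UNIV. norm (U i k t)) \<le> M"
    and small: "\<And>t k. t \<in> I \<Longrightarrow> K \<le> norm (freq k) \<Longrightarrow> (\<Sum>i\<in>UNIV. norm (U i k t)) \<le> \<eta> * inv_sq k"
    and M_nonneg: "M \<ge> 0" and K_pos: "K > 0" and \<eta>_pos: "\<eta> > 0"
begin

text \<open>With the sum over components as norm, the products of norms summed over all pairs
  \<open>j\<close>, \<open>m\<close> equal a product of two values of \<open>A\<close>
  exactly.\<close>

definition A :: "int^3 \<Rightarrow> real \<Rightarrow> real" where "A k t = (\<Sum>i\<in>UNIV. norm (U i k t))"

text \<open>Extends the quadratic decay to all nonzero frequencies: below \<open>K\<close> one has
  \<open>1 <= K^2 / |k|^2\<close>, so \<open>M\<close> is at most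
  \<open>K^2 * M * inv_sq k\<close>.\<close>

definition Q :: real where "Q = \<eta> + K\<^sup>2 * M"

lemma A_nonneg [simp]: "A k t \<ge> 0"
  by (simp add: A_def sum_nonneg)

lemma norm_U_le: "norm (U i k t) \<le> A k t"
  unfolding A_def by (rule member_le_sum) auto

lemma A_le_M: "t \<in> I \<Longrightarrow> A k t \<le> M"
  using bounded by (simp add: A_def)

lemma A_small: "t \<in> I \<Longrightarrow> K \<le> norm (freq k) \<Longrightarrow> A k t \<le> \<eta> * inv_sq k"
  using small by (simp add: A_def)

lemma Q_pos: "Q > 0"
  unfolding Q_def using \<eta>_pos M_nonneg by (intro add_pos_nonneg mult_nonneg_nonneg) auto

lemma A_le_Q:
  assumes "t \<in> I" "k \<noteq> 0"
  shows "A k t \<le> Q * inv_sq k"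
proof (cases "K \<le> norm (freq k)")
  case True
  have "\<eta> * inv_sq k \<le> Q * inv_sq k"
    unfolding Q_def using M_nonneg by (intro mult_right_mono) auto
  then show ?thesis using A_small[OF assms(1) True] by linarith
next
  case False
  have n: "norm (freq k) \<ge> 1" by (rule norm_freq_ge_1[OF assms(2)])
  have "1 \<le> K\<^sup>2 * inv_sq k"
  proof -
    have "(norm (freq k))\<^sup>2 \<le> K\<^sup>2" using False n by (intro power_mono) auto
    moreover have "0 < (norm (freq k))\<^sup>2" using n by (intro zero_less_power) linarith
    ultimately show ?thesis by (simp add: inv_sq_def le_divide_eq_1_pos)
  qed
  then have "M * 1 \<le> M * (K\<^sup>2 * inv_sq k)" by (intro mult_left_mono M_nonneg)
  also have "\<dots> \<le> Q * inv_sq k" 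
    unfolding Q_def using \<eta>_pos by (simp add: algebra_simps)
  finally show ?thesis using A_le_M[OF assms(1), of k] by linarith
qed

lemma sq_norm_A_le_Q:
  assumes "t \<in> I"
  shows "(norm (freq k))\<^sup>2 * A k t \<le> Q"
proof (cases "k = 0")
  case False
  have "(norm (freq k))\<^sup>2 * A k t \<le> (norm (freq k))\<^sup>2 * (Q * inv_sq k)"
    by (intro mult_left_mono A_le_Q assms False) auto
  also have "\<dots> = Q" using False by (simp add: inv_sq_def)
  finally show ?thesis .
qed (use Q_pos in simp)

text \<open>A square-summable majorant independent of time, for the uniform convergence of the
  convolutions. The zero frequency needs its own term because \<open>inv_sq 0 = 0\<close>.\<close>

definition D :: "int^3 \<Rightarrow> real" where "D k = Q * inv_sq k + (if k = 0 then M else 0)"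

lemma D_nonneg [simp]: "D k \<ge> 0"
  using Q_pos M_nonneg by (simp add: D_def)

lemma A_le_D: "t \<in> I \<Longrightarrow> A k t \<le> D k"
  using A_le_Q[of t k] A_le_M[of t k] by (cases "k = 0") (auto simp: D_def)

lemma D_sq_summable: "(\<lambda>k. (D k)\<^sup>2) summable_on UNIV"
proof -
  have "(\<lambda>k. Q\<^sup>2 * (inv_sq k)\<^sup>2) summable_on UNIV"
    by (intro summable_on_cmult_right inv_sq_sq_summable)
  moreover have "(\<lambda>k. if k = 0 then M\<^sup>2 else 0) summable_on (UNIV :: (int^3) set)"
    by (subst summable_on_cong_neutral[where T = "{0}" and g = "\<lambda>k. M\<^sup>2"]) auto
  ultimately have "(\<lambda>k. Q\<^sup>2 * (inv_sq k)\<^sup>2 + (if k = 0 then M\<^sup>2 else 0)) summable_on UNIV"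
    by (rule summable_on_add)
  then show ?thesis
    by (rule summable_on_cong[THEN iffD1, rotated]) (auto simp: D_def power_mult_distrib)
qed

lemma A_conv_summable:
  assumes "t \<in> I"
  shows "(\<lambda>l. A (k - l) t * A l t) summable_on UNIV"
proof (rule summable_on_comparison_test)
  show "(\<lambda>l. D (k - l) * D l) summable_on UNIV"
    by (rule mult_summable_conv) (auto intro: D_sq_summable)
  show "A (k - l) t * A l t \<le> D (k - l) * D l" for l
    by (intro mult_mono A_le_D assms) auto
qed auto

definition A_conv :: "int^3 \<Rightarrow> real \<Rightarrow> real" where
  "A_conv k t = (\<Sum>\<^sub>\<infinity>l. A (k - l) t * A l t)"

lemma A_conv_le:
  assumes "t \<in> I" "\<And>F. finite F \<Longrightarrow> (\<Sum>l\<in>F. A (k - l) t * A l t) \<le> X"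
  shows "A_conv k t \<le> X"
  unfolding A_conv_def by (rule infsum_le_finite_sums[OF A_conv_summable[OF assms(1)]]) (use assms in auto)

lemma norm_mult_U_le: "norm (U j (k - l) t * U m l t) \<le> A (k - l) t * A l t"
  unfolding norm_mult by (intro mult_mono norm_U_le) auto

lemma U_conv_abs_summable:
  assumes "t \<in> I"
  shows "(\<lambda>l. norm (U j (k - l) t * U m l t)) summable_on UNIV"
  by (rule summable_on_comparison_test[OF A_conv_summable[OF assms, of k]]) (use norm_mult_U_le in auto)

lemma U_conv_summable:
  assumes "t \<in> I"
  shows "(\<lambda>l. U j (k - l) t * U m l t) summable_on UNIV"
  by (rule abs_summable_summable[OF U_conv_abs_summable[OF assms]])

text \<open>The projection costs a factor 2 and the derivative \<open>2 pi |k|\<close>; the sum over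
  \<open>j\<close> and \<open>m\<close> is then exactly the convolution of \<open>A\<close> with
  itself.\<close>

lemma norm_nonlin_le:
  assumes "t \<in> I"
  shows "norm (nonlin U i k t) \<le> 4 * pi * norm (freq k) * A_conv k t"
proof -
  define n where "n j l = norm (U j l t)" for j l
  have S: "(\<lambda>l. n j (k - l) * n m l) summable_on UNIV" for j m
    using U_conv_abs_summable[OF assms, of j k m] by (simp add: n_def norm_mult)
  have c: "norm (convol (U j) (U m) k t) \<le> (\<Sum>\<^sub>\<infinity>l. n j (k - l) * n m l)" for j m
    unfolding convol_def using norm_infsum_bound[OF U_conv_abs_summable[OF assms, of j k m]]
    by (simp add: n_def norm_mult)
  have "norm (nonlin U i k t) \<le> (\<Sum>m\<in>UNIV. \<Sum>j\<in>UNIV. norm (of_real (leray i k m * (2 * pi * real_of_int (k $ j))) * \<i> * convol (U j) (U m) k t))"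
    unfolding nonlin_def by (intro order_trans[OF norm_sum] sum_mono norm_sum)
  also have "\<dots> \<le> (\<Sum>m\<in>(UNIV::3 set). \<Sum>j\<in>(UNIV::3 set). 4 * pi * norm (freq k) * (\<Sum>\<^sub>\<infinity>l. n j (k - l) * n m l))"
  proof (intro sum_mono)
    fix m j :: 3
    have "norm (of_real (leray i k m * (2 * pi * real_of_int (k $ j))) * \<i> * convol (U j) (U m) k t)
        = (\<bar>leray i k m\<bar> * (2 * pi * \<bar>real_of_int (k $ j)\<bar>)) * norm (convol (U j) (U m) k t)"
      by (simp add: norm_mult abs_mult)
    also have "\<dots> \<le> (2 * (2 * pi * norm (freq k))) * (\<Sum>\<^sub>\<infinity>l. n j (k - l) * n m l)"
      by (intro mult_mono abs_leray_le abs_le_norm_freq c) auto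
    finally show "norm (of_real (leray i k m * (2 * pi * real_of_int (k $ j))) * \<i> * convol (U j) (U m) k t)
        \<le> 4 * pi * norm (freq k) * (\<Sum>\<^sub>\<infinity>l. n j (k - l) * n m l)" by simp
  qed
  also have "\<dots> = 4 * pi * norm (freq k) * (\<Sum>\<^sub>\<infinity>l. \<Sum>m\<in>UNIV. \<Sum>j\<in>UNIV. n j (k - l) * n m l)"
  proof -
    have 1: "(\<lambda>l. \<Sum>j\<in>UNIV. n j (k - l) * n m l) summable_on UNIV \<and>
        (\<Sum>\<^sub>\<infinity>l. \<Sum>j\<in>UNIV. n j (k - l) * n m l) = (\<Sum>j\<in>UNIV. \<Sum>\<^sub>\<infinity>l. n j (k - l) * n m l)" for m
      by (rule infsum_finite_sum) (auto simp: S)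
    have "(\<Sum>\<^sub>\<infinity>l. \<Sum>m\<in>UNIV. \<Sum>j\<in>UNIV. n j (k - l) * n m l) = (\<Sum>m\<in>UNIV. \<Sum>\<^sub>\<infinity>l. \<Sum>j\<in>UNIV. n j (k - l) * n m l)"
      by (rule infsum_finite_sum[THEN conjunct2]) (auto simp: 1)
    then show ?thesis by (simp add: 1 sum_distrib_left)
  qed
  also have "(\<Sum>\<^sub>\<infinity>l. \<Sum>m\<in>UNIV. \<Sum>j\<in>UNIV. n j (k - l) * n m l) = A_conv k t"
    unfolding A_conv_def A_def n_def
  proof (rule infsum_cong)
    fix l
    show "(\<Sum>m\<in>UNIV. \<Sum>j\<in>UNIV. cmod (U j (k - l) t) * cmod (U m l t)) = (\<Sum>i\<in>UNIV. cmod (U i (k - l) t)) * (\<Sum>i\<in>UNIV. cmod (U i l t))"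
      by (subst sum.swap) (simp add: sum_product)
  qed
  finally show ?thesis .
qed

text \<open>By the triangle inequality one of \<open>l\<close> and \<open>k - l\<close> has at least
  half the length of \<open>k\<close>. It is called \<open>b\<close>, so that a convolution estimate
  can be written once for both cases; \<open>s\<close> is the other one.\<close>

lemma larger_frequency:
  obtains b s where "b = l \<and> s = k - l \<or> b = k - l \<and> s = l"
    "norm (freq k) \<le> 2 * norm (freq b)"
proof -
  have k: "norm (freq k) \<le> norm (freq l) + norm (freq (k - l))"
    using norm_triangle_ineq[of "freq l" "freq (k - l)"] by simp
  show ?thesis
  proof (cases "norm (freq (k - l)) \<le> norm (freq l)")
    case True
    show ?thesis by (rule that[of l "k - l"]) (use True k in auto)
  next
    case False
    show ?thesis by (rule that[of "k - l" l]) (use False k in auto)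
  qed
qed

lemma continuous_on_convol:
  assumes "\<And>i k. continuous_on I (U i k)"
  shows "continuous_on I (convol (U j) (U m) k)"
  unfolding convol_def
proof (rule continuous_on_infsum)
  show "continuous_on I (\<lambda>t. U j (k - l) t * U m l t)" for l
    by (intro continuous_intros assms)
  show "norm (U j (k - l) t * U m l t) \<le> D (k - l) * D l" if "t \<in> I" for l t
    by (rule order_trans[OF norm_mult_U_le]) (intro mult_mono A_le_D that; simp)
  show "(\<lambda>l. D (k - l) * D l) summable_on UNIV"
    by (rule mult_summable_conv) (auto intro: D_sq_summable)
qed

lemma continuous_on_nonlin:
  assumes "\<And>i k. continuous_on I (U i k)"
  shows "continuous_on I (nonlin U i k)"
  unfolding nonlin_def by (intro continuous_intros continuous_on_convol assms)

lemma conv_const_pos: "conv_const > 0"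
  by (simp add: conv_const_def)

end

section \<open>Gain of decay for the coefficient equation\<close>

text \<open>The set \<open>I\<close> is an interval of positive times reaching down to 0. The bound
  1/32 makes the absorbed coefficient \<open>48 * \<eta> * conv_const / pi\<close> at most
  1/2.\<close>

locale fourier_navier_stokes = bounded_coefficients +
  assumes I_pos: "\<And>t. t \<in> I \<Longrightarrow> t > 0"
    and I_down: "\<And>s t. t \<in> I \<Longrightarrow> 0 < s \<Longrightarrow> s \<le> t \<Longrightarrow> s \<in> I"
    and ode: "\<And>t i k. t \<in> I \<Longrightarrow>
      (U i k has_vector_derivative (- of_real (4 * pi\<^sup>2 * (norm (freq k))\<^sup>2) * U i k t - nonlin U i k t)) (at t)"
    and \<eta>_small: "\<eta> * conv_const \<le> 1 / 32"
begin

definition low_card :: real where "low_card = real (card {l. norm (freq l) \<le> K})"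

text \<open>Interactions with a low frequency contribute \<open>8 * M * low_card / r^2\<close>,
  those with a small one \<open>\<eta> * conv_const / r\<close>; beyond \<open>K1\<close> the former
  do not exceed the latter.\<close>

definition K1 :: real where "K1 = max 1 (8 * M * low_card / (\<eta> * conv_const))"

text \<open>
  The weight sits on the larger of the two frequencies, while the smaller one is controlled by
  the smallness assumption, or by \<open>M\<close> for the finitely many low frequencies.
\<close>

lemma A_conv_weighted:
  assumes t: "t \<in> I" and R: "R \<ge> 1" and k: "k \<noteq> 0" "norm (freq k) \<ge> K1"
    and B: "\<And>l. (min (norm (freq l)) R)\<^sup>2 * (norm (freq l))\<^sup>2 * A l t \<le> B"
  shows "(min (norm (freq k)) R)\<^sup>2 * norm (freq k) * A_conv k t \<le> 8 * \<eta> * conv_const * B"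
proof -
  define r where "r = norm (freq k)"
  define w where "w l = (min (norm (freq l)) R)\<^sup>2" for l
  have r: "r \<ge> 1" unfolding r_def by (rule norm_freq_ge_1[OF k(1)])
  have wk: "w k > 0" unfolding w_def using r R by (auto simp: r_def)
  have B0: "B \<ge> 0" using B[of 0] by simp
  \<comment> \<open>Since \<open>|k| <= 2 |b|\<close>, the truncated weights satisfy
    \<open>w k <= 4 * w b\<close>, so \<open>E * inv_sq b\<close> bounds the factor at the frequency
    \<open>b\<close>.\<close>
  define E where "E = 4 * B / w k"
  have E0: "E \<ge> 0" unfolding E_def using B0 wk by simp
  define low where "low l = (if norm (freq l) \<le> K then 1 else 0 :: real)" for l
  have point: "A (k - l) t * A l t \<le> E * (\<eta> * (inv_sq l * inv_sq (k - l)) + M * (4 / r\<^sup>2) * (low l + low (k - l)))" for l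
  proof -
    obtain b s where b1: "b = l \<and> s = k - l \<or> b = k - l \<and> s = l" and b4: "norm (freq k) \<le> 2 * norm (freq b)"
      by (rule larger_frequency)
    have b2: "A (k - l) t * A l t = A b t * A s t"
      and b3: "inv_sq l * inv_sq (k - l) = inv_sq b * inv_sq s"
      using b1 by (auto simp: mult.commute)
    have b0: "b \<noteq> 0" using b4 r by (auto simp: r_def)
    have nb: "norm (freq b) \<ge> 1" by (rule norm_freq_ge_1[OF b0])
    have "min (norm (freq k)) R \<le> 2 * min (norm (freq b)) R"
      using b4 R by (auto simp: min_def)
    then have "w k \<le> (2 * min (norm (freq b)) R)\<^sup>2"
      unfolding w_def using R by (intro power_mono) auto
    then have w: "w k \<le> 4 * w b" by (simp add: w_def power_mult_distrib)
    have wb: "w b > 0" using w wk by linarith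
    have "A b t \<le> (B / w b) * inv_sq b"
    proof -
      have "w b * (norm (freq b))\<^sup>2 > 0" using wb nb by (intro mult_pos_pos zero_less_power) auto
      moreover have "A b t * (w b * (norm (freq b))\<^sup>2) \<le> B" using B[of b] by (simp add: w_def mult_ac)
      ultimately have "A b t \<le> B / (w b * (norm (freq b))\<^sup>2)" by (simp only: pos_le_divide_eq)
      then show ?thesis by (simp add: inv_sq_def)
    qed
    also have "\<dots> \<le> E * inv_sq b"
    proof (intro mult_right_mono)
      have "B / w b \<le> B / (w k / 4)"
        using w wk wb B0 by (intro divide_left_mono) auto
      then show "B / w b \<le> E" by (simp add: E_def mult.commute)
    qed simp
    finally have Ab: "A b t \<le> E * inv_sq b" .
    have As: "A s t \<le> \<eta> * inv_sq s + M * low s"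
      using A_small[OF t, of s] A_le_M[OF t, of s] \<eta>_pos M_nonneg
      by (cases "norm (freq s) \<le> K") (auto simp: low_def add_increasing)
    have ib: "inv_sq b \<le> 4 / r\<^sup>2"
    proof -
      have "inv_sq b \<le> 1 / (r / 2)\<^sup>2"
        unfolding inv_sq_def using r b4 r_def by (intro divide_left_mono power_mono mult_pos_pos zero_less_power) auto
      then show ?thesis by (simp add: power_divide)
    qed
    have low0: "low l \<ge> 0" for l by (simp add: low_def)
    have lows: "low s \<le> low l + low (k - l)"
      using b1 low0[of l] low0[of "k - l"] by auto
    have "A b t * A s t \<le> (E * inv_sq b) * (\<eta> * inv_sq s + M * low s)"
      by (intro mult_mono Ab As) (use E0 in auto)
    also have "\<dots> = E * (\<eta> * (inv_sq b * inv_sq s) + M * (inv_sq b * low s))"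
      by (simp add: algebra_simps)
    \<comment> \<open>The decay at \<open>b\<close> is used in two ways: beside a small factor it
      stays inside the lattice sum, beside a low frequency it is replaced by \<open>4 / r^2\<close>,
      because the number of such terms is bounded.\<close>
    also have "\<dots> \<le> E * (\<eta> * (inv_sq b * inv_sq s) + M * ((4 / r\<^sup>2) * (low l + low (k - l))))"
      by (intro mult_left_mono add_left_mono mult_mono ib lows E0 M_nonneg) (auto simp: low0)
    finally show ?thesis by (simp only: b2 b3 mult.assoc)
  qed
  have "A_conv k t \<le> E * (2 * \<eta> * conv_const / r)"
  proof (rule A_conv_le[OF t])
    fix F :: "(int^3) set" assume F: "finite F"
    have fin: "finite {l. norm (freq l) \<le> K}" by (rule finite_freq_le)
    have lowsum: "(\<Sum>l\<in>F. low l) \<le> low_card" if "finite F" for F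
    proof -
      have "(\<Sum>l\<in>F. low l) = real (card (F \<inter> {l. norm (freq l) \<le> K}))"
        unfolding low_def using that by (simp add: sum.If_cases)
      also have "card (F \<inter> {l. norm (freq l) \<le> K}) \<le> card {l. norm (freq l) \<le> K}"
        by (rule card_mono[OF fin]) auto
      finally show ?thesis by (simp add: low_card_def)
    qed
    have low2: "(\<Sum>l\<in>F. low (k - l)) \<le> low_card"
      using lowsum[of "(\<lambda>l. k - l) ` F"] F by (simp add: sum.reindex inj_on_def)
    have "(\<Sum>l\<in>F. A (k - l) t * A l t) \<le> (\<Sum>l\<in>F. E * (\<eta> * (inv_sq l * inv_sq (k - l)) + M * (4 / r\<^sup>2) * (low l + low (k - l))))"
      by (intro sum_mono point)
    also have "\<dots> = E * (\<eta> * (\<Sum>l\<in>F. inv_sq l * inv_sq (k - l)) + M * (4 / r\<^sup>2) * ((\<Sum>l\<in>F. low l) + (\<Sum>l\<in>F. low (k - l))))"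
      unfolding sum_distrib_left[symmetric] sum.distrib by simp
    also have "\<dots> \<le> E * (\<eta> * (conv_const / r) + M * (4 / r\<^sup>2) * (low_card + low_card))"
      using sum_inv_sq_conv[OF k(1) F] lowsum[OF F] low2 \<eta>_pos M_nonneg E0 unfolding r_def
      by (intro mult_left_mono add_mono) auto
    also have "M * (4 / r\<^sup>2) * (low_card + low_card) \<le> \<eta> * conv_const / r"
    proof -
      have "8 * M * low_card / (\<eta> * conv_const) \<le> r" using k(2) by (simp add: K1_def r_def)
      then have "8 * M * low_card \<le> r * (\<eta> * conv_const)"
        using \<eta>_pos conv_const_pos by (simp add: divide_le_eq)
      then have "8 * M * low_card / r\<^sup>2 \<le> r * (\<eta> * conv_const) / r\<^sup>2"
        by (intro divide_right_mono) auto
      then show ?thesis using r by (simp add: power2_eq_square)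
    qed
    finally show "(\<Sum>l\<in>F. A (k - l) t * A l t) \<le> E * (2 * \<eta> * conv_const / r)"
      using E0 by (simp add: mult_left_mono mult_ac)
  qed
  then have "w k * r * A_conv k t \<le> w k * r * (E * (2 * \<eta> * conv_const / r))"
    using wk r by (intro mult_left_mono) auto
  also have "\<dots> = 8 * \<eta> * conv_const * B"
    unfolding E_def using wk r by simp
  finally show ?thesis by (simp add: w_def r_def)
qed

text \<open>The factors 3 count components. Dividing \<open>4 pi X\<close> by the damping rate
  \<open>4 pi^2 |k|^2\<close> leaves \<open>X / (pi |k|^2)\<close>.\<close>

lemma decay_via_duhamel:
  assumes t: "t \<in> I" and s: "0 < s" "s < t" and k: "k \<noteq> 0"
    and conv: "\<And>r. r \<in> {s..t} \<Longrightarrow> norm (freq k) * A_conv k r \<le> X"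
  shows "A k t \<le> 3 * exp (- (4 * pi\<^sup>2 * (norm (freq k))\<^sup>2) * (t - s)) * A k s + 3 * X / (pi * (norm (freq k))\<^sup>2)"
proof -
  define c where "c = 4 * pi\<^sup>2 * (norm (freq k))\<^sup>2"
  have n: "norm (freq k) \<ge> 1" by (rule norm_freq_ge_1[OF k])
  have c: "c > 0" unfolding c_def using n by (intro mult_pos_pos zero_less_power) auto
  have I: "r \<in> I" if "r \<in> {s..t}" for r
    using I_down[OF t, of r] that s by auto
  have "norm (U i k t) \<le> exp (- c * (t - s)) * A k s + X / (pi * (norm (freq k))\<^sup>2)" for i
  proof -
    have "norm (U i k t) \<le> exp (- c * (t - s)) * norm (U i k s) + (4 * pi * X) / c"
    proof (rule duhamel_bound[OF s(2) c])
      fix r assume r: "r \<in> {s..t}"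
      show "(U i k has_vector_derivative - of_real c * U i k r - nonlin U i k r) (at r)"
        unfolding c_def by (rule ode[OF I[OF r]])
      have "norm (nonlin U i k r) \<le> 4 * pi * norm (freq k) * A_conv k r"
        by (rule norm_nonlin_le[OF I[OF r]])
      also have "\<dots> \<le> 4 * pi * X"
        using conv[OF r] by simp
      finally show "norm (nonlin U i k r) \<le> 4 * pi * X" .
    qed
    also have "(4 * pi * X) / c = X / (pi * (norm (freq k))\<^sup>2)"
      unfolding c_def by (simp add: power2_eq_square)
    also have "exp (- c * (t - s)) * norm (U i k s) \<le> exp (- c * (t - s)) * A k s"
      by (intro mult_left_mono norm_U_le) auto
    finally show ?thesis by simp
  qed
  then have "A k t \<le> (\<Sum>i\<in>(UNIV::3 set). exp (- c * (t - s)) * A k s + X / (pi * (norm (freq k))\<^sup>2))"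
    unfolding A_def[of k t] by (intro sum_mono)
  then show ?thesis by (simp add: c_def algebra_simps)
qed

lemma exp_minus_le: "x > 0 \<Longrightarrow> exp (- x) \<le> 1 / (x::real)"
proof -
  assume x: "x > 0"
  then have "x \<le> exp x" using exp_ge_add_one_self[of x] by linarith
  then show ?thesis using x by (simp add: exp_minus field_simps)
qed

text \<open>
  Truncating the weight at \<open>R\<close> makes the supremum \<open>B\<close> finite a priori; the resulting bound
  \<open>B \<le> 3 Q + B / 2 + const\<close> is uniform in \<open>R\<close>.
\<close>

lemma decay_fourth_order:
  assumes t1: "t1 \<in> I"
  shows "\<exists>C. \<forall>t\<in>{0<..t1}. \<forall>k. t * (norm (freq k))^4 * A k t \<le> C"
\<comment> \<open>The witness is fixed only by the final bound, which mentions neither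
  \<open>t0\<close> nor \<open>k0\<close>, even though \<open>R\<close> and \<open>B\<close> depend
  on \<open>k0\<close>.\<close>
proof (intro exI ballI allI)
  fix t0 :: real and k0 :: "int^3" assume t0: "t0 \<in> {0<..t1}"
  \<comment> \<open>At \<open>k0\<close> itself this truncation is inactive, so the weighted bound
    yields the full fourth power there.\<close>
  define R where "R = max 1 (norm (freq k0))"
  have R: "R \<ge> 1" by (simp add: R_def)
  define w where "w k = (min (norm (freq k)) R)\<^sup>2" for k
  have w0: "w k \<ge> 0" for k by (simp add: w_def)
  have w_le: "w k \<le> (norm (freq k))\<^sup>2" for k
    unfolding w_def using R by (intro power_mono) auto
  define g where "g = (\<lambda>(t, k). t * (w k * (norm (freq k))\<^sup>2 * A k t))"
  define B where "B = Sup (g ` ({0<..t1} \<times> UNIV))"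
  have I: "t \<in> I" if "t \<in> {0<..t1}" for t using I_down[OF t1, of t] that by auto
  have t1_pos: "t1 > 0" by (rule I_pos[OF t1])
  \<comment> \<open>Finiteness of \<open>B\<close>: the truncated weight is at most
    \<open>R^2\<close>, and the remaining \<open>|k|^2\<close> is met by the critical decay.\<close>
  have bdd: "bdd_above (g ` ({0<..t1} \<times> UNIV))"
  proof (rule bdd_aboveI2)
    fix z assume "z \<in> {0<..t1} \<times> (UNIV :: (int^3) set)"
    then obtain t k where z: "z = (t, k)" and t: "t \<in> {0<..t1}" by auto
    have wR: "w k \<le> R\<^sup>2" unfolding w_def using R by (intro power_mono) auto
    have "w k * ((norm (freq k))\<^sup>2 * A k t) \<le> R\<^sup>2 * Q"
      by (intro mult_mono wR sq_norm_A_le_Q I t) auto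
    then have "t * (w k * ((norm (freq k))\<^sup>2 * A k t)) \<le> t1 * (R\<^sup>2 * Q)"
      by (rule mult_mono[rotated]) (use t w0 in auto)
    then show "g z \<le> t1 * (R\<^sup>2 * Q)" by (simp add: g_def z mult.assoc)
  qed
  have gB: "t * (w k * (norm (freq k))\<^sup>2 * A k t) \<le> B" if "t \<in> {0<..t1}" for t k
    using cSup_upper[OF _ bdd, of "g (t, k)"] that by (force simp: g_def B_def)
  have K1: "K1 \<ge> 1" by (simp add: K1_def)
  have B0: "B \<ge> 0" using gB[of t1 0] t1_pos by simp
  have step: "t * (w k * (norm (freq k))\<^sup>2 * A k t) \<le> (3 * Q + B / 2) + t1 * (K1\<^sup>2 * K1\<^sup>2 * M)" if t: "t \<in> {0<..t1}" for t k
  proof -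
    have tp: "t > 0" "t \<le> t1" using t by auto
    have n1: "0 \<le> 3 * Q + B / 2" using B0 Q_pos by simp
    have n2: "0 \<le> t1 * (K1\<^sup>2 * K1\<^sup>2 * M)" using t1_pos M_nonneg by simp
    consider "k = 0" | "norm (freq k) < K1" | "k \<noteq> 0" "norm (freq k) \<ge> K1" by linarith
    then show ?thesis
    proof cases
      case 1
      then show ?thesis using n1 n2 by simp
    next
      case 2
      have k2: "(norm (freq k))\<^sup>2 \<le> K1\<^sup>2" using 2 by (intro power_mono) auto
      have "w k * (norm (freq k))\<^sup>2 * A k t \<le> K1\<^sup>2 * K1\<^sup>2 * M"
        by (intro mult_mono k2 order_trans[OF w_le k2] A_le_M I t) (auto simp: w0)
      then have "t * (w k * (norm (freq k))\<^sup>2 * A k t) \<le> t1 * (K1\<^sup>2 * K1\<^sup>2 * M)"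
        by (rule mult_mono[rotated]) (use tp w0 in auto)
      then show ?thesis using n1 by simp
    next
      case 3
      define r where "r = norm (freq k)"
      have r: "r \<ge> 1" using K1 3 by (simp add: r_def)
      have wk: "w k > 0" unfolding w_def using r R by (simp add: r_def)
      \<comment> \<open>On the interval from \<open>t/2\<close> to \<open>t\<close> the factor of
        time in \<open>B\<close> is at least \<open>t/2\<close>, which turns 8 into 16.\<close>
      define X where "X = 16 * \<eta> * conv_const * B / (t * w k)"
      have half: "t / 2 \<in> {0<..t1}" using tp by auto
      have conv: "norm (freq k) * A_conv k s \<le> X" if s: "s \<in> {t/2..t}" for s
      proof -
        have s': "s \<in> {0<..t1}" using s tp by auto
        have "w k * norm (freq k) * A_conv k s \<le> 8 * \<eta> * conv_const * (B / (t / 2))"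
          unfolding w_def
        proof (rule A_conv_weighted[OF I[OF s'] R 3])
          fix l
          have "(t / 2) * (w l * (norm (freq l))\<^sup>2 * A l s) \<le> s * (w l * (norm (freq l))\<^sup>2 * A l s)"
            using s w0 by (intro mult_right_mono) auto
          also have "\<dots> \<le> B" by (rule gB[OF s'])
          finally show "(min (norm (freq l)) R)\<^sup>2 * (norm (freq l))\<^sup>2 * A l s \<le> B / (t / 2)"
            using tp by (simp add: w_def field_simps)
        qed
        then have "(norm (freq k) * A_conv k s) * w k \<le> 16 * \<eta> * conv_const * B / t"
          by (simp add: mult_ac)
        then have "norm (freq k) * A_conv k s \<le> 16 * \<eta> * conv_const * B / t / w k"
          using wk by (simp only: pos_le_divide_eq)
        then show ?thesis by (simp add: X_def)
      qed
      have "A k t \<le> 3 * exp (- (4 * pi\<^sup>2 * r\<^sup>2) * (t - t / 2)) * A k (t / 2) + 3 * X / (pi * r\<^sup>2)"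
        unfolding r_def by (rule decay_via_duhamel[OF I[OF t] _ _ 3(1) conv]) (use tp in auto)
      then have "t * (w k * r\<^sup>2 * A k t) \<le> t * (w k * r\<^sup>2 * (3 * exp (- (4 * pi\<^sup>2 * r\<^sup>2) * (t - t / 2)) * A k (t / 2) + 3 * X / (pi * r\<^sup>2)))"
        using tp w0 by (intro mult_left_mono) auto
      also have "\<dots> = 3 * ((t * w k * exp (- (2 * pi\<^sup>2 * r\<^sup>2 * t))) * (r\<^sup>2 * A k (t / 2))) + 48 * (\<eta> * conv_const) * B / pi"
      proof -
        have "t * (w k * r\<^sup>2 * (3 * X / (pi * r\<^sup>2))) = 48 * (\<eta> * conv_const) * B / pi"
          unfolding X_def using tp wk r by (simp add: field_simps)
        moreover have "- (4 * pi\<^sup>2 * r\<^sup>2) * (t - t / 2) = - (2 * pi\<^sup>2 * r\<^sup>2 * t)" by simp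
        ultimately show ?thesis by (simp only: distrib_left) (simp only: mult_ac)
      qed
      \<comment> \<open>Heat smoothing over half the time: \<open>t * w k\<close> is at most the
        exponent \<open>y\<close>, and \<open>y * exp (- y) <= 1\<close>. The two extra orders of
        the linear part are thus paid for by the factor \<open>t\<close>.\<close>
      also have "(t * w k * exp (- (2 * pi\<^sup>2 * r\<^sup>2 * t))) * (r\<^sup>2 * A k (t / 2)) \<le> 1 * Q"
      proof (intro mult_mono)
        show "r\<^sup>2 * A k (t / 2) \<le> Q" unfolding r_def by (rule sq_norm_A_le_Q[OF I[OF half]])
        define y where "y = 2 * pi\<^sup>2 * r\<^sup>2 * t"
        have y: "y > 0" unfolding y_def using r tp by (intro mult_pos_pos zero_less_power) auto
        have ly: "t * w k \<le> y"
        proof -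
          have "1 * 1 \<le> pi * pi" using pi_gt3 by (intro mult_mono) auto
          then have "1 * (r\<^sup>2 * t) \<le> (2 * pi\<^sup>2) * (r\<^sup>2 * t)"
            using tp by (intro mult_right_mono) (auto simp: power2_eq_square)
          moreover have "t * w k \<le> t * r\<^sup>2"
            using w_le[of k] tp unfolding r_def by (intro mult_left_mono) auto
          ultimately show ?thesis unfolding y_def by (simp add: mult_ac)
        qed
        have "t * w k * exp (- y) \<le> y * (1 / y)"
          by (intro mult_mono ly exp_minus_le y) (use y in auto)
        also have "y * (1 / y) = 1" using y by simp
        finally show "t * w k * exp (- (2 * pi\<^sup>2 * r\<^sup>2 * t)) \<le> 1" by (simp only: y_def)
      qed (use tp w0 in auto)
      also have "48 * (\<eta> * conv_const) * B / pi \<le> B / 2"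
      proof -
        have "48 * (\<eta> * conv_const) * B \<le> (3/2) * B"
        proof (rule mult_right_mono[OF _ B0])
          show "48 * (\<eta> * conv_const) \<le> 3/2" using \<eta>_small by linarith
        qed
        also have "\<dots> \<le> (pi / 2) * B" using pi_gt3 B0 by (intro mult_right_mono) auto
        finally show ?thesis by (simp add: divide_le_eq mult.commute)
      qed
      finally show ?thesis using n2 by (simp add: r_def)
    qed
  qed
  \<comment> \<open>The three summands come from the linear part, the nonlinear part and the
    frequencies below \<open>K1\<close>. As \<open>B\<close> is a real number, \<open>B / 2\<close>
    can be moved to the left.\<close>
  have "B \<le> (3 * Q + B / 2) + t1 * (K1\<^sup>2 * K1\<^sup>2 * M)"
    unfolding B_def
  proof (rule cSup_least)
    show "g ` ({0<..t1} \<times> UNIV) \<noteq> {}" using t1_pos by auto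
    fix x assume "x \<in> g ` ({0<..t1} \<times> UNIV)"
    then show "x \<le> (3 * Q + Sup (g ` ({0<..t1} \<times> UNIV)) / 2) + t1 * (K1\<^sup>2 * K1\<^sup>2 * M)"
      using step by (auto simp: g_def B_def)
  qed
  then have B_le: "B \<le> 6 * Q + 2 * t1 * (K1\<^sup>2 * K1\<^sup>2 * M)" by simp
  have "w k0 = (norm (freq k0))\<^sup>2" unfolding w_def R_def by simp
  then have "t0 * (norm (freq k0))^4 * A k0 t0 = t0 * (w k0 * (norm (freq k0))\<^sup>2 * A k0 t0)"
    by (simp add: power4_eq_xxxx power2_eq_square mult_ac)
  also have "\<dots> \<le> B" by (rule gB[OF t0])
  finally show "t0 * (norm (freq k0))^4 * A k0 t0 \<le> 6 * Q + 2 * t1 * (K1\<^sup>2 * K1\<^sup>2 * M)"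
    using B_le by linarith
qed

text \<open>The fourth-order decay beats the dimension three. From here on this absolute summability
  takes over the role of the smallness assumption.\<close>

lemma A_sum_bounded:
  assumes a: "0 < a" "a \<le> b" "b \<in> I"
  shows "\<exists>S\<ge>0. \<forall>t\<in>{a..b}. \<forall>F. finite F \<longrightarrow> (\<Sum>l\<in>F. A l t) \<le> S"
proof -
  obtain C where C: "\<And>t k. t \<in> {0<..b} \<Longrightarrow> t * (norm (freq k))^4 * A k t \<le> C"
    using decay_fourth_order[OF a(3)] by blast
  have C0: "C \<ge> 0" using C[of a 0] a by simp
  define Z where "Z = (\<Sum>\<^sub>\<infinity>k. (inv_sq k)\<^sup>2)"
  have Z0: "Z \<ge> 0" unfolding Z_def by (rule infsum_nonneg) auto
  have "(\<Sum>l\<in>F. A l t) \<le> M + C / a * Z" if t: "t \<in> {a..b}" and F: "finite F" for t F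
  proof -
    have tI: "t \<in> I" using I_down[OF a(3), of t] t a by auto
    have "A l t \<le> (if l = 0 then M else 0) + C / a * (inv_sq l)\<^sup>2" for l
    proof (cases "l = 0")
      case False
      have n: "(norm (freq l))^4 > 0" using norm_freq_ge_1[OF False] by (intro zero_less_power) auto
      have "a * (norm (freq l))^4 * A l t \<le> t * (norm (freq l))^4 * A l t"
        using t by (intro mult_right_mono) auto
      also have "\<dots> \<le> C" using t a by (intro C) auto
      finally have "A l t * (a * (norm (freq l))^4) \<le> C" by (simp add: mult_ac)
      then have "A l t \<le> C / (a * (norm (freq l))^4)"
        using n a by (simp only: pos_le_divide_eq mult_pos_pos)
      then show ?thesis using False by (simp add: inv_sq_def power_divide flip: power_mult)
    qed (use A_le_M[OF tI] in simp)
    then have "(\<Sum>l\<in>F. A l t) \<le> (\<Sum>l\<in>F. (if l = 0 then M else 0) + C / a * (inv_sq l)\<^sup>2)"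
      by (intro sum_mono)
    also have "\<dots> = (\<Sum>l\<in>F. if l = 0 then M else 0) + C / a * (\<Sum>l\<in>F. (inv_sq l)\<^sup>2)"
      by (simp add: sum.distrib sum_distrib_left)
    also have "\<dots> \<le> M + C / a * Z"
    proof (intro add_mono mult_left_mono)
      show "(\<Sum>l\<in>F. if l = 0 then M else 0) \<le> M" using F M_nonneg by simp
      show "(\<Sum>l\<in>F. (inv_sq l)\<^sup>2) \<le> Z"
        unfolding Z_def by (rule finite_sum_le_infsum) (use F inv_sq_sq_summable in auto)
    qed (use C0 a in auto)
    finally show ?thesis .
  qed
  moreover have "M + C / a * Z \<ge> 0" using M_nonneg C0 Z0 a by simp
  ultimately show ?thesis by blast
qed

text \<open>In the convolution the weight \<open>|k|^p <= (2 |b|)^p\<close> goes to the longer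
  frequency and the other factor is summed, so decay of order \<open>p\<close> is inherited.
  Derivative and damping together then gain one power. Each round starts from the larger interval
  \<open>{a/2..b}\<close>, which is why \<open>a\<close> is quantified inside the induction.\<close>

lemma decay_any_order:
  assumes b: "b \<in> I"
  shows "\<forall>a. 0 < a \<longrightarrow> a \<le> b \<longrightarrow> (\<exists>C\<ge>0. \<forall>t\<in>{a..b}. \<forall>k. (norm (freq k)) ^ (m + 4) * A k t \<le> C)"
proof (induction m)
  case 0
  show ?case
  proof (intro allI impI)
    fix a assume a: "0 < a" "a \<le> b"
    obtain C where C: "\<And>t k. t \<in> {0<..b} \<Longrightarrow> t * (norm (freq k))^4 * A k t \<le> C"
      using decay_fourth_order[OF b] by blast
    have "(norm (freq k)) ^ (0 + 4) * A k t \<le> C / a" if t: "t \<in> {a..b}" for t k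
    proof -
      have "a * (norm (freq k))^4 * A k t \<le> t * (norm (freq k))^4 * A k t"
        using t by (intro mult_right_mono) auto
      also have "\<dots> \<le> C" using t a by (intro C) auto
      finally show ?thesis using a by (simp add: field_simps)
    qed
    moreover have "C / a \<ge> 0" using C[of a 0] a by simp
    ultimately show "\<exists>C\<ge>0. \<forall>t\<in>{a..b}. \<forall>k. (norm (freq k)) ^ (0 + 4) * A k t \<le> C" by blast
  qed
next
  case (Suc m)
  define p where "p = m + 4"
  show ?case
  proof (intro allI impI)
    fix a assume a: "0 < a" "a \<le> b"
    have a2: "0 < a / 2" "a / 2 \<le> b" using a by auto
    obtain C where C0: "C \<ge> 0" and C: "\<And>t k. t \<in> {a/2..b} \<Longrightarrow> (norm (freq k)) ^ p * A k t \<le> C"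
      using Suc.IH[rule_format, OF a2] unfolding p_def by auto
    obtain S where S0: "S \<ge> 0" and S: "\<And>t F. t \<in> {a/2..b} \<Longrightarrow> finite F \<Longrightarrow> (\<Sum>l\<in>F. A l t) \<le> S"
      using A_sum_bounded[OF a2 b] by blast
    have I: "t \<in> I" if "t \<in> {a/2..b}" for t using I_down[OF b, of t] that a by auto
    define Y where "Y = 2 ^ p * C * (2 * S)"
    have conv: "(norm (freq k)) ^ p * A_conv k t \<le> Y" if t: "t \<in> {a/2..b}" and k: "k \<noteq> 0" for t k
    proof -
      have np: "(norm (freq k)) ^ p > 0" using norm_freq_ge_1[OF k] by (intro zero_less_power) auto
      have "A_conv k t \<le> Y / (norm (freq k)) ^ p"
      proof (rule A_conv_le[OF I[OF t]])
        fix F :: "(int^3) set" assume F: "finite F"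
        have "(norm (freq k)) ^ p * (A (k - l) t * A l t) \<le> 2 ^ p * C * (A l t + A (k - l) t)" for l
        proof -
          obtain b s where bs: "b = l \<and> s = k - l \<or> b = k - l \<and> s = l" "norm (freq k) \<le> 2 * norm (freq b)"
            by (rule larger_frequency)
          have "(norm (freq k)) ^ p * (A b t * A s t) \<le> (2 * norm (freq b)) ^ p * (A b t * A s t)"
            using bs(2) by (intro mult_right_mono power_mono) auto
          also have "\<dots> = 2 ^ p * ((norm (freq b)) ^ p * A b t) * A s t"
            by (simp add: power_mult_distrib mult_ac)
          also have "\<dots> \<le> 2 ^ p * C * A s t"
            using C[OF t, of b] by (intro mult_right_mono mult_left_mono) auto
          also have "\<dots> \<le> 2 ^ p * C * (A l t + A (k - l) t)"
            using bs(1) C0 by (intro mult_left_mono) auto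
          finally show ?thesis using bs(1) by (auto simp: mult.commute)
        qed
        then have "(\<Sum>l\<in>F. (norm (freq k)) ^ p * (A (k - l) t * A l t)) \<le> (\<Sum>l\<in>F. 2 ^ p * C * (A l t + A (k - l) t))"
          by (intro sum_mono)
        also have "\<dots> = 2 ^ p * C * ((\<Sum>l\<in>F. A l t) + (\<Sum>l\<in>(\<lambda>l. k - l) ` F. A l t))"
          unfolding sum_distrib_left[symmetric] sum.distrib by (simp add: sum.reindex inj_on_def)
        also have "\<dots> \<le> 2 ^ p * C * (S + S)"
          using F S[OF t] C0 by (intro mult_left_mono add_mono) auto
        finally have "(\<Sum>l\<in>F. A (k - l) t * A l t) * (norm (freq k)) ^ p \<le> Y"
          unfolding Y_def by (simp add: sum_distrib_left[symmetric] mult.commute)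
        then show "(\<Sum>l\<in>F. A (k - l) t * A l t) \<le> Y / (norm (freq k)) ^ p"
          using np by (simp only: pos_le_divide_eq)
      qed
      then show ?thesis using np by (simp add: pos_le_divide_eq mult.commute)
    qed
    have Y0: "Y \<ge> 0" unfolding Y_def using C0 S0 by simp
    define C' where "C' = 3 * (C / (2 * pi\<^sup>2 * a)) + 3 * Y / pi"
    have C'0: "C' \<ge> 0" unfolding C'_def using C0 Y0 a by simp
    have "(norm (freq k)) ^ (Suc m + 4) * A k t \<le> C'" if t: "t \<in> {a..b}" for t k
    proof (cases "k = 0")
      case True
      then show ?thesis using C'0 by (simp add: power_0_left)
    next
      case False
      define r where "r = norm (freq k)"
      have r: "r \<ge> 1" unfolding r_def by (rule norm_freq_ge_1[OF False])
      \<comment> \<open>A fixed distance back in time: it remains in \<open>{a/2..b}\<close> and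
        leaves enough damping for the linear part to gain its power of \<open>r\<close>.\<close>
      define s where "s = t - a / 2"
      have s: "0 < s" "s < t" "s \<in> {a/2..b}" using t a by (auto simp: s_def)
      have tI: "t \<in> I" using I t a by auto
      define E where "E = exp (- (4 * pi\<^sup>2 * r\<^sup>2) * (t - s))"
      have E: "r * E \<le> 1 / (2 * pi\<^sup>2 * a)"
      proof -
        have y: "2 * pi\<^sup>2 * r\<^sup>2 * a > 0" using r a by (intro mult_pos_pos zero_less_power) auto
        have "E = exp (- (2 * pi\<^sup>2 * r\<^sup>2 * a))" unfolding E_def s_def by simp
        also have "\<dots> \<le> 1 / (2 * pi\<^sup>2 * r\<^sup>2 * a)" by (rule exp_minus_le[OF y])
        finally have "r * E \<le> r * (1 / (2 * pi\<^sup>2 * r\<^sup>2 * a))" using r by (intro mult_left_mono) auto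
        also have "\<dots> = (1 / (2 * pi\<^sup>2 * a)) * (1 / r)" using r by (simp add: power2_eq_square)
        also have "\<dots> \<le> (1 / (2 * pi\<^sup>2 * a)) * 1" using r a by (intro mult_left_mono) auto
        finally show ?thesis by simp
      qed
      have "A k t \<le> 3 * E * A k s + 3 * (r * (Y / r ^ p)) / (pi * r\<^sup>2)"
        unfolding E_def r_def
      proof (rule decay_via_duhamel[OF tI s(1,2) False])
        fix q assume "q \<in> {s..t}"
        then have q: "q \<in> {a/2..b}" using s t by auto
        have "A_conv k q \<le> Y / r ^ p"
        proof -
          have "r ^ p > 0" using r by (intro zero_less_power) auto
          then show ?thesis using conv[OF q False] by (simp add: pos_le_divide_eq r_def mult.commute)
        qed
        then show "norm (freq k) * A_conv k q \<le> norm (freq k) * (Y / norm (freq k) ^ p)"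
          unfolding r_def by (intro mult_left_mono) auto
      qed
      then have "r ^ Suc p * A k t \<le> r ^ Suc p * (3 * E * A k s + 3 * (r * (Y / r ^ p)) / (pi * r\<^sup>2))"
        using r by (intro mult_left_mono) auto
      also have "\<dots> = 3 * ((r * E) * (r ^ p * A k s)) + 3 * Y / pi"
        using r by (simp add: field_simps power2_eq_square)
      also have "(r * E) * (r ^ p * A k s) \<le> (1 / (2 * pi\<^sup>2 * a)) * C"
        using C[OF s(3), of k] a r unfolding r_def[symmetric] by (intro mult_mono E) auto
      finally show ?thesis unfolding C'_def r_def p_def by simp
    qed
    then show "\<exists>C\<ge>0. \<forall>t\<in>{a..b}. \<forall>k. (norm (freq k)) ^ (Suc m + 4) * A k t \<le> C"
      using C'0 by blast
  qed
qed

theorem rapid_decay: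
  assumes "0 < a" "a \<le> b" "b \<in> I"
  shows "\<exists>C. \<forall>t\<in>{a..b}. \<forall>k. (1 + norm (freq k)) ^ m * A k t \<le> C"
proof -
  obtain C where C0: "C \<ge> 0" and C: "\<And>t k. t \<in> {a..b} \<Longrightarrow> (norm (freq k)) ^ (m + 4) * A k t \<le> C"
    using decay_any_order[OF assms(3), of m, rule_format, OF assms(1,2)] by auto
  have "(1 + norm (freq k)) ^ m * A k t \<le> M + 2 ^ m * C" if t: "t \<in> {a..b}" for t k
  proof (cases "k = 0")
    case True
    have "t \<in> I" using I_down[OF assms(3), of t] t assms by auto
    then show ?thesis using A_le_M[of t k] True C0 by (simp add: add_increasing2)
  next
    case False
    define r where "r = norm (freq k)"
    have r: "r \<ge> 1" unfolding r_def by (rule norm_freq_ge_1[OF False])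
    have "(1 + r) ^ m \<le> (2 * r) ^ m" using r by (intro power_mono) auto
    also have "\<dots> = 2 ^ m * r ^ m" by (simp add: power_mult_distrib)
    also have "\<dots> \<le> 2 ^ m * r ^ (m + 4)" using r by (intro mult_left_mono power_increasing) auto
    finally have "(1 + r) ^ m * A k t \<le> 2 ^ m * (r ^ (m + 4) * A k t)"
      unfolding mult.assoc[symmetric] by (intro mult_right_mono) auto
    also have "\<dots> \<le> 2 ^ m * C" unfolding r_def by (intro mult_left_mono C t) auto
    finally show ?thesis using M_nonneg unfolding r_def by simp
  qed
  then show ?thesis by blast
qed

end

subsection \<open>Smooth families of Fourier coefficients\<close>

text \<open>An enumeration of the lattice reduces the claim to termwise differentiation of a
  sequential series. The majorant \<open>N\<close> makes the derivatives converge uniformly in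
  operator norm, and absolute convergence identifies the sequential sums with the unordered
  ones.\<close>

lemma has_derivative_infsum:
  fixes f :: "int^3 \<Rightarrow> 'a::real_normed_vector \<Rightarrow> 'b::banach"
  assumes S: "convex S" "x \<in> S"
    and der: "\<And>k z. z \<in> S \<Longrightarrow> (f k has_derivative f' k z) (at z within S)"
    and bound: "\<And>k z h. z \<in> S \<Longrightarrow> norm (f' k z h) \<le> N k * norm h"
    and N: "N summable_on UNIV"
    and f: "\<And>z. z \<in> S \<Longrightarrow> (\<lambda>k. norm (f k z)) summable_on UNIV"
  shows "((\<lambda>z. \<Sum>\<^sub>\<infinity>k. f k z) has_derivative (\<lambda>h. \<Sum>\<^sub>\<infinity>k. f' k x h)) (at x within S)"
proof -
  have "infinite (UNIV :: (int^3) set)"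
  proof
    assume "finite (UNIV :: (int^3) set)"
    then have "finite (range (\<lambda>k :: int^3. k $ 1))" by simp
    moreover have "range (\<lambda>k :: int^3. k $ 1) = UNIV"
      by (auto intro!: image_eqI[of _ _ "\<chi> i. _"])
    ultimately show False by simp
  qed
  then obtain e :: "nat \<Rightarrow> int^3" where e: "bij e"
    using bij_betw_from_nat_into[of "UNIV :: (int^3) set"] by blast
  have sums: "(\<lambda>n. g (e n)) sums (\<Sum>\<^sub>\<infinity>k. g k)" if "(\<lambda>k. norm (g k)) summable_on UNIV" for g :: "int^3 \<Rightarrow> 'b"
  proof -
    have "(g has_sum (\<Sum>\<^sub>\<infinity>k. g k)) UNIV"
      using abs_summable_summable[OF that] by simp
    then have "((\<lambda>n. g (e n)) has_sum (\<Sum>\<^sub>\<infinity>k. g k)) UNIV"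
      using has_sum_reindex_bij_betw[OF e, of g] by simp
    then show ?thesis by (rule has_sum_imp_sums)
  qed
  have Ne: "summable (\<lambda>n. N (e n))"
    using summable_on_reindex_bij_betw[OF e, of N] N by (auto intro: summable_on_imp_summable)
  have f': "(\<lambda>k. norm (f' k z h)) summable_on UNIV" if "z \<in> S" for z h
    by (rule summable_on_comparison_test[of "\<lambda>k. N k * norm h"])
       (use bound[OF that] in \<open>auto intro: summable_on_cmult_left N\<close>)
  have "\<exists>g. \<forall>z\<in>S. (\<lambda>n. f (e n) z) sums g z \<and> (g has_derivative (\<lambda>h. \<Sum>\<^sub>\<infinity>k. f' k z h)) (at z within S)"
  proof (rule has_derivative_series[OF S(1) _ _ S(2)])
    show "(f (e n) has_derivative f' (e n) z) (at z within S)" if "z \<in> S" for n z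
      by (rule der[OF that])
    show "(\<lambda>n. f (e n) x) sums (\<Sum>\<^sub>\<infinity>k. f k x)"
      by (rule sums[OF f[OF S(2)]])
    fix \<epsilon> :: real assume \<epsilon>: "\<epsilon> > 0"
    obtain n0 where n0: "\<And>n. n \<ge> n0 \<Longrightarrow> norm (\<Sum>i. N (e (i + n))) < \<epsilon>"
      using suminf_exist_split[OF \<epsilon> Ne] by blast
    show "\<forall>\<^sub>F n in sequentially. \<forall>z\<in>S. \<forall>h. norm ((\<Sum>i<n. f' (e i) z h) - (\<Sum>\<^sub>\<infinity>k. f' k z h)) \<le> \<epsilon> * norm h"
    proof (rule eventually_sequentiallyI[of n0], intro ballI allI)
      fix n z h assume n: "n \<ge> n0" and z: "z \<in> S"
      have s: "(\<lambda>n. f' (e n) z h) sums (\<Sum>\<^sub>\<infinity>k. f' k z h)" by (rule sums[OF f'[OF z]])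
      have Nn: "summable (\<lambda>i. N (e (i + n)))" using Ne summable_iff_shift[of "\<lambda>n. N (e n)" n] by simp
      have "(\<Sum>\<^sub>\<infinity>k. f' k z h) = (\<Sum>i. f' (e i) z h)" using s by (simp add: sums_iff)
      also have "\<dots> = (\<Sum>i. f' (e (i + n)) z h) + (\<Sum>i<n. f' (e i) z h)"
        using s by (intro suminf_split_initial_segment) (simp add: sums_iff)
      finally have "norm ((\<Sum>i<n. f' (e i) z h) - (\<Sum>\<^sub>\<infinity>k. f' k z h)) = norm (\<Sum>i. f' (e (i + n)) z h)"
        by (simp add: norm_minus_commute)
      also have "\<dots> \<le> (\<Sum>i. N (e (i + n)) * norm h)"
        by (rule norm_suminf_le) (use bound[OF z] summable_mult2[OF Nn] in auto)
      also have "\<dots> = (\<Sum>i. N (e (i + n))) * norm h"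
        by (rule suminf_mult2[OF Nn, symmetric])
      also have "\<dots> \<le> \<epsilon> * norm h"
        using n0[OF n] by (intro mult_right_mono) auto
      finally show "norm ((\<Sum>i<n. f' (e i) z h) - (\<Sum>\<^sub>\<infinity>k. f' k z h)) \<le> \<epsilon> * norm h" .
    qed
  qed
  then obtain g where g: "\<And>z. z \<in> S \<Longrightarrow> (\<lambda>n. f (e n) z) sums g z"
    "\<And>z. z \<in> S \<Longrightarrow> (g has_derivative (\<lambda>h. \<Sum>\<^sub>\<infinity>k. f' k z h)) (at z within S)"
    by blast
  have "g z = (\<Sum>\<^sub>\<infinity>k. f k z)" if "z \<in> S" for z
    using sums_unique2[OF g(1)[OF that] sums[OF f[OF that]]] .
  then show ?thesis
    using has_derivative_transform[OF S(2) _ g(2)[OF S(2)]] by simp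
qed

text \<open>Bounds are uniform only on compact time intervals, since the decay estimates degenerate
  as time tends to 0.\<close>

definition rapid_family :: "real set \<Rightarrow> (int^3 \<Rightarrow> real \<Rightarrow> complex) \<Rightarrow> bool" where
  "rapid_family I g \<longleftrightarrow> (\<forall>k. continuous_on I (g k)) \<and>
     (\<forall>m a b. {a..b} \<subseteq> I \<longrightarrow> (\<exists>C. \<forall>t\<in>{a..b}. \<forall>k. (1 + norm (freq k)) ^ m * norm (g k t) \<le> C))"

text \<open>Counts time derivatives only; space derivatives are multiplications by powers of
  \<open>k\<close>, which rapid decay already tolerates.\<close>

primrec smooth_family :: "nat \<Rightarrow> real set \<Rightarrow> (int^3 \<Rightarrow> real \<Rightarrow> complex) \<Rightarrow> bool" where
  "smooth_family 0 I g \<longleftrightarrow> rapid_family I g"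
| "smooth_family (Suc n) I g \<longleftrightarrow> rapid_family I g \<and>
     (\<exists>g'. (\<forall>k. \<forall>t\<in>I. (g k has_vector_derivative g' k t) (at t)) \<and> smooth_family n I g')"

lemma rapid_familyD:
  assumes "rapid_family I g" "{a..b} \<subseteq> I"
  obtains C where "C \<ge> 0" "\<And>t k. t \<in> {a..b} \<Longrightarrow> (1 + norm (freq k)) ^ m * norm (g k t) \<le> C"
proof -
  obtain C where C: "\<And>t k. t \<in> {a..b} \<Longrightarrow> (1 + norm (freq k)) ^ m * norm (g k t) \<le> C"
    using assms unfolding rapid_family_def by meson
  show ?thesis by (rule that[of "max 0 C"]) (auto simp: le_max_iff_disj C)
qed

lemma rapid_family_continuous: "rapid_family I g \<Longrightarrow> continuous_on I (g k)"
  by (simp add: rapid_family_def)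

lemma smooth_family_rapid: "smooth_family n I g \<Longrightarrow> rapid_family I g"
  by (cases n) auto

lemma smooth_family_SucE:
  assumes "smooth_family (Suc n) I g"
  obtains g' where "rapid_family I g" "\<And>k t. t \<in> I \<Longrightarrow> (g k has_vector_derivative g' k t) (at t)"
    "smooth_family n I g'"
  using assms unfolding smooth_family.simps by blast

lemma smooth_family_SucI:
  assumes "rapid_family I g" "\<And>k t. t \<in> I \<Longrightarrow> (g k has_vector_derivative g' k t) (at t)"
    "smooth_family n I g'"
  shows "smooth_family (Suc n) I g"
  using assms by auto

lemma smooth_family_Suc_imp: "smooth_family (Suc n) I g \<Longrightarrow> smooth_family n I g"
proof (induction n arbitrary: g)
  case (Suc n)
  obtain g' where "rapid_family I g" "\<And>k t. t \<in> I \<Longrightarrow> (g k has_vector_derivative g' k t) (at t)"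
    "smooth_family (Suc n) I g'"
    using smooth_family_SucE[OF Suc.prems] by metis
  then show ?case by (intro smooth_family_SucI[of I g g'] Suc.IH)
qed auto

lemma rapid_family_add:
  assumes "rapid_family I f" "rapid_family I g"
  shows "rapid_family I (\<lambda>k t. f k t + g k t)"
  unfolding rapid_family_def
proof (intro conjI allI impI)
  show "continuous_on I (\<lambda>t. f k t + g k t)" for k
    using assms by (intro continuous_intros rapid_family_continuous)
  fix m a b assume ab: "{a..b} \<subseteq> I"
  obtain C1 where C1: "\<And>t k. t \<in> {a..b} \<Longrightarrow> (1 + norm (freq k)) ^ m * norm (f k t) \<le> C1"
    using rapid_familyD[OF assms(1) ab] by metis
  obtain C2 where C2: "\<And>t k. t \<in> {a..b} \<Longrightarrow> (1 + norm (freq k)) ^ m * norm (g k t) \<le> C2"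
    using rapid_familyD[OF assms(2) ab] by metis
  have "(1 + norm (freq k)) ^ m * norm (f k t + g k t) \<le> C1 + C2" if t: "t \<in> {a..b}" for t k
  proof -
    have "(1 + norm (freq k)) ^ m * norm (f k t + g k t) \<le> (1 + norm (freq k)) ^ m * (norm (f k t) + norm (g k t))"
      by (intro mult_left_mono norm_triangle_ineq) auto
    then show ?thesis using C1[OF t, of k] C2[OF t, of k] by (simp add: distrib_left)
  qed
  then show "\<exists>C. \<forall>t\<in>{a..b}. \<forall>k. (1 + norm (freq k)) ^ m * norm (f k t + g k t) \<le> C"
    by blast
qed

lemma rapid_family_symbol:
  assumes "rapid_family I g" and \<sigma>: "\<And>k. norm (\<sigma> k) \<le> B * (1 + norm (freq k)) ^ p"
  shows "rapid_family I (\<lambda>k t. \<sigma> k * g k t)"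
  unfolding rapid_family_def
proof (intro conjI allI impI)
  show "continuous_on I (\<lambda>t. \<sigma> k * g k t)" for k
    using assms by (intro continuous_intros rapid_family_continuous)
  fix m a b assume ab: "{a..b} \<subseteq> I"
  have "norm (\<sigma> 0) \<le> B" using \<sigma>[of 0] by simp
  then have B: "B \<ge> 0" using norm_ge_zero order_trans by blast
  obtain C where C: "\<And>t k. t \<in> {a..b} \<Longrightarrow> (1 + norm (freq k)) ^ (m + p) * norm (g k t) \<le> C"
    using rapid_familyD[OF assms(1) ab] by metis
  have "(1 + norm (freq k)) ^ m * norm (\<sigma> k * g k t) \<le> B * C" if t: "t \<in> {a..b}" for t k
  proof -
    have "(1 + norm (freq k)) ^ m * norm (\<sigma> k * g k t) \<le> (1 + norm (freq k)) ^ m * ((B * (1 + norm (freq k)) ^ p) * norm (g k t))"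
      unfolding norm_mult by (intro mult_left_mono mult_right_mono \<sigma>) auto
    also have "\<dots> = B * ((1 + norm (freq k)) ^ (m + p) * norm (g k t))"
      by (simp add: power_add mult_ac)
    also have "\<dots> \<le> B * C" by (intro mult_left_mono C t B)
    finally show ?thesis .
  qed
  then show "\<exists>C. \<forall>t\<in>{a..b}. \<forall>k. (1 + norm (freq k)) ^ m * norm (\<sigma> k * g k t) \<le> C"
    by blast
qed

lemma inv_fourth_summable: "(\<lambda>k. 1 / (1 + norm (freq k)) ^ 4) summable_on (UNIV :: (int^3) set)"
proof (rule summable_on_comparison_test)
  have "(\<lambda>k. if k = 0 then 1 else 0 :: real) summable_on (UNIV :: (int^3) set)"
    by (subst summable_on_cong_neutral[where T = "{0}" and g = "\<lambda>k. 1"]) auto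
  then show "(\<lambda>k. (if k = 0 then 1 else 0) + (inv_sq k)\<^sup>2) summable_on (UNIV :: (int^3) set)"
    by (intro summable_on_add inv_sq_sq_summable)
  show "1 / (1 + norm (freq k)) ^ 4 \<le> (if k = 0 then 1 else 0) + (inv_sq k)\<^sup>2" for k
  proof (cases "k = 0")
    case False
    have "1 / (1 + norm (freq k)) ^ 4 \<le> 1 / norm (freq k) ^ 4"
      using norm_freq_ge_1[OF False] by (intro divide_left_mono power_mono mult_pos_pos zero_less_power) auto
    then show ?thesis using False by (simp add: inv_sq_def power_divide flip: power_mult)
  qed simp
qed auto

lemma rapid_family_le_inv_fourth:
  assumes "(1 + norm (freq k)) ^ (m + 4) * norm (z :: complex) \<le> C"
  shows "(1 + norm (freq k)) ^ m * norm z \<le> C * (1 / (1 + norm (freq k)) ^ 4)"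
proof -
  have p: "(1 + norm (freq k)) ^ 4 > 0" by (intro zero_less_power add_pos_nonneg) auto
  have "((1 + norm (freq k)) ^ m * norm z) * (1 + norm (freq k)) ^ 4 \<le> C"
    using assms by (simp only: power_add mult_ac)
  then have "(1 + norm (freq k)) ^ m * norm z \<le> C / (1 + norm (freq k)) ^ 4"
    using p by (simp only: pos_le_divide_eq)
  then show ?thesis by simp
qed

lemma one_plus_freq_mult: "1 + norm (freq k) \<le> (1 + norm (freq (k - l))) * (1 + norm (freq l))"
proof -
  have "norm (freq k) \<le> norm (freq (k - l)) + norm (freq l)"
    using norm_triangle_ineq[of "freq (k - l)" "freq l"] by simp
  moreover have "0 \<le> norm (freq (k - l)) * norm (freq l)" by simp
  ultimately show ?thesis unfolding distrib_left distrib_right by linarith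
qed

text \<open>By \<open>one_plus_freq_mult\<close> the weight at \<open>k\<close> splits into weights
  at \<open>k - l\<close> and \<open>l\<close>. Four surplus orders on the second factor leave a
  term summable in \<open>l\<close>.\<close>

lemma convol_term_bound:
  assumes "rapid_family I f" "rapid_family I g" "{a..b} \<subseteq> I"
  obtains C where "C \<ge> 0" "\<And>t k l. t \<in> {a..b} \<Longrightarrow>
    (1 + norm (freq k)) ^ m * norm (f (k - l) t * g l t) \<le> C * (1 / (1 + norm (freq l)) ^ 4)"
proof -
  obtain C1 where C1: "C1 \<ge> 0" "\<And>t k. t \<in> {a..b} \<Longrightarrow> (1 + norm (freq k)) ^ m * norm (f k t) \<le> C1"
    using rapid_familyD[OF assms(1,3)] by metis
  obtain C2 where C2: "C2 \<ge> 0" "\<And>t k. t \<in> {a..b} \<Longrightarrow> (1 + norm (freq k)) ^ (m + 4) * norm (g k t) \<le> C2"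
    using rapid_familyD[OF assms(2,3)] by metis
  show ?thesis
  proof (rule that[of "C1 * C2"])
    fix t k l assume t: "t \<in> {a..b}"
    have "(1 + norm (freq k)) ^ m \<le> ((1 + norm (freq (k - l))) * (1 + norm (freq l))) ^ m"
      by (intro power_mono one_plus_freq_mult) auto
    then have "(1 + norm (freq k)) ^ m * norm (f (k - l) t * g l t)
        \<le> ((1 + norm (freq (k - l))) * (1 + norm (freq l))) ^ m * norm (f (k - l) t * g l t)"
      by (intro mult_right_mono) auto
    also have "\<dots> = ((1 + norm (freq (k - l))) ^ m * norm (f (k - l) t)) * ((1 + norm (freq l)) ^ m * norm (g l t))"
      by (simp only: power_mult_distrib norm_mult mult_ac)
    also have "\<dots> \<le> C1 * (C2 * (1 / (1 + norm (freq l)) ^ 4))"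
      by (intro mult_mono C1 t rapid_family_le_inv_fourth C2) (auto simp: C1)
    finally show "(1 + norm (freq k)) ^ m * norm (f (k - l) t * g l t) \<le> C1 * C2 * (1 / (1 + norm (freq l)) ^ 4)"
      by (simp only: mult.assoc)
  qed (use C1 C2 in auto)
qed

lemma open_real_interval_around:
  assumes "open I" "(t::real) \<in> I"
  obtains a b where "a < t" "t < b" "{a..b} \<subseteq> I"
proof -
  obtain e where e: "e > 0" "cball t e \<subseteq> I"
    using assms open_contains_cball by blast
  show ?thesis by (rule that[of "t - e" "t + e"]) (use e in \<open>auto simp: cball_eq_atLeastAtMost\<close>)
qed

lemma continuous_on_open_locally:
  fixes f :: "real \<Rightarrow> complex"
  assumes "open I" "\<And>a b. {a..b} \<subseteq> I \<Longrightarrow> continuous_on {a..b} f"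
  shows "continuous_on I f"
  unfolding continuous_on_eq_continuous_at[OF assms(1)]
proof
  fix t assume "t \<in> I"
  then obtain a b where ab: "a < t" "t < b" "{a..b} \<subseteq> I"
    using open_real_interval_around[OF assms(1)] by metis
  have "continuous_on {a<..<b} f"
    by (rule continuous_on_subset[OF assms(2)[OF ab(3)]]) auto
  then show "isCont f t"
    using ab by (simp add: continuous_on_eq_continuous_at)
qed

lemma convol_abs_summable:
  assumes "rapid_family I f" "rapid_family I g" "t \<in> I"
  shows "(\<lambda>l. norm (f (k - l) t * g l t)) summable_on UNIV"
proof -
  obtain C where "C \<ge> 0" and C: "\<And>s k l. s \<in> {t..t} \<Longrightarrow>
      (1 + norm (freq k)) ^ 0 * norm (f (k - l) s * g l s) \<le> C * (1 / (1 + norm (freq l)) ^ 4)"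
    using convol_term_bound[OF assms(1,2), of t t 0] assms(3) by (auto simp del: power_0)
  show ?thesis
    by (rule summable_on_comparison_test[OF summable_on_cmult_right[OF inv_fourth_summable]])
       (use C[of t k] in auto)
qed

lemma rapid_family_convol:
  assumes I: "open I" and f: "rapid_family I f" and g: "rapid_family I g"
  shows "rapid_family I (convol f g)"
  unfolding rapid_family_def
proof (intro conjI allI impI)
  fix k
  show "continuous_on I (convol f g k)"
  proof (rule continuous_on_open_locally[OF I])
    fix a b assume ab: "{a..b} \<subseteq> I"
    obtain C where C: "\<And>t k l. t \<in> {a..b} \<Longrightarrow>
      (1 + norm (freq k)) ^ 0 * norm (f (k - l) t * g l t) \<le> C * (1 / (1 + norm (freq l)) ^ 4)"
      using convol_term_bound[OF f g ab, of 0] by metis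
    show "continuous_on {a..b} (convol f g k)"
      unfolding convol_def
      by (rule continuous_on_infsum[OF _ _ summable_on_cmult_right[OF inv_fourth_summable, of C]])
         (use C[of _ k] ab in \<open>auto intro!: continuous_intros continuous_on_subset[OF rapid_family_continuous[OF f]]
            continuous_on_subset[OF rapid_family_continuous[OF g]]\<close>)
  qed
next
  fix m a b assume ab: "{a..b} \<subseteq> I"
  obtain C where C: "\<And>t k l. t \<in> {a..b} \<Longrightarrow>
      (1 + norm (freq k)) ^ m * norm (f (k - l) t * g l t) \<le> C * (1 / (1 + norm (freq l)) ^ 4)"
    using convol_term_bound[OF f g ab, of m] by metis
  have "(1 + norm (freq k)) ^ m * norm (convol f g k t) \<le> (\<Sum>\<^sub>\<infinity>l::int^3. C * (1 / (1 + norm (freq l)) ^ 4))" if t: "t \<in> {a..b}" for t k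
  proof -
    have tI: "t \<in> I" using t ab by auto
    note S = convol_abs_summable[OF f g tI, of k]
    have "(1 + norm (freq k)) ^ m * norm (convol f g k t) \<le> (1 + norm (freq k)) ^ m * (\<Sum>\<^sub>\<infinity>l. norm (f (k - l) t * g l t))"
      unfolding convol_def by (intro mult_left_mono norm_infsum_bound S) auto
    also have "\<dots> = (\<Sum>\<^sub>\<infinity>l. (1 + norm (freq k)) ^ m * norm (f (k - l) t * g l t))"
      by (rule infsum_cmult_right[symmetric]) (use S in simp)
    also have "\<dots> \<le> (\<Sum>\<^sub>\<infinity>l::int^3. C * (1 / (1 + norm (freq l)) ^ 4))"
      by (rule infsum_mono) (use C[OF t, of k] summable_on_cmult_right[OF S] summable_on_cmult_right[OF inv_fourth_summable, of C] in auto)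
    finally show ?thesis .
  qed
  then show "\<exists>C. \<forall>t\<in>{a..b}. \<forall>k. (1 + norm (freq k)) ^ m * norm (convol f g k t) \<le> C"
    by blast
qed

lemma smooth_family_add:
  "smooth_family n I f \<Longrightarrow> smooth_family n I g \<Longrightarrow> smooth_family n I (\<lambda>k t. f k t + g k t)"
proof (induction n arbitrary: f g)
  case (Suc n)
  obtain f' where f: "rapid_family I f" "\<And>k t. t \<in> I \<Longrightarrow> (f k has_vector_derivative f' k t) (at t)"
    "smooth_family n I f'" using smooth_family_SucE[OF Suc.prems(1)] by metis
  obtain g' where g: "rapid_family I g" "\<And>k t. t \<in> I \<Longrightarrow> (g k has_vector_derivative g' k t) (at t)"
    "smooth_family n I g'" using smooth_family_SucE[OF Suc.prems(2)] by metis
  show ?case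
    by (rule smooth_family_SucI[where g' = "\<lambda>k t. f' k t + g' k t"])
       (intro rapid_family_add has_vector_derivative_add Suc.IH f g; assumption)+
qed (auto intro: rapid_family_add)

lemma smooth_family_symbol:
  assumes \<sigma>: "\<And>k. norm (\<sigma> k) \<le> B * (1 + norm (freq k)) ^ p"
  shows "smooth_family n I g \<Longrightarrow> smooth_family n I (\<lambda>k t. \<sigma> k * g k t)"
proof (induction n arbitrary: g)
  case (Suc n)
  obtain g' where g: "rapid_family I g" "\<And>k t. t \<in> I \<Longrightarrow> (g k has_vector_derivative g' k t) (at t)"
    "smooth_family n I g'" using smooth_family_SucE[OF Suc.prems] by metis
  show ?case
    by (rule smooth_family_SucI[where g' = "\<lambda>k t. \<sigma> k * g' k t"])
       (intro rapid_family_symbol[OF _ \<sigma>] has_vector_derivative_mult_right Suc.IH g; assumption)+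
qed (auto intro: rapid_family_symbol[OF _ \<sigma>])

lemma smooth_family_zero: "smooth_family n I (\<lambda>k t. 0)"
  by (induction n) (auto simp: rapid_family_def intro!: exI[of _ "\<lambda>k t. 0"])

lemma smooth_family_sum:
  assumes "finite F" "\<And>x. x \<in> F \<Longrightarrow> smooth_family n I (g x)"
  shows "smooth_family n I (\<lambda>k t. \<Sum>x\<in>F. g x k t)"
  using assms by (induction F rule: finite_induct) (auto intro: smooth_family_zero smooth_family_add)

text \<open>The product rule, termwise on a neighbourhood of \<open>t\<close> whose closure lies in
  \<open>I\<close>. Both resulting convolutions have factors with \<open>n\<close> time derivatives,
  so the induction applies to them.\<close>

lemma smooth_family_convol:
  assumes I: "open I"
  shows "smooth_family n I f \<Longrightarrow> smooth_family n I g \<Longrightarrow> smooth_family n I (convol f g)"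
proof (induction n arbitrary: f g)
  case (Suc n)
  obtain f' where f': "\<And>k t. t \<in> I \<Longrightarrow> (f k has_vector_derivative f' k t) (at t)" "smooth_family n I f'"
    using smooth_family_SucE[OF Suc.prems(1)] by metis
  obtain g' where g': "\<And>k t. t \<in> I \<Longrightarrow> (g k has_vector_derivative g' k t) (at t)" "smooth_family n I g'"
    using smooth_family_SucE[OF Suc.prems(2)] by metis
  have f: "smooth_family n I f" "rapid_family I f" and g: "smooth_family n I g" "rapid_family I g"
    by (rule smooth_family_Suc_imp smooth_family_rapid, rule Suc.prems)+
  have f'r: "rapid_family I f'" and g'r: "rapid_family I g'"
    using f'(2) g'(2) by (auto intro: smooth_family_rapid)
  have "(convol f g k has_vector_derivative convol f' g k t + convol f g' k t) (at t)" if t: "t \<in> I" for k t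
  proof -
    obtain a b where ab: "a < t" "t < b" "{a..b} \<subseteq> I"
      using open_real_interval_around[OF I t] by metis
    define S where "S = {a<..<b}"
    have S: "convex S" "t \<in> S" "S \<subseteq> {a..b}" "open S" "S \<subseteq> I" unfolding S_def using ab by auto
    obtain C1 where C1: "\<And>s k l. s \<in> {a..b} \<Longrightarrow>
        (1 + norm (freq k)) ^ 0 * norm (f' (k - l) s * g l s) \<le> C1 * (1 / (1 + norm (freq l)) ^ 4)"
      using convol_term_bound[OF f'r g(2) ab(3), of 0] by metis
    obtain C2 where C2: "\<And>s k l. s \<in> {a..b} \<Longrightarrow>
        (1 + norm (freq k)) ^ 0 * norm (f (k - l) s * g' l s) \<le> C2 * (1 / (1 + norm (freq l)) ^ 4)"
      using convol_term_bound[OF f(2) g'r ab(3), of 0] by metis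
    define d where "d l s = f' (k - l) s * g l s + f (k - l) s * g' l s" for l s
    have "((\<lambda>s. \<Sum>\<^sub>\<infinity>l. f (k - l) s * g l s) has_derivative (\<lambda>h. \<Sum>\<^sub>\<infinity>l. h *\<^sub>R d l t)) (at t within S)"
    proof (rule has_derivative_infsum[OF S(1,2)])
      show "((\<lambda>s. f (k - l) s * g l s) has_derivative (\<lambda>h. h *\<^sub>R d l s)) (at s within S)" if "s \<in> S" for l s
      proof -
        have "s \<in> I" using that S by auto
        then have "((\<lambda>s. f (k - l) s * g l s) has_vector_derivative (f (k - l) s * g' l s + f' (k - l) s * g l s)) (at s)"
          by (intro has_vector_derivative_mult f' g')
        then have "((\<lambda>s. f (k - l) s * g l s) has_vector_derivative d l s) (at s)"
          by (simp add: d_def add.commute)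
        then show ?thesis
          unfolding has_vector_derivative_def by (rule has_derivative_at_withinI)
      qed
      show "norm (h *\<^sub>R d l s) \<le> ((C1 + C2) * (1 / (1 + norm (freq l)) ^ 4)) * norm h" if s: "s \<in> S" for l s h
      proof -
        have "norm (d l s) \<le> norm (f' (k - l) s * g l s) + norm (f (k - l) s * g' l s)"
          unfolding d_def by (rule norm_triangle_ineq)
        also have "\<dots> \<le> (C1 + C2) * (1 / (1 + norm (freq l)) ^ 4)"
          using C1[of s k l] C2[of s k l] s S(3) unfolding distrib_right by auto
        finally have "norm (d l s) * norm h \<le> ((C1 + C2) * (1 / (1 + norm (freq l)) ^ 4)) * norm h"
          by (intro mult_right_mono) auto
        then show ?thesis by (simp add: mult.commute)
      qed
      show "(\<lambda>l::int^3. (C1 + C2) * (1 / (1 + norm (freq l)) ^ 4)) summable_on UNIV"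
        by (intro summable_on_cmult_right inv_fourth_summable)
      show "(\<lambda>l. norm (f (k - l) s * g l s)) summable_on UNIV" if "s \<in> S" for s
        by (rule convol_abs_summable[OF f(2) g(2)]) (use that S in auto)
    qed
    moreover have "(\<Sum>\<^sub>\<infinity>l. h *\<^sub>R d l t) = h *\<^sub>R (convol f' g k t + convol f g' k t)" for h
      unfolding d_def convol_def infsum_scaleR_right
      by (subst infsum_add)
         (auto intro: abs_summable_summable convol_abs_summable[OF f'r g(2) t] convol_abs_summable[OF f(2) g'r t])
    ultimately show ?thesis
      unfolding has_vector_derivative_def convol_def[abs_def, symmetric]
      using at_within_open[OF S(2,4)] by (simp add: convol_def[abs_def])
  qed
  moreover have "smooth_family n I (\<lambda>k t. convol f' g k t + convol f g' k t)"
    by (intro smooth_family_add Suc.IH f f' g g')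
  ultimately show ?case
    by (rule smooth_family_SucI[OF rapid_family_convol[OF I f(2) g(2)]])
qed (auto intro: rapid_family_convol[OF I])

subsection \<open>Synthesis\<close>

definition synth :: "(int^3 \<Rightarrow> real \<Rightarrow> complex) \<Rightarrow> real \<times> (real^3) \<Rightarrow> complex" where
  "synth g z = (\<Sum>\<^sub>\<infinity>k. g k (fst z) * wave k (snd z))"

lemma wave_has_derivative:
  "(wave k has_derivative (\<lambda>h. (2 * pi * (h \<bullet> freq k)) *\<^sub>R (\<i> * wave k x))) (at x within S)"
  unfolding wave_def[abs_def]
  by (rule has_derivative_cis) (auto intro!: derivative_eq_intros)

lemma rapid_family_abs_summable:
  assumes "rapid_family I g" "t \<in> I"
  shows "(\<lambda>k. norm (g k t)) summable_on UNIV"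
proof -
  obtain C where "C \<ge> 0" and C: "\<And>s k. s \<in> {t..t} \<Longrightarrow> (1 + norm (freq k)) ^ (0 + 4) * norm (g k s) \<le> C"
    using rapid_familyD[OF assms(1), of t t "0 + 4"] assms(2) by auto
  show ?thesis
    by (rule summable_on_comparison_test[OF summable_on_cmult_right[OF inv_fourth_summable, of C]])
       (use rapid_family_le_inv_fourth[OF C[of t]] in auto)
qed

lemma continuous_on_synth:
  assumes I: "open I" and g: "rapid_family I g"
  shows "continuous_on (I \<times> UNIV) (synth g)"
proof -
  have op: "open (I \<times> (UNIV :: (real^3) set))" by (intro open_Times I open_UNIV)
  show ?thesis
    unfolding continuous_on_eq_continuous_at[OF op]
  proof
    fix z assume "z \<in> I \<times> (UNIV :: (real^3) set)"
    then obtain t x where z: "z = (t, x)" and t: "t \<in> I" by auto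
    obtain a b where ab: "a < t" "t < b" "{a..b} \<subseteq> I"
      using open_real_interval_around[OF I t] by metis
    obtain C where C: "\<And>s k. s \<in> {a..b} \<Longrightarrow> (1 + norm (freq k)) ^ (0 + 4) * norm (g k s) \<le> C"
      using rapid_familyD[OF g ab(3), of "0 + 4"] by metis
    have sub: "{a<..<b} \<subseteq> I" using ab(3) by auto
    have "continuous_on ({a<..<b} \<times> UNIV) (synth g)"
      unfolding synth_def
    proof (rule continuous_on_infsum[OF _ _ summable_on_cmult_right[OF inv_fourth_summable, of C]])
      show "continuous_on ({a<..<b} \<times> UNIV) (\<lambda>z. g k (fst z) * wave k (snd z))" for k
        by (intro continuous_intros continuous_on_compose2[OF continuous_on_subset[OF rapid_family_continuous[OF g] sub]]
            continuous_on_compose2[OF continuous_wave[of UNIV]]) auto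
      show "norm (g k (fst z) * wave k (snd z)) \<le> C * (1 / (1 + norm (freq k)) ^ 4)" if "z \<in> {a<..<b} \<times> UNIV" for k z
        using rapid_family_le_inv_fourth[OF C[of "fst z" k]] that by (auto simp: norm_mult)
    qed
    moreover have "open ({a<..<b} \<times> (UNIV :: (real^3) set))" by (intro open_Times open_UNIV) auto
    ultimately show "isCont (synth g) z"
      using ab by (simp add: continuous_on_eq_continuous_at z)
  qed
qed

text \<open>A directional derivative of a synthesised function is again a synthesised function: time
  differentiates the coefficients, space multiplies them by \<open>2 pi i\<close> times the inner
  product of the direction with \<open>k\<close>. Hence the induction closes.\<close>

lemma synth_Ck_on:
  assumes I: "open I"
  shows "smooth_family n I g \<Longrightarrow> Ck_on n (I \<times> UNIV) (synth g)"
proof (induction n arbitrary: g)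
  case 0
  then show ?case using continuous_on_synth[OF I] by simp
next
  case (Suc n)
  obtain g' where g': "\<And>k t. t \<in> I \<Longrightarrow> (g k has_vector_derivative g' k t) (at t)" "smooth_family n I g'"
    using smooth_family_SucE[OF Suc.prems] by metis
  have g: "smooth_family n I g" "rapid_family I g"
    by (rule smooth_family_Suc_imp smooth_family_rapid, rule Suc.prems)+
  have g'r: "rapid_family I g'" using g'(2) by (rule smooth_family_rapid)
  define d where "d h k t = of_real (fst h) * g' k t + (of_real (2 * pi * (snd h \<bullet> freq k)) * \<i>) * g k t"
    for h :: "real \<times> (real^3)" and k t
  have d_smooth: "smooth_family n I (d h)" for h
    unfolding d_def
  proof (intro smooth_family_add)
    show "smooth_family n I (\<lambda>k t. of_real (fst h) * g' k t)"
      by (rule smooth_family_symbol[where B = "\<bar>fst h\<bar>" and p = 0]) (use g' in auto)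
    show "smooth_family n I (\<lambda>k t. (of_real (2 * pi * (snd h \<bullet> freq k)) * \<i>) * g k t)"
    proof (rule smooth_family_symbol[where B = "2 * pi * norm (snd h)" and p = 1])
      fix k
      have "\<bar>snd h \<bullet> freq k\<bar> \<le> norm (snd h) * (1 + norm (freq k))"
        using Cauchy_Schwarz_ineq2[of "snd h" "freq k"] norm_ge_zero[of "snd h"] unfolding distrib_left by linarith
      then show "norm (of_real (2 * pi * (snd h \<bullet> freq k)) * \<i>) \<le> 2 * pi * norm (snd h) * (1 + norm (freq k)) ^ 1"
        by (simp add: norm_mult abs_mult mult.assoc)
    qed (rule g)
  qed
  have "(synth g has_derivative (\<lambda>h. synth (d h) z)) (at z within I \<times> UNIV)" if z: "z \<in> I \<times> UNIV" for z
  proof -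
    have op: "open (I \<times> (UNIV :: (real^3) set))" by (intro open_Times I open_UNIV)
    have "fst z \<in> I" using z by auto
    then obtain a b where ab: "a < fst z" "fst z < b" "{a..b} \<subseteq> I"
      using open_real_interval_around[OF I] by metis
    define S where "S = {a<..<b} \<times> (UNIV :: (real^3) set)"
    have S: "convex S" "z \<in> S" "open S" "\<And>y. y \<in> S \<Longrightarrow> fst y \<in> {a..b}" "\<And>y. y \<in> S \<Longrightarrow> fst y \<in> I"
      unfolding S_def using ab by (auto intro!: convex_Times open_Times simp: mem_Times_iff)
    obtain C1 where C1: "\<And>s k. s \<in> {a..b} \<Longrightarrow> (1 + norm (freq k)) ^ (0 + 4) * norm (g' k s) \<le> C1"
      using rapid_familyD[OF g'r ab(3), of "0 + 4"] by metis
    obtain C2 where C2: "\<And>s k. s \<in> {a..b} \<Longrightarrow> (1 + norm (freq k)) ^ (1 + 4) * norm (g k s) \<le> C2"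
      using rapid_familyD[OF g(2) ab(3), of "1 + 4"] by metis
    have "((\<lambda>y. \<Sum>\<^sub>\<infinity>k. g k (fst y) * wave k (snd y)) has_derivative (\<lambda>h. \<Sum>\<^sub>\<infinity>k. d h k (fst z) * wave k (snd z))) (at z within S)"
    proof (rule has_derivative_infsum[OF S(1,2)])
      fix k y assume y: "y \<in> S"
      have "((\<lambda>y. g k (fst y)) has_derivative (\<lambda>h. fst h *\<^sub>R g' k (fst y))) (at y within S)"
        using has_derivative_compose[OF has_derivative_fst[OF has_derivative_ident] g'(1)[OF S(5)[OF y], unfolded has_vector_derivative_def]]
        by simp
      moreover have "((\<lambda>y. wave k (snd y)) has_derivative (\<lambda>h. (2 * pi * (snd h \<bullet> freq k)) *\<^sub>R (\<i> * wave k (snd y)))) (at y within S)"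
        using has_derivative_compose[OF has_derivative_snd[OF has_derivative_ident] wave_has_derivative[of k "snd y" UNIV]]
        by simp
      ultimately have "((\<lambda>y. g k (fst y) * wave k (snd y)) has_derivative
          (\<lambda>h. g k (fst y) * ((2 * pi * (snd h \<bullet> freq k)) *\<^sub>R (\<i> * wave k (snd y))) + (fst h *\<^sub>R g' k (fst y)) * wave k (snd y))) (at y within S)"
        by (rule has_derivative_mult)
      then show "((\<lambda>y. g k (fst y) * wave k (snd y)) has_derivative (\<lambda>h. d h k (fst y) * wave k (snd y))) (at y within S)"
        by (rule has_derivative_eq_rhs) (simp add: d_def scaleR_conv_of_real algebra_simps)
      fix h :: "real \<times> (real^3)"
      have fh: "\<bar>fst h\<bar> \<le> norm h" using norm_fst_le[of "fst h" "snd h"] by simp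
      have sh: "\<bar>snd h \<bullet> freq k\<bar> \<le> norm h * (1 + norm (freq k))"
      proof -
        have "\<bar>snd h \<bullet> freq k\<bar> \<le> norm (snd h) * norm (freq k)" by (rule Cauchy_Schwarz_ineq2)
        also have "\<dots> \<le> norm h * (1 + norm (freq k))"
          using norm_snd_le[of "snd h" "fst h"] by (intro mult_mono) auto
        finally show ?thesis .
      qed
      have "norm (d h k (fst y) * wave k (snd y)) \<le> \<bar>fst h\<bar> * norm (g' k (fst y)) + 2 * pi * (\<bar>snd h \<bullet> freq k\<bar> * norm (g k (fst y)))"
        unfolding d_def norm_mult[of _ "wave k (snd y)"]
        by (intro order_trans[OF mult_right_mono[OF norm_triangle_ineq]]) (auto simp: norm_mult abs_mult)
      also have "\<dots> \<le> norm h * norm (g' k (fst y)) + 2 * pi * ((norm h * (1 + norm (freq k))) * norm (g k (fst y)))"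
        by (intro add_mono mult_right_mono mult_left_mono fh sh) auto
      also have "\<dots> = norm h * ((1 + norm (freq k)) ^ 0 * norm (g' k (fst y))) + 2 * pi * norm h * ((1 + norm (freq k)) ^ 1 * norm (g k (fst y)))"
        by simp
      also have "\<dots> \<le> norm h * (C1 * (1 / (1 + norm (freq k)) ^ 4)) + 2 * pi * norm h * (C2 * (1 / (1 + norm (freq k)) ^ 4))"
        by (intro add_mono mult_left_mono rapid_family_le_inv_fourth C1 C2 S(4) y) auto
      also have "\<dots> = ((C1 + 2 * pi * C2) * (1 / (1 + norm (freq k)) ^ 4)) * norm h"
        by (simp only: algebra_simps)
      finally show "norm (d h k (fst y) * wave k (snd y)) \<le> ((C1 + 2 * pi * C2) * (1 / (1 + norm (freq k)) ^ 4)) * norm h" .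
    next
      show "(\<lambda>k::int^3. (C1 + 2 * pi * C2) * (1 / (1 + norm (freq k)) ^ 4)) summable_on UNIV"
        by (intro summable_on_cmult_right inv_fourth_summable)
      show "(\<lambda>k. norm (g k (fst y) * wave k (snd y))) summable_on UNIV" if "y \<in> S" for y
        using rapid_family_abs_summable[OF g(2) S(5)[OF that]] by (simp add: norm_mult)
    qed
    then have "(synth g has_derivative (\<lambda>h. synth (d h) z)) (at z)"
      unfolding synth_def[abs_def] using at_within_open[OF S(2,3)] by simp
    then show ?thesis by (rule has_derivative_at_withinI)
  qed
  moreover have "Ck_on n (I \<times> UNIV) (\<lambda>z. synth (d h) z)" for h
    using Suc.IH[OF d_smooth] by simp
  ultimately show ?case
    unfolding Ck_on.simps by (intro exI[of _ "\<lambda>z h. synth (d h) z"]) blast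
qed

section \<open>Closure properties of differentiability classes\<close>

lemma Ck_on_bounded_linear:
  assumes L: "bounded_linear L"
  shows "Ck_on n S f \<Longrightarrow> Ck_on n S (\<lambda>z. L (f z))"
proof (induction n arbitrary: f)
  case 0
  then show ?case using bounded_linear.continuous_on[OF L] by simp
next
  case (Suc n)
  then obtain f' where f': "\<And>x. x \<in> S \<Longrightarrow> (f has_derivative f' x) (at x within S)" "\<And>h. Ck_on n S (\<lambda>x. f' x h)"
    by auto
  show ?case
    using bounded_linear.has_derivative[OF L f'(1)] Suc.IH[OF f'(2)]
    by (auto intro!: exI[of _ "\<lambda>x h. L (f' x h)"])
qed

lemma Ck_on_vec_lambda:
  fixes f :: "'n::finite \<Rightarrow> 'a::euclidean_space \<Rightarrow> real"
  shows "(\<And>i. Ck_on n S (f i)) \<Longrightarrow> Ck_on n S (\<lambda>z. \<chi> i. f i z)"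
proof (induction n arbitrary: f)
  case 0
  then show ?case by (auto intro!: continuous_on_vec_lambda)
next
  case (Suc n)
  then have "\<forall>i. \<exists>f'. (\<forall>x\<in>S. (f i has_derivative f' x) (at x within S)) \<and> (\<forall>h. Ck_on n S (\<lambda>x. f' x h))"
    by auto
  then obtain f' where f': "\<And>i x. x \<in> S \<Longrightarrow> (f i has_derivative f' i x) (at x within S)" "\<And>i h. Ck_on n S (\<lambda>x. f' i x h)"
    by metis
  have "((\<lambda>z. \<chi> i. f i z) has_derivative (\<lambda>h. \<chi> i. f' i x h)) (at x within S)" if "x \<in> S" for x
    by (subst has_derivative_componentwise_within)
       (use f'(1)[OF that] in \<open>auto simp: Basis_vec_def inner_axis\<close>)
  then show ?case using Suc.IH[OF f'(2)] by (auto intro!: exI[of _ "\<lambda>x h. \<chi> i. f' i x h"])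
qed

text \<open>The derivative of a cosine is written as a cosine with phase advanced by a quarter
  period, so that differentiation reproduces the form of the function.\<close>

lemma Ck_on_cos:
  assumes l: "bounded_linear l"
  shows "Ck_on n S (\<lambda>z. cos (l z + \<theta>) *\<^sub>R (a :: 'b::real_normed_vector))"
proof (induction n arbitrary: \<theta> a)
  case 0
  show ?case using bounded_linear.continuous_on[OF l continuous_on_id] by (auto intro!: continuous_intros)
next
  case (Suc n)
  have "((\<lambda>z. cos (l z + \<theta>) *\<^sub>R a) has_derivative (\<lambda>h. cos (l x + (\<theta> + pi / 2)) *\<^sub>R (l h *\<^sub>R a))) (at x within S)" for x
  proof -
    have "cos (l x + (\<theta> + pi / 2)) = - sin (l x + \<theta>)"
      using minus_sin_cos_eq[of "l x + \<theta>"] by (simp add: add.assoc)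
    then show ?thesis
      by (auto intro!: derivative_eq_intros bounded_linear.has_derivative[OF l])
  qed
  then show ?case using Suc.IH by (auto intro!: exI[of _ "\<lambda>x h. cos (l x + (\<theta> + pi / 2)) *\<^sub>R (l h *\<^sub>R a)"])
qed

subsection \<open>Fourier coefficients of a Leray--Hopf solution\<close>

text \<open>The map \<open>p\<close> stands for a coordinate, so that vector components and matrix
  entries are treated together.\<close>

lemma in_L2_component:
  fixes p :: "'b::euclidean_space \<Rightarrow> real"
  assumes f: "in_L2 f" and p: "continuous_on UNIV p" "\<And>y. \<bar>p y\<bar> \<le> norm y"
  shows "square_integrable (\<lambda>x. complex_of_real (p (f x)))"
    and "sq_norm (\<lambda>x. complex_of_real (p (f x))) \<le> (torus_norm f)\<^sup>2"
proof -
  have meas: "f \<in> borel_measurable cube_measure"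
    using f by (simp add: in_L2_def set_borel_measurable_def borel_measurable_restrict_space_iff)
  have int: "integrable cube_measure (\<lambda>x. (norm (f x))\<^sup>2)"
    using f by (simp add: in_L2_def set_integrable_def integrable_restrict_space)
  have "(\<lambda>x. p (f x)) \<in> borel_measurable cube_measure"
    by (rule measurable_compose[OF meas borel_measurable_continuous_onI[OF p(1)]])
  then have m: "(\<lambda>x. complex_of_real (p (f x))) \<in> borel_measurable cube_measure"
    by simp
  have le: "(norm (complex_of_real (p y)))\<^sup>2 \<le> (norm y)\<^sup>2" for y
    using p(2)[of y] by (intro power_mono) auto
  have i: "integrable cube_measure (\<lambda>x. (norm (complex_of_real (p (f x))))\<^sup>2)"
    by (rule Bochner_Integration.integrable_bound[OF int]) (use m le in \<open>auto simp del: norm_of_real\<close>)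
  show "square_integrable (\<lambda>x. complex_of_real (p (f x)))"
    using m i by (simp add: square_integrable_def)
  have nn: "0 \<le> (\<integral>x. f x \<bullet> f x \<partial>cube_measure)" by simp
  have "sq_norm (\<lambda>x. complex_of_real (p (f x))) \<le> (\<integral>x. (norm (f x))\<^sup>2 \<partial>cube_measure)"
    unfolding sq_norm_def by (rule integral_mono[OF i int le])
  also have "\<dots> = (torus_norm f)\<^sup>2"
    using nn unfolding torus_norm_def torus_inner_def set_lebesgue_integral_def
    by (simp add: integral_restrict_space power2_norm_eq_inner)
  finally show "sq_norm (\<lambda>x. complex_of_real (p (f x))) \<le> (torus_norm f)\<^sup>2" .
qed

lemma in_L2_nth: "in_L2 f \<Longrightarrow> square_integrable (\<lambda>x. complex_of_real (f x $ i))"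
  for f :: "real^3 \<Rightarrow> real^3"
  by (rule in_L2_component(1)) (auto intro!: continuous_intros component_le_norm_cart)

lemma in_L2_nth_nth: "in_L2 f \<Longrightarrow> square_integrable (\<lambda>x. complex_of_real (f x $ i $ j))"
  for f :: "real^3 \<Rightarrow> real^3^3"
  by (rule in_L2_component(1))
     (auto intro!: continuous_intros intro: order_trans[OF component_le_norm_cart Finite_Cartesian_Product.norm_nth_le])

lemma torus_inner_cube: "torus_inner f g = (\<integral>x. f x \<bullet> g x \<partial>cube_measure)"
  by (simp add: torus_inner_def set_lebesgue_integral_def integral_restrict_space)

lemma fourier_coeff_nth: "fourier_coeff f k $ i = fcoeff (\<lambda>x. complex_of_real (f x $ i)) k"
proof -
  have "exp (- (2 * of_real pi * \<i> * of_real (x \<bullet> freq k))) = cnj (wave k x)" for x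
    unfolding wave_def cis_cnj[symmetric] by (simp add: cis_conv_exp exp_cnj mult_ac)
  then show ?thesis
    by (simp add: fourier_coeff_def fcoeff_def set_lebesgue_integral_def integral_restrict_space)
qed

section \<open>Real test fields and the Fourier side of weak derivatives\<close>

text \<open>The weak formulations admit real test functions only. With a free phase they still
  determine a complex coefficient, whose real and imaginary parts appear at the phases 0 and
  \<open>pi / 2\<close>.\<close>

definition coswave :: "int^3 \<Rightarrow> real \<Rightarrow> real^3 \<Rightarrow> real" where
  "coswave k \<theta> x = cos (2 * pi * (x \<bullet> freq k) + \<theta>)"

lemma coswave_pi: "coswave k (\<theta> + pi) x = - coswave k \<theta> x"
  unfolding coswave_def by (metis add.assoc cos_periodic_pi)

lemma continuous_coswave: "continuous_on S (coswave k \<theta>)"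
  unfolding coswave_def by (intro continuous_intros)

lemma coswave_measurable: "coswave k \<theta> \<in> borel_measurable cube_measure"
  by (intro measurable_cube_borel borel_measurable_continuous_onI continuous_coswave)

lemma abs_coswave_le: "\<bar>coswave k \<theta> x\<bar> \<le> 1"
  by (simp add: coswave_def)

lemma integrable_mult_coswave:
  fixes h :: "real^3 \<Rightarrow> real"
  assumes "integrable cube_measure h"
  shows "integrable cube_measure (\<lambda>x. h x * coswave k \<theta> x)"
proof (rule Bochner_Integration.integrable_bound[OF assms])
  show "(\<lambda>x. h x * coswave k \<theta> x) \<in> borel_measurable cube_measure"
    using assms coswave_measurable by (intro borel_measurable_times) auto
  show "AE x in cube_measure. norm (h x * coswave k \<theta> x) \<le> norm (h x)"
    using abs_coswave_le by (intro AE_I2) (simp add: abs_mult mult_left_le)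
qed

lemma integral_mult_coswave:
  assumes h: "integrable cube_measure h"
  shows "(\<integral>x. h x * coswave k \<theta> x \<partial>cube_measure) = Re (cis (- \<theta>) * fcoeff (\<lambda>x. complex_of_real (h x)) k)"
proof -
  have eq: "Re (cis (- \<theta>) * (complex_of_real (h x) * cnj (wave k x))) = h x * coswave k \<theta> x" for x
  proof -
    have "cis (- \<theta>) * (complex_of_real (h x) * cnj (wave k x)) = complex_of_real (h x) * cis (- (2 * pi * (x \<bullet> freq k) + \<theta>))"
    proof -
      have "cis (- \<theta>) * cis (- y) = cis (- (y + \<theta>))" for y
        by (subst cis_mult) (rule arg_cong[where f = cis], simp)
      then show ?thesis by (simp add: wave_def cis_cnj mult.left_commute del: minus_add_distrib)
    qed
    moreover have "Re (of_real r * cis (- y)) = r * cos y" for r y by simp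
    ultimately show ?thesis by (simp only: coswave_def)
  qed
  have int: "integrable cube_measure (\<lambda>x. complex_of_real (h x) * cnj (wave k x))"
  proof (rule Bochner_Integration.integrable_bound)
    show "integrable cube_measure (\<lambda>x. complex_of_real (h x))" using h by simp
    have "(\<lambda>x. cnj (wave k x)) \<in> borel_measurable cube_measure" unfolding cnj_wave by measurable
    then show "(\<lambda>x. complex_of_real (h x) * cnj (wave k x)) \<in> borel_measurable cube_measure"
      using h by (intro borel_measurable_times) auto
  qed (auto simp: norm_mult)
  have "cis (- \<theta>) * fcoeff (\<lambda>x. complex_of_real (h x)) k = (\<integral>x. cis (- \<theta>) * (complex_of_real (h x) * cnj (wave k x)) \<partial>cube_measure)"
    unfolding fcoeff_def by simp
  also have "Re \<dots> = (\<integral>x. Re (cis (- \<theta>) * (complex_of_real (h x) * cnj (wave k x))) \<partial>cube_measure)"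
    by (rule integral_Re[symmetric]) (use int in simp)
  finally show ?thesis by (simp only: eq)
qed

lemma integral_mult_coswave_sq:
  assumes "square_integrable (\<lambda>x. complex_of_real (h x))"
  shows "(\<integral>x. h x * coswave k \<theta> x \<partial>cube_measure) = Re (cis (- \<theta>) * fcoeff (\<lambda>x. complex_of_real (h x)) k)"
    and "integrable cube_measure h"
proof -
  show "integrable cube_measure h"
    using integrable_Re[OF square_integrable_integrable[OF assms]] by simp
  then show "(\<integral>x. h x * coswave k \<theta> x \<partial>cube_measure) = Re (cis (- \<theta>) * fcoeff (\<lambda>x. complex_of_real (h x)) k)"
    by (rule integral_mult_coswave)
qed

lemma coswave_has_derivative:
  "(coswave k \<theta> has_derivative (\<lambda>h. 2 * pi * (h \<bullet> freq k) * coswave k (\<theta> + pi / 2) x)) (at x)"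
proof -
  have "cos (2 * pi * (x \<bullet> freq k) + (\<theta> + pi / 2)) = - sin (2 * pi * (x \<bullet> freq k) + \<theta>)"
    using minus_sin_cos_eq[of "2 * pi * (x \<bullet> freq k) + \<theta>"] by (simp add: add.assoc)
  then show ?thesis
    unfolding coswave_def by (auto intro!: derivative_eq_intros)
qed

lemma gradient_coswave: "gradient (coswave k \<theta>) x $ j = 2 * pi * real_of_int (k $ j) * coswave k (\<theta> + pi / 2) x"
  unfolding gradient_def
  by (simp add: frechet_derivative_at[OF coswave_has_derivative, symmetric] inner_axis')

lemma periodic_coswave: "coswave k \<theta> (x + axis i 1) = coswave k \<theta> x"
proof -
  have "2 * pi * ((x + axis i 1) \<bullet> freq k) + \<theta> = (2 * pi * (x \<bullet> freq k) + \<theta>) + 2 * pi * real_of_int (k $ i)"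
    by (simp add: inner_add_left inner_axis' distrib_left)
  then show ?thesis
    unfolding coswave_def by (simp only: cos_add cos_int_2pin sin_int_2pin) simp
qed

lemma bounded_linear_phase: "bounded_linear (\<lambda>x. 2 * pi * (x \<bullet> freq k))"
  by (intro bounded_linear_mult_right[THEN bounded_linear_compose] bounded_linear_inner_left)

lemma torus_smooth_coswave: "torus_smooth (coswave k \<theta>)"
  unfolding torus_smooth_def periodic_def smooth_on_def
proof (intro conjI allI)
  show "Ck_on n UNIV (coswave k \<theta>)" for n
    using Ck_on_cos[OF bounded_linear_phase, of n UNIV k \<theta> "1::real"] by (simp add: coswave_def[abs_def])
qed (rule periodic_coswave)

lemma complex_eq_by_phases:
  assumes "\<And>\<theta>. Re (cis (- \<theta>) * z) = Re (cis (- \<theta>) * w)"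
  shows "z = w"
  using assms[of 0] assms[of "pi / 2"] by (simp add: complex_eq_iff)

lemma cis_shift: "cis (- (\<theta> + pi / 2)) = cis (- \<theta>) * (- \<i>)"
proof -
  have "cis (- (pi / 2)) = - \<i>"
    by (simp add: complex_eq_iff)
  moreover have "cis (- (\<theta> + pi / 2)) = cis (- \<theta>) * cis (- (pi / 2))"
    unfolding cis_mult by (rule arg_cong[where f = cis]) simp
  ultimately show ?thesis by simp
qed

text \<open>Integration by parts against a cosine shifts its phase by a quarter period, which by
  \<open>cis_shift\<close> is multiplication by \<open>- \<i>\<close> on the coefficient.\<close>

lemma fcoeff_weak_gradient:
  assumes f: "in_L2 f" and G: "has_weak_gradient f G"
  shows "fcoeff (\<lambda>x. complex_of_real (G x $ i $ j)) k =
    2 * of_real pi * \<i> * of_int (k $ j) * fcoeff (\<lambda>x. complex_of_real (f x $ i)) k" (is "?G = _ * ?F")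
proof (rule complex_eq_by_phases)
  fix \<theta>
  have GL2: "in_L2 G" using G by (simp add: has_weak_gradient_def)
  have "torus_inner (\<lambda>x. f x $ i) (\<lambda>x. gradient (coswave k \<theta>) x $ j) = - torus_inner (\<lambda>x. G x $ i $ j) (coswave k \<theta>)"
    using G torus_smooth_coswave unfolding has_weak_gradient_def by blast
  moreover have "torus_inner (\<lambda>x. f x $ i) (\<lambda>x. gradient (coswave k \<theta>) x $ j)
      = 2 * pi * real_of_int (k $ j) * (\<integral>x. f x $ i * coswave k (\<theta> + pi / 2) x \<partial>cube_measure)"
    unfolding torus_inner_cube gradient_coswave inner_real_def mult.left_commute[of "f _ $ i"]
    by (simp only: mult.assoc integral_mult_right_zero)
  moreover have "torus_inner (\<lambda>x. G x $ i $ j) (coswave k \<theta>) = Re (cis (- \<theta>) * ?G)"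
    unfolding torus_inner_cube using integral_mult_coswave_sq(1)[OF in_L2_nth_nth[OF GL2]] by simp
  ultimately have "Re (cis (- \<theta>) * ?G) = - (2 * pi * real_of_int (k $ j) * Re (cis (- (\<theta> + pi / 2)) * ?F))"
    using integral_mult_coswave_sq(1)[OF in_L2_nth[OF f]] by simp
  then show "Re (cis (- \<theta>) * ?G) = Re (cis (- \<theta>) * (2 * of_real pi * \<i> * of_int (k $ j) * ?F))"
    unfolding cis_shift by (simp add: algebra_simps)
qed

lemma fcoeff_div_free:
  assumes f: "in_L2 f" and div: "weakly_div_free f"
  shows "(\<Sum>j\<in>UNIV. of_int (k $ j) * fcoeff (\<lambda>x. complex_of_real (f x $ j)) k) = 0"
proof (rule complex_eq_by_phases)
  fix \<theta>
  define F where "F j = fcoeff (\<lambda>x. complex_of_real (f x $ j)) k" for j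
  have int: "integrable cube_measure (\<lambda>x. f x $ j * coswave k (\<theta> + pi) x)" for j
    by (intro integrable_mult_coswave integral_mult_coswave_sq(2) in_L2_nth f)
  \<comment> \<open>Together with the quarter period from the gradient the phase is shifted by
    \<open>pi\<close>, which is merely a change of sign.\<close>
  have "0 = torus_inner f (gradient (coswave k (\<theta> + pi / 2)))"
    using div torus_smooth_coswave unfolding weakly_div_free_def by simp
  also have "\<dots> = (\<integral>x. (\<Sum>j\<in>UNIV. 2 * pi * real_of_int (k $ j) * (f x $ j * coswave k (\<theta> + pi) x)) \<partial>cube_measure)"
    unfolding torus_inner_cube inner_vec_def gradient_coswave by (simp add: mult_ac add.assoc)
  also have "\<dots> = (\<Sum>j\<in>UNIV. 2 * pi * real_of_int (k $ j) * (\<integral>x. f x $ j * coswave k (\<theta> + pi) x \<partial>cube_measure))"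
    using int by (subst Bochner_Integration.integral_sum) auto
  also have "\<dots> = (\<Sum>j\<in>UNIV. 2 * pi * real_of_int (k $ j) * - Re (cis (- \<theta>) * F j))"
    unfolding coswave_pi F_def using integral_mult_coswave_sq(1)[OF in_L2_nth[OF f]] by simp
  also have "\<dots> = - 2 * pi * (\<Sum>j\<in>UNIV. real_of_int (k $ j) * Re (cis (- \<theta>) * F j))"
    unfolding sum_distrib_left by (intro sum.cong) (simp_all add: algebra_simps)
  also have "(\<Sum>j\<in>UNIV. real_of_int (k $ j) * Re (cis (- \<theta>) * F j)) = Re (cis (- \<theta>) * (\<Sum>j\<in>UNIV. of_int (k $ j) * F j))"
    by (simp add: sum_distrib_left Re_sum algebra_simps)
  finally show "Re (cis (- \<theta>) * (\<Sum>j\<in>UNIV. of_int (k $ j) * F j)) = Re (cis (- \<theta>) * 0)"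
    by simp
qed

definition test_field :: "int^3 \<Rightarrow> real \<Rightarrow> real^3 \<Rightarrow> real^3 \<Rightarrow> real^3" where
  "test_field k \<theta> a x = coswave k \<theta> x *\<^sub>R a"

lemma jacobian_test_field:
  "jacobian (test_field k \<theta> a) x $ i $ j = a $ i * (2 * pi * real_of_int (k $ j)) * coswave k (\<theta> + pi / 2) x"
proof -
  have "(test_field k \<theta> a has_derivative (\<lambda>h. (2 * pi * (h \<bullet> freq k) * coswave k (\<theta> + pi / 2) x) *\<^sub>R a)) (at x)"
    unfolding test_field_def[abs_def] by (intro has_derivative_scaleR_left coswave_has_derivative)
  from frechet_derivative_at[OF this, symmetric] show ?thesis
    by (simp add: jacobian_def matrix_def inner_axis')
qed

lemma divergence_test_field:
  assumes "a \<bullet> freq k = 0"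
  shows "divergence (test_field k \<theta> a) x = 0"
proof -
  have "divergence (test_field k \<theta> a) x = (2 * pi * coswave k (\<theta> + pi / 2) x) * (\<Sum>i\<in>UNIV. a $ i * real_of_int (k $ i))"
    unfolding divergence_def trace_def jacobian_test_field by (simp add: sum_distrib_left mult_ac)
  also have "(\<Sum>i\<in>UNIV. a $ i * real_of_int (k $ i)) = a \<bullet> freq k"
    by (simp add: inner_vec_def)
  finally show ?thesis using assms by simp
qed

lemma torus_time_smooth_test_field: "torus_time_smooth I (\<lambda>t. test_field k \<theta> a)"
  unfolding torus_time_smooth_def
proof
  show "\<forall>t\<in>I. periodic (test_field k \<theta> a)"
    by (simp add: periodic_def test_field_def periodic_coswave)
  have "bounded_linear (\<lambda>z::real \<times> (real^3). 2 * pi * (snd z \<bullet> freq k))"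
    by (rule bounded_linear_compose[OF bounded_linear_phase bounded_linear_snd])
  from Ck_on_cos[OF this, of _ _ \<theta> a]
  show "smooth_on (I \<times> UNIV) (\<lambda>(t, x). test_field k \<theta> a x)"
    by (simp add: smooth_on_def test_field_def coswave_def case_prod_unfold)
qed

text \<open>Stated for integrable components because it is applied to \<open>convection\<close>, a
  product of two square-integrable factors.\<close>

lemma torus_inner_test_field:
  assumes "\<And>i. integrable cube_measure (\<lambda>x. f x $ i)"
  shows "torus_inner f (test_field k \<theta> a) =
    Re (cis (- \<theta>) * (\<Sum>i\<in>UNIV. of_real (a $ i) * fcoeff (\<lambda>x. complex_of_real (f x $ i)) k))"
proof -
  define F where "F j = fcoeff (\<lambda>x. complex_of_real (f x $ j)) k" for j
  have "torus_inner f (test_field k \<theta> a) = (\<integral>x. (\<Sum>i\<in>UNIV. a $ i * (f x $ i * coswave k \<theta> x)) \<partial>cube_measure)"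
    unfolding torus_inner_cube test_field_def inner_vec_def by (simp add: mult_ac)
  also have "\<dots> = (\<Sum>i\<in>UNIV. a $ i * (\<integral>x. f x $ i * coswave k \<theta> x \<partial>cube_measure))"
    using integrable_mult_coswave[OF assms] by (subst Bochner_Integration.integral_sum) auto
  also have "\<dots> = (\<Sum>i\<in>UNIV. a $ i * Re (cis (- \<theta>) * F i))"
    using integral_mult_coswave[OF assms] by (simp add: F_def)
  also have "\<dots> = Re (cis (- \<theta>) * (\<Sum>i\<in>UNIV. of_real (a $ i) * F i))"
    by (simp add: sum_distrib_left Re_sum algebra_simps)
  finally show ?thesis by (simp only: F_def)
qed

text \<open>One factor \<open>2 pi k_j\<close> comes from the test field and one from the weak
  gradient. The two quarter-period phases cancel, and summing the squares over \<open>j\<close>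
  gives \<open>4 pi^2 |k|^2\<close>.\<close>

lemma torus_inner_jacobian_test_field:
  assumes f: "in_L2 f" and G: "has_weak_gradient f G"
  shows "torus_inner G (jacobian (test_field k \<theta> a)) =
    Re (cis (- \<theta>) * (of_real (4 * pi\<^sup>2 * (norm (freq k))\<^sup>2) * (\<Sum>i\<in>UNIV. of_real (a $ i) * fcoeff (\<lambda>x. complex_of_real (f x $ i)) k)))"
proof -
  define F where "F j = fcoeff (\<lambda>x. complex_of_real (f x $ j)) k" for j
  have GL2: "in_L2 G" using G by (simp add: has_weak_gradient_def)
  note Gsq = in_L2_nth_nth[OF GL2]
  have int: "integrable cube_measure (\<lambda>x. G x $ i $ j * coswave k (\<theta> + pi / 2) x)" for i j
    by (intro integrable_mult_coswave integral_mult_coswave_sq(2) Gsq)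
  have "torus_inner G (jacobian (test_field k \<theta> a))
      = (\<integral>x. (\<Sum>i\<in>UNIV. \<Sum>j\<in>UNIV. (a $ i * (2 * pi * real_of_int (k $ j))) * (G x $ i $ j * coswave k (\<theta> + pi / 2) x)) \<partial>cube_measure)"
    unfolding torus_inner_cube inner_vec_def jacobian_test_field by (simp add: mult_ac)
  also have "\<dots> = (\<Sum>i\<in>UNIV. \<Sum>j\<in>UNIV. (a $ i * (2 * pi * real_of_int (k $ j))) * (\<integral>x. G x $ i $ j * coswave k (\<theta> + pi / 2) x \<partial>cube_measure))"
    using int by (simp add: Bochner_Integration.integral_sum Bochner_Integration.integrable_sum)
  also have "\<dots> = (\<Sum>i\<in>UNIV. \<Sum>j\<in>UNIV. (a $ i * (2 * pi * real_of_int (k $ j))) * Re (cis (- \<theta>) * (of_real (2 * pi * real_of_int (k $ j)) * F i)))"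
  proof (intro sum.cong refl)
    fix i j :: 3
    have "(\<integral>x. G x $ i $ j * coswave k (\<theta> + pi / 2) x \<partial>cube_measure) = Re (cis (- (\<theta> + pi / 2)) * (2 * of_real pi * \<i> * of_int (k $ j) * F i))"
      unfolding integral_mult_coswave_sq(1)[OF Gsq] fcoeff_weak_gradient[OF f G] F_def ..
    also have "cis (- (\<theta> + pi / 2)) * (2 * of_real pi * \<i> * of_int (k $ j) * F i) = cis (- \<theta>) * (of_real (2 * pi * real_of_int (k $ j)) * F i)"
      unfolding cis_shift by (simp add: algebra_simps)
    finally show "(a $ i * (2 * pi * real_of_int (k $ j))) * (\<integral>x. G x $ i $ j * coswave k (\<theta> + pi / 2) x \<partial>cube_measure)
      = (a $ i * (2 * pi * real_of_int (k $ j))) * Re (cis (- \<theta>) * (of_real (2 * pi * real_of_int (k $ j)) * F i))" by simp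
  qed
  also have "\<dots> = (\<Sum>i\<in>UNIV. \<Sum>j\<in>UNIV. (4 * pi\<^sup>2 * (real_of_int (k $ j))\<^sup>2) * (a $ i * Re (cis (- \<theta>) * F i)))"
    by (intro sum.cong refl) (simp add: power2_eq_square algebra_simps)
  also have "\<dots> = (\<Sum>j\<in>UNIV. 4 * pi\<^sup>2 * (real_of_int (k $ j))\<^sup>2) * (\<Sum>i\<in>UNIV. a $ i * Re (cis (- \<theta>) * F i))"
    by (subst sum.swap) (simp add: sum_product)
  also have "(\<Sum>j\<in>UNIV. 4 * pi\<^sup>2 * (real_of_int (k $ j))\<^sup>2) = 4 * pi\<^sup>2 * (norm (freq k))\<^sup>2"
    by (simp add: sum_distrib_left[symmetric] norm_vec_def L2_set_def sum_nonneg)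
  also have "(\<Sum>i\<in>UNIV. a $ i * Re (cis (- \<theta>) * F i)) = Re (cis (- \<theta>) * (\<Sum>i\<in>UNIV. of_real (a $ i) * F i))"
    by (simp add: sum_distrib_left Re_sum algebra_simps)
  also have "4 * pi\<^sup>2 * (norm (freq k))\<^sup>2 * Re (cis (- \<theta>) * (\<Sum>i\<in>UNIV. of_real (a $ i) * F i))
     = Re (of_real (4 * pi\<^sup>2 * (norm (freq k))\<^sup>2) * (cis (- \<theta>) * (\<Sum>i\<in>UNIV. of_real (a $ i) * F i)))"
  proof -
    have "r * Re z = Re (of_real r * z)" for r z by simp
    then show ?thesis .
  qed
  finally show ?thesis by (simp only: F_def mult_ac)
qed

text \<open>
  By incompressibility \<open>(k - l) \<cdot> u\<^sub>k\<^sub>-\<^sub>l = 0\<close>, so the derivative falling on the second factor can be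
  replaced by the output frequency \<open>k\<close>.
\<close>

lemma fcoeff_convection:
  assumes f: "in_L2 f" and G: "has_weak_gradient f (weak_gradient f)" and div: "weakly_div_free f"
    and F: "\<And>j l. F j l = fcoeff (\<lambda>x. complex_of_real (f x $ j)) l"
    and S: "\<And>j m. (\<lambda>l. F j (k - l) * F m l) summable_on UNIV"
  shows "integrable cube_measure (\<lambda>x. convection f x $ m)"
    and "fcoeff (\<lambda>x. complex_of_real (convection f x $ m)) k =
      (\<Sum>j\<in>UNIV. of_real (2 * pi * real_of_int (k $ j)) * \<i> * (\<Sum>\<^sub>\<infinity>l. F j (k - l) * F m l))"
proof -
  define G where "G = weak_gradient f"
  note G' = G[folded G_def]
  have GL2: "in_L2 G" using G' by (simp add: has_weak_gradient_def)
  note fsq = in_L2_nth[OF f] and Gsq = in_L2_nth_nth[OF GL2]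
  have conv: "convection f x $ m = (\<Sum>j\<in>UNIV. G x $ m $ j * f x $ j)" for x
    by (simp add: convection_def G_def matrix_vector_mult_def)
  have intj: "integrable cube_measure (\<lambda>x. complex_of_real (G x $ m $ j) * complex_of_real (f x $ j))" for j
    by (rule square_integrable_mult[OF Gsq fsq])
  have "integrable cube_measure (\<lambda>x. G x $ m $ j * f x $ j)" for j
    using integrable_Re[OF intj[of j]] by simp
  then show "integrable cube_measure (\<lambda>x. convection f x $ m)"
    unfolding conv by (intro Bochner_Integration.integrable_sum)
  have cw: "integrable cube_measure (\<lambda>x. complex_of_real (G x $ m $ j) * complex_of_real (f x $ j) * cnj (wave k x))" for j
    using square_integrable_mult[OF Gsq square_integrable_mult_wave(2)[OF fsq]] by (simp add: mult.assoc)
  \<comment> \<open>The convolution theorem with the gradient entry at frequency \<open>l\<close>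
    and the transporting component at \<open>k - l\<close>.\<close>
  define t where "t j l = (2 * of_real pi * \<i> * of_int (l $ j)) * (F j (k - l) * F m l)" for j l
  have term_sum: "(t j has_sum fcoeff (\<lambda>x. complex_of_real (G x $ m $ j) * complex_of_real (f x $ j)) k) UNIV" for j
    using fcoeff_mult_has_sum[OF Gsq fsq, of m j j k]
    unfolding fcoeff_weak_gradient[OF f G'] F[symmetric] t_def by (simp add: mult_ac)
  have "fcoeff (\<lambda>x. complex_of_real (convection f x $ m)) k
      = (\<Sum>j\<in>UNIV. fcoeff (\<lambda>x. complex_of_real (G x $ m $ j) * complex_of_real (f x $ j)) k)"
    unfolding fcoeff_def conv using cw
    by (simp add: sum_distrib_right Bochner_Integration.integral_sum)
  also have "\<dots> = (\<Sum>j\<in>UNIV. infsum (t j) UNIV)"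
    using term_sum by (simp add: has_sum_iff)
  also have "\<dots> = (\<Sum>\<^sub>\<infinity>l. \<Sum>j\<in>UNIV. t j l)"
    by (rule infsum_finite_sum[THEN conjunct2, symmetric]) (use term_sum in \<open>auto simp: has_sum_iff\<close>)
  also have "\<dots> = (\<Sum>\<^sub>\<infinity>l. \<Sum>j\<in>UNIV. (of_real (2 * pi * real_of_int (k $ j)) * \<i>) * (F j (k - l) * F m l))"
  proof (rule infsum_cong)
    fix l
    have "(\<Sum>j\<in>UNIV. of_int ((k - l) $ j) * F j (k - l)) = 0"
      unfolding F by (rule fcoeff_div_free[OF f div])
    then have "(\<Sum>j\<in>UNIV. of_int (k $ j) * F j (k - l)) = (\<Sum>j\<in>UNIV. of_int (l $ j) * F j (k - l))"
      by (simp add: left_diff_distrib sum_subtractf)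
    then have "(2 * of_real pi * \<i> * F m l) * (\<Sum>j\<in>UNIV. of_int (k $ j) * F j (k - l)) = (2 * of_real pi * \<i> * F m l) * (\<Sum>j\<in>UNIV. of_int (l $ j) * F j (k - l))"
      by simp
    then show "(\<Sum>j\<in>UNIV. t j l) = (\<Sum>j\<in>UNIV. (of_real (2 * pi * real_of_int (k $ j)) * \<i>) * (F j (k - l) * F m l))"
      by (simp add: t_def sum_distrib_left mult_ac)
  qed
  also have "\<dots> = (\<Sum>j\<in>UNIV. \<Sum>\<^sub>\<infinity>l. (of_real (2 * pi * real_of_int (k $ j)) * \<i>) * (F j (k - l) * F m l))"
    by (rule infsum_finite_sum[THEN conjunct2]) (auto intro: summable_on_cmult_right S)
  also have "\<dots> = (\<Sum>j\<in>UNIV. of_real (2 * pi * real_of_int (k $ j)) * \<i> * (\<Sum>\<^sub>\<infinity>l. F j (k - l) * F m l))"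
    by (simp add: infsum_cmult_right S)
  finally show "fcoeff (\<lambda>x. complex_of_real (convection f x $ m)) k =
      (\<Sum>j\<in>UNIV. of_real (2 * pi * real_of_int (k $ j)) * \<i> * (\<Sum>\<^sub>\<infinity>l. F j (k - l) * F m l))" .
qed

text \<open>Makes each row of the projection an admissible amplitude for a divergence-free test
  field.\<close>

lemma leray_orthogonal: "(\<chi> m. leray i k m) \<bullet> freq k = 0"
proof (cases "k = 0")
  case False
  have n: "(norm (freq k))\<^sup>2 = (\<Sum>m\<in>UNIV. (real_of_int (k $ m))\<^sup>2)"
    by (simp add: norm_vec_def L2_set_def sum_nonneg)
  have "(\<chi> m. leray i k m) \<bullet> freq k = (\<Sum>m\<in>UNIV. (if i = m then real_of_int (k $ m) else 0) - real_of_int (k $ i) / (norm (freq k))\<^sup>2 * (real_of_int (k $ m))\<^sup>2)"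
    by (auto simp: inner_vec_def leray_def left_diff_distrib power2_eq_square intro!: sum.cong)
  also have "\<dots> = real_of_int (k $ i) - real_of_int (k $ i) / (norm (freq k))\<^sup>2 * (norm (freq k))\<^sup>2"
    unfolding sum_subtractf n sum_distrib_left[symmetric] by simp
  also have "\<dots> = 0" using False by simp
  finally show ?thesis .
qed simp

lemma leray_div_free:
  assumes "(\<Sum>m\<in>UNIV. of_int (k $ m) * F m) = (0 :: complex)"
  shows "(\<Sum>m\<in>UNIV. of_real (leray i k m) * F m) = F i"
proof -
  have "(\<Sum>m\<in>UNIV. of_real (leray i k m) * F m)
      = (\<Sum>m\<in>UNIV. (if i = m then F m else 0) - of_real (real_of_int (k $ i) / (norm (freq k))\<^sup>2) * (of_int (k $ m) * F m))"
    by (intro sum.cong) (auto simp: leray_def left_diff_distrib)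
  also have "\<dots> = F i"
    unfolding sum_subtractf sum_distrib_left[symmetric] assms by simp
  finally show ?thesis .
qed

section \<open>From the integrated equation to a differential equation\<close>

text \<open>The integrand of the weak formulation is identified only at almost every time. Agreement
  with a continuous function there makes it integrable and opens the way to the fundamental theorem
  of calculus.\<close>

lemma LINT_eq_integral_continuous:
  fixes f g :: "real \<Rightarrow> real"
  assumes g: "continuous_on {a..b} g" and ae: "AE t in lebesgue. t \<in> {a<..<b} \<longrightarrow> f t = g t"
  shows "(LINT t:{a..b}|lebesgue. f t) = integral {a..b} g"
proof -
  obtain N where N: "negligible N" "{t. \<not> (t \<in> {a<..<b} \<longrightarrow> f t = g t)} \<subseteq> N"
    using ae unfolding eventually_ae_filter_negligible by blast
  have neg: "negligible (N \<union> {a, b})" using N(1) by auto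
  have eq: "f t = g t" if "t \<in> {a..b} - (N \<union> {a, b})" for t
    using that N(2) by force
  have "g absolutely_integrable_on {a..b}"
    by (rule absolutely_integrable_continuous_real[OF g])
  then have "f absolutely_integrable_on {a..b}"
    by (rule absolutely_integrable_spike[OF _ neg]) (rule eq)
  then have "(LINT t:{a..b}|lebesgue. f t) = integral {a..b} f"
    by (rule set_lebesgue_integral_eq_integral)
  also have "\<dots> = integral {a..b} g"
    by (rule integral_spike[OF neg]) (use eq in auto)
  finally show ?thesis .
qed

text \<open>Each phase gives a real identity that the fundamental theorem differentiates; the phases
  0 and \<open>pi / 2\<close> reassemble the complex derivative.\<close>

lemma integral_identity_imp_derivative:
  fixes c H :: "real \<Rightarrow> complex"
  assumes H: "continuous_on {0..b} H" and t: "0 < t" "t < b"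
    and id: "\<And>\<theta> s. s \<in> {0..b} \<Longrightarrow> Re (cis (- \<theta>) * c s) + integral {0..s} (\<lambda>\<tau>. Re (cis (- \<theta>) * H \<tau>)) = C \<theta>"
  shows "(c has_vector_derivative - H t) (at t)"
proof -
  have der: "((\<lambda>s. Re (cis (- \<theta>) * c s)) has_real_derivative - Re (cis (- \<theta>) * H t)) (at t)" for \<theta>
  proof -
    have "continuous_on {0..b} (\<lambda>\<tau>. Re (cis (- \<theta>) * H \<tau>))"
      by (intro continuous_intros H)
    then have "((\<lambda>s. integral {0..s} (\<lambda>\<tau>. Re (cis (- \<theta>) * H \<tau>))) has_real_derivative Re (cis (- \<theta>) * H t)) (at t within {0..b})"
      by (rule integral_has_real_derivative) (use t in auto)
    then have "((\<lambda>s. integral {0..s} (\<lambda>\<tau>. Re (cis (- \<theta>) * H \<tau>))) has_real_derivative Re (cis (- \<theta>) * H t)) (at t)"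
      using t by (simp add: at_within_Icc_at)
    then have "((\<lambda>s. C \<theta> - integral {0..s} (\<lambda>\<tau>. Re (cis (- \<theta>) * H \<tau>))) has_real_derivative - Re (cis (- \<theta>) * H t)) (at t)"
      by (auto intro!: derivative_eq_intros)
    then show ?thesis
    proof (rule has_field_derivative_transform_within_open[where S = "{0<..<b}"])
      show "C \<theta> - integral {0..s} (\<lambda>\<tau>. Re (cis (- \<theta>) * H \<tau>)) = Re (cis (- \<theta>) * c s)" if "s \<in> {0<..<b}" for s
        using id[of s \<theta>] that by auto
    qed (use t in auto)
  qed
  have "((\<lambda>s. Re (c s)) has_real_derivative - Re (H t)) (at t)" "((\<lambda>s. Im (c s)) has_real_derivative - Im (H t)) (at t)"
    using der[of 0] der[of "pi / 2"] by simp_all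
  then have "((\<lambda>s. Re (c s) *\<^sub>R 1 + Im (c s) *\<^sub>R \<i>) has_vector_derivative (- Re (H t)) *\<^sub>R 1 + (- Im (H t)) *\<^sub>R \<i>) (at t)"
    using has_vector_derivative_scaleR[OF _ has_vector_derivative_const[of "1::complex"]]
      has_vector_derivative_scaleR[OF _ has_vector_derivative_const[of \<i>]]
    by (intro has_vector_derivative_add) fastforce+
  moreover have "Re z *\<^sub>R 1 + Im z *\<^sub>R \<i> = z" for z
    by (simp add: complex_eq_iff)
  moreover have "(- Re (H t)) *\<^sub>R 1 + (- Im (H t)) *\<^sub>R \<i> = - H t"
    by (simp add: complex_eq_iff)
  ultimately show ?thesis by simp
qed

lemma time_oo_subset: "time_oo T \<subseteq> time_co T"
  by (auto simp: time_oo_def time_co_def)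

lemma open_time_oo: "open (time_oo T)"
proof (cases T)
  case (real r)
  then have "time_oo T = {0<..<r}" by (auto simp: time_oo_def)
  then show ?thesis by simp
next
  case PInf
  then have "time_oo T = {0<..}" by (auto simp: time_oo_def)
  then show ?thesis by simp
qed (simp add: time_oo_def)

lemma time_co_down: "t \<in> time_co T \<Longrightarrow> 0 \<le> s \<Longrightarrow> s \<le> t \<Longrightarrow> s \<in> time_co T"
  unfolding time_co_def using ereal_less_eq(3) order_le_less_trans by blast

lemma time_oo_down: "t \<in> time_oo T \<Longrightarrow> 0 < s \<Longrightarrow> s \<le> t \<Longrightarrow> s \<in> time_oo T"
  unfolding time_oo_def using ereal_less_eq(3) order_le_less_trans by blast

lemma in_L2_test_field: "in_L2 (test_field k \<theta> a)"
proof -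
  have cont: "continuous_on S (test_field k \<theta> a)" for S
    unfolding test_field_def[abs_def] by (intro continuous_intros continuous_coswave)
  have meas: "test_field k \<theta> a \<in> borel_measurable cube_measure"
    by (intro measurable_cube_borel borel_measurable_continuous_onI cont)
  have "integrable cube_measure (\<lambda>x. (norm (test_field k \<theta> a x))\<^sup>2)"
  proof (rule integrable_cube_bounded)
    show "norm ((norm (test_field k \<theta> a x))\<^sup>2) \<le> (norm a)\<^sup>2" for x
      using abs_coswave_le[of k \<theta> x] by (auto simp: test_field_def intro!: power_mono mult_left_le_one_le)
  qed (use meas in auto)
  then show ?thesis
    using meas by (simp add: in_L2_def set_borel_measurable_def set_integrable_def
        borel_measurable_restrict_space_iff integrable_restrict_space)
qed

section \<open>The coefficient equation of a given solution\<close>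

locale leray_hopf_solution =
  fixes T :: ereal and \<psi> :: "real^3 \<Rightarrow> real^3" and u :: "real \<Rightarrow> real^3 \<Rightarrow> real^3"
  assumes T: "T > 0" and lh: "leray_hopf T \<psi> u"
begin

definition U :: "3 \<Rightarrow> int^3 \<Rightarrow> real \<Rightarrow> complex" where
  "U i k t = fourier_coeff (u t) k $ i"

lemma U_fcoeff: "U i k t = fcoeff (\<lambda>x. complex_of_real (u t x $ i)) k"
  by (simp add: U_def fourier_coeff_nth)

lemma L2: "t \<in> time_co T \<Longrightarrow> in_L2 (u t)"
  and div_free: "t \<in> time_co T \<Longrightarrow> weakly_div_free (u t)"
  using lh by (auto simp: leray_hopf_def)

text \<open>Three components, each estimated by \<open>norm_fcoeff_le\<close> and the energy
  inequality.\<close>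

definition M :: real where "M = 3 * (1 + (torus_norm \<psi>)\<^sup>2)"

lemma M_nonneg: "M \<ge> 0"
  by (simp add: M_def)

lemma U_bounded:
  assumes t: "t \<in> time_co T"
  shows "(\<Sum>i\<in>UNIV. norm (U i k t)) \<le> M"
proof -
  have "0 \<le> (LINT \<tau>:{0..t}|lebesgue. (torus_norm (weak_gradient (u \<tau>)))\<^sup>2)"
    unfolding set_lebesgue_integral_def by (rule integral_nonneg_AE) auto
  then have energy: "(torus_norm (u t))\<^sup>2 \<le> (torus_norm \<psi>)\<^sup>2"
    using lh t unfolding leray_hopf_def energy_inequality_def by fastforce
  have "norm (U i k t) \<le> 1 + (torus_norm \<psi>)\<^sup>2" for i
  proof -
    have "norm (U i k t) \<le> 1 + sq_norm (\<lambda>x. complex_of_real (u t x $ i))"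
      unfolding U_fcoeff sq_norm_def by (rule norm_fcoeff_le[OF in_L2_nth[OF L2[OF t]]])
    also have "sq_norm (\<lambda>x. complex_of_real (u t x $ i)) \<le> (torus_norm (u t))\<^sup>2"
      by (rule in_L2_component(2)[OF L2[OF t]]) (auto intro!: continuous_intros component_le_norm_cart)
    finally show ?thesis using energy by linarith
  qed
  then have "(\<Sum>i\<in>UNIV. norm (U i k t)) \<le> (\<Sum>i\<in>(UNIV::3 set). 1 + (torus_norm \<psi>)\<^sup>2)"
    by (intro sum_mono)
  then show ?thesis by (simp add: M_def)
qed

lemma torus_inner_u_test_field:
  assumes "t \<in> time_co T"
  shows "torus_inner (u t) (test_field k \<theta> a) = Re (cis (- \<theta>) * (\<Sum>i\<in>UNIV. of_real (a $ i) * U i k t))"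
  unfolding U_fcoeff by (rule torus_inner_test_field) (rule integral_mult_coswave_sq(2)[OF in_L2_nth[OF L2[OF assms]]])

text \<open>Weak continuity tested with cosine fields in an axis direction; two phases recover the
  complex value.\<close>

lemma U_continuous: "continuous_on (time_co T) (U i k)"
proof -
  have cont: "continuous_on (time_co T) (\<lambda>t. Re (cis (- \<theta>) * U i k t))" for \<theta>
  proof -
    have "continuous_on (time_co T) (\<lambda>t. torus_inner (u t) (test_field k \<theta> (axis i 1)))"
      using lh in_L2_test_field unfolding leray_hopf_def weakly_continuous_def by blast
    moreover have "(\<Sum>j\<in>UNIV. of_real ((axis i 1 :: real^3) $ j) * U j k t) = U i k t" for t
      by (simp add: axis_def if_distrib[of of_real] if_distrib[of "\<lambda>x. x * _"] cong: if_cong)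
    ultimately show ?thesis
      by (simp add: torus_inner_u_test_field cong: continuous_on_cong)
  qed
  have "continuous_on (time_co T) (\<lambda>t. Complex (Re (cis (- 0) * U i k t)) (Re (cis (- (pi / 2)) * U i k t)))"
    by (intro continuous_on_Complex cont)
  moreover have "Complex (Re (cis (- 0) * z)) (Re (cis (- (pi / 2)) * z)) = z" for z
    by (simp add: complex_eq_iff)
  ultimately show ?thesis by simp
qed

lemma U_div_free:
  assumes "t \<in> time_co T"
  shows "(\<Sum>m\<in>UNIV. of_int (k $ m) * U m k t) = 0"
  unfolding U_fcoeff by (rule fcoeff_div_free[OF L2[OF assms] div_free[OF assms]])

lemma AE_in_H1: "AE t in lebesgue. t \<in> time_oo T \<longrightarrow> in_H1 (u t)"
  using lh by (simp add: leray_hopf_def L2_H1_def)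

text \<open>
  Testing with \<open>cos (2\<pi> k \<cdot> x + \<theta>)\<close> times a row of the Leray projection gives the Fourier side of
  the equation in integrated form.
\<close>

lemma U_integral_identity:
  assumes t: "t \<in> time_co T"
    and S: "\<And>\<tau> j m. \<tau> \<in> time_co T \<Longrightarrow> (\<lambda>l. U j (k - l) \<tau> * U m l \<tau>) summable_on UNIV"
    and cont: "continuous_on (time_co T) (nonlin U i k)"
  defines "H \<equiv> \<lambda>\<tau>. of_real (4 * pi\<^sup>2 * (norm (freq k))\<^sup>2) * U i k \<tau> + nonlin U i k \<tau>"
  shows "Re (cis (- \<theta>) * U i k t) + integral {0..t} (\<lambda>\<tau>. Re (cis (- \<theta>) * H \<tau>))
    = torus_inner \<psi> (test_field k \<theta> (\<chi> m. leray i k m))"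
proof -
  define a where "a = (\<chi> m. leray i k m)"
  define \<phi> where "\<phi> = (\<lambda>t::real. test_field k \<theta> a)"
  have leray: "(\<Sum>m\<in>UNIV. of_real (a $ m) * U m k \<tau>) = U i k \<tau>" if "\<tau> \<in> time_co T" for \<tau>
    unfolding a_def using leray_div_free[OF U_div_free[OF that]] by simp
  have "torus_time_smooth (time_co T) \<phi> \<and> (\<forall>t\<in>time_co T. \<forall>x. divergence (\<phi> t) x = 0)"
    unfolding \<phi>_def using torus_time_smooth_test_field divergence_test_field leray_orthogonal by (simp add: a_def)
  moreover have "weak_NS T \<psi> u" using lh by (simp add: leray_hopf_def)
  ultimately have weak: "torus_inner (u t) (\<phi> t)
          + (LINT \<tau>:{0..t}|lebesgue.
               - torus_inner (u \<tau>) (\<lambda>x. vector_derivative (\<lambda>s. \<phi> s x) (at \<tau> within time_co T))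
               + torus_inner (weak_gradient (u \<tau>)) (jacobian (\<phi> \<tau>))
               + torus_inner (convection (u \<tau>)) (\<phi> \<tau>))
          = torus_inner \<psi> (\<phi> 0)"
    using t unfolding weak_NS_def by blast
  have sub: "{0..t} \<subseteq> time_co T" using time_co_down[OF t] by auto
  have "(LINT \<tau>:{0..t}|lebesgue.
               - torus_inner (u \<tau>) (\<lambda>x. vector_derivative (\<lambda>s. \<phi> s x) (at \<tau> within time_co T))
               + torus_inner (weak_gradient (u \<tau>)) (jacobian (\<phi> \<tau>))
               + torus_inner (convection (u \<tau>)) (\<phi> \<tau>))
      = integral {0..t} (\<lambda>\<tau>. Re (cis (- \<theta>) * H \<tau>))"
  proof (rule LINT_eq_integral_continuous)
    show "continuous_on {0..t} (\<lambda>\<tau>. Re (cis (- \<theta>) * H \<tau>))"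
      unfolding H_def
      by (intro continuous_intros continuous_on_subset[OF U_continuous sub] continuous_on_subset[OF cont sub])
    show "AE \<tau> in lebesgue. \<tau> \<in> {0<..<t} \<longrightarrow>
        - torus_inner (u \<tau>) (\<lambda>x. vector_derivative (\<lambda>s. \<phi> s x) (at \<tau> within time_co T))
               + torus_inner (weak_gradient (u \<tau>)) (jacobian (\<phi> \<tau>))
               + torus_inner (convection (u \<tau>)) (\<phi> \<tau>) = Re (cis (- \<theta>) * H \<tau>)"
      using AE_in_H1
    proof eventually_elim
      case (elim \<tau>)
      show ?case
      proof
        assume \<tau>: "\<tau> \<in> {0<..<t}"
        then have \<tau>co: "\<tau> \<in> time_co T" using sub by auto
        then have \<tau>oo: "\<tau> \<in> time_oo T" using \<tau> by (auto simp: time_co_def time_oo_def)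
        \<comment> \<open>The choice operator is meaningful only where the solution lies in
          \<open>H^1\<close>, hence the restriction to almost every time.\<close>
        have G: "has_weak_gradient (u \<tau>) (weak_gradient (u \<tau>))"
          using elim \<tau>oo unfolding in_H1_def weak_gradient_def by (metis someI_ex)
        have "\<tau> \<in> interior (time_co T)"
          using interior_maximal[OF time_oo_subset open_time_oo] \<tau>oo by blast
        then have at: "at \<tau> within time_co T = at \<tau>" by (rule at_within_interior)
        have 1: "torus_inner (u \<tau>) (\<lambda>x. vector_derivative (\<lambda>s. \<phi> s x) (at \<tau> within time_co T)) = 0"
          unfolding at \<phi>_def by (simp add: torus_inner_cube)
        have 2: "torus_inner (weak_gradient (u \<tau>)) (jacobian (\<phi> \<tau>)) = Re (cis (- \<theta>) * (of_real (4 * pi\<^sup>2 * (norm (freq k))\<^sup>2) * U i k \<tau>))"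
          unfolding \<phi>_def torus_inner_jacobian_test_field[OF L2[OF \<tau>co] G] U_fcoeff[symmetric] leray[OF \<tau>co] ..
        note conv = fcoeff_convection[OF L2[OF \<tau>co] G div_free[OF \<tau>co], of "\<lambda>j l. U j l \<tau>", OF U_fcoeff S[OF \<tau>co]]
        have 3: "torus_inner (convection (u \<tau>)) (\<phi> \<tau>) = Re (cis (- \<theta>) * nonlin U i k \<tau>)"
          unfolding \<phi>_def torus_inner_test_field[OF conv(1)] conv(2)
          by (simp add: nonlin_def convol_def a_def sum_distrib_left mult_ac)
        show "- torus_inner (u \<tau>) (\<lambda>x. vector_derivative (\<lambda>s. \<phi> s x) (at \<tau> within time_co T))
               + torus_inner (weak_gradient (u \<tau>)) (jacobian (\<phi> \<tau>))
               + torus_inner (convection (u \<tau>)) (\<phi> \<tau>) = Re (cis (- \<theta>) * H \<tau>)"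
          unfolding 1 2 3 H_def by (simp add: distrib_left)
      qed
    qed
  qed
  moreover have "torus_inner (u t) (\<phi> t) = Re (cis (- \<theta>) * U i k t)"
    unfolding \<phi>_def torus_inner_u_test_field[OF t] leray[OF t] ..
  ultimately show ?thesis using weak by (simp add: \<phi>_def a_def)
qed

end

text \<open>The series converges uniformly in space, and the coefficient functional is continuous
  for uniform convergence.\<close>

lemma fcoeff_synth:
  assumes g: "(\<lambda>k. norm (g k t)) summable_on UNIV"
  shows "square_integrable (\<lambda>x. synth g (t, x))" and "fcoeff (\<lambda>x. synth g (t, x)) k = g k t"
proof -
  define V where "V x = synth g (t, x)" for x
  have V: "V x = (\<Sum>\<^sub>\<infinity>k. g k t * wave k x)" for x by (simp add: V_def synth_def)
  have lim: "uniform_limit UNIV (\<lambda>F x. \<Sum>l\<in>F. g l t * wave l x) V (finite_subsets_at_top UNIV)"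
    unfolding V[abs_def] by (rule Weierstrass_m_test_general[OF _ g]) (simp add: norm_mult)
  have "continuous_on UNIV V"
    unfolding V[abs_def]
    by (rule continuous_on_infsum[OF _ _ g]) (auto simp: norm_mult intro!: continuous_intros continuous_wave)
  then have meas: "V \<in> borel_measurable cube_measure"
    by (intro measurable_cube_borel borel_measurable_continuous_onI)
  have sq: "square_integrable V"
  proof (rule square_integrable_bounded[OF meas])
    fix x
    have "(\<lambda>k. norm (g k t * wave k x)) summable_on UNIV" using g by (simp add: norm_mult)
    from norm_infsum_bound[OF this] show "norm (V x) \<le> (\<Sum>\<^sub>\<infinity>k. norm (g k t))"
      unfolding V by (simp add: norm_mult)
  qed
  then show "square_integrable (\<lambda>x. synth g (t, x))" by (simp add: V_def[abs_def])
  have small: "norm (fcoeff V k - g k t) \<le> e" if e: "e > 0" for e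
  proof -
    obtain X where X: "finite X" "\<And>F. finite F \<Longrightarrow> X \<subseteq> F \<Longrightarrow> \<forall>x. dist (\<Sum>l\<in>F. g l t * wave l x) (V x) < e"
      using uniform_limitD[OF lim e] unfolding eventually_finite_subsets_at_top by auto
    \<comment> \<open>With \<open>k\<close> included, the partial sum already has
      \<open>k\<close>-th coefficient exactly \<open>g k t\<close>.\<close>
    define F where "F = insert k X"
    define P where "P x = (\<Sum>l\<in>F. g l t * wave l x)" for x
    have F: "finite F" "X \<subseteq> F" using X by (auto simp: F_def)
    have Psq: "square_integrable P"
      unfolding P_def by (intro square_integrable_sum square_integrable_cmult square_integrable_wave F)
    have "fcoeff P k = (\<Sum>l\<in>F. g l t * fcoeff (wave l) k)"
      unfolding P_def using F
      by (subst fcoeff_sum) (auto simp: fcoeff_cmult intro: square_integrable_cmult square_integrable_wave)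
    also have "\<dots> = (\<Sum>l\<in>F. if l = k then g k t else 0)"
      by (intro sum.cong) (auto simp: fcoeff_wave)
    also have "\<dots> = g k t" using F by (simp add: F_def)
    finally have P: "fcoeff P k = g k t" .
    have "norm (fcoeff V k - g k t) = norm (fcoeff (\<lambda>x. V x - P x) k)"
      using fcoeff_diff[OF sq Psq] P by simp
    also have "\<dots> \<le> (\<integral>x. e \<partial>cube_measure)"
      unfolding fcoeff_def
    proof (rule Bochner_Integration.integral_norm_bound_integral)
      show "integrable cube_measure (\<lambda>x. (V x - P x) * cnj (wave k x))"
        by (intro integrable_mult_wave square_integrable_diff sq Psq)
      fix x
      have "norm (V x - P x) < e"
        using X(2)[OF F] by (simp add: P_def dist_norm norm_minus_commute)
      then show "norm ((V x - P x) * cnj (wave k x)) \<le> e" by (simp add: norm_mult)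
    qed simp
    also have "\<dots> = e" by (simp add: measure_restrict_space)
    finally show ?thesis .
  qed
  then have "norm (fcoeff V k - g k t) \<le> 0"
    by (rule field_le_epsilon[of _ 0, simplified])
  then show "fcoeff (\<lambda>x. synth g (t, x)) k = g k t" by (simp add: V_def[abs_def])
qed

section \<open>Smoothness in time and conclusion\<close>

context fourier_navier_stokes
begin

lemma rapid_family_U: "rapid_family I (U i)"
  unfolding rapid_family_def
proof (intro conjI allI impI)
  show "continuous_on I (U i k)" for k
    by (rule continuous_on_vector_derivative) (use ode has_vector_derivative_at_within in blast)
  fix m a b assume ab: "{a..b} \<subseteq> I"
  show "\<exists>C. \<forall>t\<in>{a..b}. \<forall>k. (1 + norm (freq k)) ^ m * norm (U i k t) \<le> C"
  proof (cases "a \<le> b")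
    case True
    then have "a \<in> I" "b \<in> I" using ab by auto
    then obtain C where C: "\<And>t k. t \<in> {a..b} \<Longrightarrow> (1 + norm (freq k)) ^ m * A k t \<le> C"
      using rapid_decay[of a b m] I_pos True by blast
    have "(1 + norm (freq k)) ^ m * norm (U i k t) \<le> C" if "t \<in> {a..b}" for t k
      by (rule order_trans[OF mult_left_mono[OF norm_U_le] C[OF that]]) simp
    then show ?thesis by blast
  qed auto
qed

text \<open>The equation expresses the time derivative through multipliers and convolutions of
  \<open>U\<close>, so it has as many time derivatives as \<open>U\<close>. The two orders lost to
  the Laplacian are harmless under rapid decay.\<close>

lemma smooth_family_U:
  assumes "open I"
  shows "smooth_family n I (U i)"
proof (induction n arbitrary: i)
  case 0
  then show ?case using rapid_family_U by simp
next
  case (Suc n)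
  show ?case
  proof (rule smooth_family_SucI[OF rapid_family_U ode])
    have lap: "smooth_family n I (\<lambda>k t. (- of_real (4 * pi\<^sup>2 * (norm (freq k))\<^sup>2)) * U i k t)"
    proof (rule smooth_family_symbol[where B = "4 * pi\<^sup>2" and p = 2, OF _ Suc.IH])
      show "norm (- of_real (4 * pi\<^sup>2 * (norm (freq k))\<^sup>2) :: complex) \<le> 4 * pi\<^sup>2 * (1 + norm (freq k))\<^sup>2" for k
        unfolding norm_minus_cancel norm_of_real by (auto simp: abs_mult intro!: mult_left_mono power_mono)
    qed
    have nl: "smooth_family n I (\<lambda>k t. (-1) * nonlin U i k t)"
    proof (rule smooth_family_symbol[where B = 1 and p = 0])
      show "smooth_family n I (\<lambda>k t. nonlin U i k t)"
        unfolding nonlin_def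
      proof (intro smooth_family_sum finite)
        fix m j :: 3
        show "smooth_family n I (\<lambda>k t. of_real (leray i k m * (2 * pi * real_of_int (k $ j))) * \<i> * convol (U j) (U m) k t)"
        proof (rule smooth_family_symbol[where B = "4 * pi" and p = 1])
          fix k
          have "\<bar>leray i k m\<bar> * (2 * pi * \<bar>real_of_int (k $ j)\<bar>) \<le> 2 * (2 * pi * (1 + norm (freq k)))"
            using abs_le_norm_freq[of k j] by (intro mult_mono abs_leray_le) auto
          then show "norm (of_real (leray i k m * (2 * pi * real_of_int (k $ j))) * \<i>) \<le> 4 * pi * (1 + norm (freq k)) ^ 1"
            by (simp add: norm_mult abs_mult)
        next
          show "smooth_family n I (convol (U j) (U m))"
            by (intro smooth_family_convol assms Suc.IH)
        qed
      qed
    qed simp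
    show "smooth_family n I (\<lambda>k t. - of_real (4 * pi\<^sup>2 * (norm (freq k))\<^sup>2) * U i k t - nonlin U i k t)"
      using smooth_family_add[OF lap nl] by simp
  qed
qed

end

text \<open>The smallness hypothesis concerns positive times, whereas the integrated equation starts
  at 0; continuity carries the bound over.\<close>

lemma continuous_le_at_left_end:
  fixes f :: "real \<Rightarrow> real"
  assumes "continuous_on {0..b} f" "0 < b" "\<And>t. t \<in> {0<..<b} \<Longrightarrow> f t \<le> c"
  shows "f 0 \<le> c"
proof -
  have "(f \<longlongrightarrow> f 0) (at 0 within {0..b})"
    using assms(1,2) by (simp add: continuous_on)
  then have "(f \<longlongrightarrow> f 0) (at_right 0)"
    using assms(2) by (simp add: at_within_Icc_at_right)
  moreover have "\<forall>\<^sub>F t in at_right 0. f t \<le> c"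
    unfolding eventually_at_right_field using assms(2,3) by (intro exI[of _ b]) auto
  ultimately show ?thesis
    by (rule tendsto_upperbound) simp
qed

context leray_hopf_solution
begin

text \<open>The factor 3 arises because each of the three components is bounded by the norm of the
  whole coefficient vector.\<close>

lemma coefficients_small:
  assumes K: "K > 0"
    and sup: "\<And>t. t \<in> time_oo T \<Longrightarrow> (SUP k\<in>{k :: int^3. norm (freq k) \<ge> K}.
       ereal ((norm (freq k))\<^sup>2 * norm (fourier_coeff (u t) k))) < ereal \<epsilon>"
    and t: "t \<in> time_co T" and k: "K \<le> norm (freq k)"
  shows "(\<Sum>i\<in>UNIV. norm (U i k t)) \<le> 3 * \<epsilon> * inv_sq k"
proof -
  have oo: "(\<Sum>i\<in>UNIV. norm (U i k t)) \<le> 3 * \<epsilon> * inv_sq k" if t: "t \<in> time_oo T" for t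
  proof -
    have "ereal ((norm (freq k))\<^sup>2 * norm (fourier_coeff (u t) k)) < ereal \<epsilon>"
      by (rule order_le_less_trans[OF SUP_upper sup[OF t]]) (use k in simp)
    then have "norm (fourier_coeff (u t) k) * (norm (freq k))\<^sup>2 \<le> \<epsilon>" by (simp add: mult.commute)
    moreover have "(norm (freq k))\<^sup>2 > 0" using K k by (intro zero_less_power) linarith
    ultimately have le: "norm (fourier_coeff (u t) k) \<le> \<epsilon> * inv_sq k"
      by (simp add: inv_sq_def pos_le_divide_eq)
    have "(\<Sum>i\<in>UNIV. norm (U i k t)) \<le> (\<Sum>i\<in>(UNIV::3 set). \<epsilon> * inv_sq k)"
      unfolding U_def by (intro sum_mono order_trans[OF Finite_Cartesian_Product.norm_nth_le le])
    then show ?thesis by simp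
  qed
  show ?thesis
  proof (cases "t = 0")
    case False
    then show ?thesis using t by (intro oo) (auto simp: time_co_def time_oo_def)
  next
    case True
    obtain b where b: "0 < b" "ereal b < T"
      using T ereal_dense2[of 0 T] by (auto simp: zero_ereal_def)
    have sub: "{0..b} \<subseteq> time_co T"
      using b(2) time_co_down[of b T] b(1) by (auto simp: time_co_def)
    show ?thesis
      unfolding True
    proof (rule continuous_le_at_left_end[OF _ b(1)])
      show "continuous_on {0..b} (\<lambda>t. \<Sum>i\<in>UNIV. norm (U i k t))"
        by (intro continuous_intros continuous_on_subset[OF U_continuous sub])
      show "(\<Sum>i\<in>UNIV. norm (U i k t)) \<le> 3 * \<epsilon> * inv_sq k" if "t \<in> {0<..<b}" for t
      proof (rule oo)
        have "t \<in> time_co T" using that sub by auto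
        then show "t \<in> time_oo T" using that by (auto simp: time_co_def time_oo_def)
      qed
    qed
  qed
qed

theorem has_smooth_version:
  assumes K: "K > 0" and \<epsilon>: "\<epsilon> > 0" "96 * \<epsilon> * conv_const \<le> 1"
    and sup: "\<And>t. t \<in> time_oo T \<Longrightarrow> (SUP k\<in>{k :: int^3. norm (freq k) \<ge> K}.
       ereal ((norm (freq k))\<^sup>2 * norm (fourier_coeff (u t) k))) < ereal \<epsilon>"
  shows "has_smooth_version_on (time_oo T) u"
proof -
  \<comment> \<open>Time 0 is included, as the integrals in the coefficient identity begin
    there.\<close>
  interpret B: bounded_coefficients U "time_co T" M "3 * \<epsilon>" K
    by unfold_locales (use U_bounded coefficients_small[OF K sup] M_nonneg K \<epsilon> in auto)
  have cont: "continuous_on (time_co T) (nonlin U i k)" for i k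
    by (rule B.continuous_on_nonlin) (rule U_continuous)
  have ode: "(U i k has_vector_derivative (- of_real (4 * pi\<^sup>2 * (norm (freq k))\<^sup>2) * U i k t - nonlin U i k t)) (at t)"
    if t: "t \<in> time_oo T" for t i k
  proof -
    obtain a b where ab: "a < t" "t < b" "{a..b} \<subseteq> time_oo T"
      using open_real_interval_around[OF open_time_oo t] by metis
    have t0: "0 < t" using t by (simp add: time_oo_def)
    have "b \<in> time_co T" using ab time_oo_subset by force
    then have sub: "{0..b} \<subseteq> time_co T" using time_co_down by auto
    define H where "H \<tau> = of_real (4 * pi\<^sup>2 * (norm (freq k))\<^sup>2) * U i k \<tau> + nonlin U i k \<tau>" for \<tau>
    have "(U i k has_vector_derivative - H t) (at t)"
    proof (rule integral_identity_imp_derivative[OF _ t0 ab(2)])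
      show "continuous_on {0..b} H"
        unfolding H_def by (intro continuous_intros continuous_on_subset[OF U_continuous sub] continuous_on_subset[OF cont sub])
      show "Re (cis (- \<theta>) * U i k s) + integral {0..s} (\<lambda>\<tau>. Re (cis (- \<theta>) * H \<tau>))
          = torus_inner \<psi> (test_field k \<theta> (\<chi> m. leray i k m))" if "s \<in> {0..b}" for \<theta> s
        unfolding H_def by (rule U_integral_identity[OF _ B.U_conv_summable cont]) (use that sub in auto)
    qed
    then show ?thesis by (simp add: H_def)
  qed
  interpret N: fourier_navier_stokes U "time_oo T" M "3 * \<epsilon>" K
  proof unfold_locales
    fix t assume t: "t \<in> time_oo T"
    then have tco: "t \<in> time_co T" using time_oo_subset by auto
    show "(\<Sum>i\<in>UNIV. norm (U i k t)) \<le> M" for k by (rule B.bounded[OF tco])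
    show "(\<Sum>i\<in>UNIV. norm (U i k t)) \<le> 3 * \<epsilon> * inv_sq k" if "K \<le> norm (freq k)" for k
      by (rule B.small[OF tco that])
    show "t > 0" using t by (simp add: time_oo_def)
    show "s \<in> time_oo T" if "0 < s" "s \<le> t" for s by (rule time_oo_down[OF t that])
  qed (use M_nonneg K \<epsilon> ode in auto)
  \<comment> \<open>The synthesised function is complex-valued by construction; it agrees with the
    real components of \<open>u\<close> almost everywhere, so taking the real part changes nothing
    there.\<close>
  define v where "v t x = (\<chi> i. Re (synth (U i) (t, x)))" for t x
  have "Ck_on n (time_oo T \<times> UNIV) (\<lambda>z. \<chi> i. Re (synth (U i) z))" for n
    by (intro Ck_on_vec_lambda Ck_on_bounded_linear[OF bounded_linear_Re] synth_Ck_on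
        open_time_oo N.smooth_family_U)
  then have smooth: "smooth_on (time_oo T \<times> UNIV) (\<lambda>(t, x). v t x)"
    by (simp add: smooth_on_def v_def case_prod_unfold)
  have periodic: "periodic (v t)" for t
  proof -
    have "wave k (x + axis j 1) = wave k x" for k x j
      \<comment> \<open>The phases 0 and \<open>- (pi / 2)\<close> give the cosine and the sine, the
        two parts of \<open>wave\<close>.\<close>
      using periodic_coswave[of k 0 x j] periodic_coswave[of k "- (pi / 2)" x j]
      by (simp add: coswave_def wave_def complex_eq_iff cos_diff)
    then show ?thesis by (simp add: periodic_def v_def synth_def)
  qed
  have "AE x in lebesgue. x \<in> unit_cube \<longrightarrow> u t x = v t x" if t: "t \<in> time_oo T" for t
  proof -
    have tco: "t \<in> time_co T" using t time_oo_subset by auto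
    have "AE x in cube_measure. complex_of_real (u t x $ i) - synth (U i) (t, x) = 0" for i
    proof (rule fcoeff_eq_0_imp_AE_0)
      note usq = in_L2_nth[OF L2[OF tco], of i]
      note syn = fcoeff_synth[of "U i" t, OF rapid_family_abs_summable[OF N.rapid_family_U t]]
      show "square_integrable (\<lambda>x. complex_of_real (u t x $ i) - synth (U i) (t, x))"
        by (rule square_integrable_diff[OF usq syn(1)])
      show "fcoeff (\<lambda>x. complex_of_real (u t x $ i) - synth (U i) (t, x)) k = 0" for k
        unfolding fcoeff_diff[OF usq syn(1)] syn(2) U_fcoeff by simp
    qed
    then have "AE x in cube_measure. \<forall>i\<in>UNIV. complex_of_real (u t x $ i) - synth (U i) (t, x) = 0"
      by (intro AE_finite_allI) auto
    then have "AE x in cube_measure. u t x = v t x"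
    proof eventually_elim
      case (elim x)
      then have "synth (U i) (t, x) = complex_of_real (u t x $ i)" for i by simp
      then show ?case by (simp add: v_def vec_eq_iff)
    qed
    then show ?thesis by (simp add: AE_restrict_space_iff)
  qed
  then show ?thesis
    unfolding has_smooth_version_on_def torus_time_smooth_def using smooth periodic by blast
qed

end

theorem theorem2:
  shows "\<exists>\<epsilon>::real. \<epsilon> > 0 \<and>
    (\<forall>(T::ereal) (\<psi> :: real^3 \<Rightarrow> real^3) (u :: real \<Rightarrow> real^3 \<Rightarrow> real^3) (K::real).
       0 < T \<longrightarrow> leray_hopf T \<psi> u \<longrightarrow> 0 < K \<longrightarrow>
       (\<forall>t\<in>time_oo T.
          (SUP k\<in>{k :: int^3. norm (freq k) \<ge> K}.
             ereal ((norm (freq k))\<^sup>2 * norm (fourier_coeff (u t) k))) < ereal \<epsilon>) \<longrightarrow>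
       has_smooth_version_on (time_oo T) u)"
proof (intro exI[of _ "1 / (96 * conv_const)"] conjI allI impI)
  show "1 / (96 * conv_const) > 0" by (simp add: conv_const_def)
  fix T :: ereal and \<psi> :: "real^3 \<Rightarrow> real^3" and u :: "real \<Rightarrow> real^3 \<Rightarrow> real^3" and K :: real
  assume T: "0 < T" and lh: "leray_hopf T \<psi> u" and K: "0 < K"
    and sup: "\<forall>t\<in>time_oo T. (SUP k\<in>{k :: int^3. norm (freq k) \<ge> K}.
             ereal ((norm (freq k))\<^sup>2 * norm (fourier_coeff (u t) k))) < ereal (1 / (96 * conv_const))"
  interpret leray_hopf_solution T \<psi> u
    by unfold_locales (fact T lh)+
  show "has_smooth_version_on (time_oo T) u"
    by (rule has_smooth_version[OF K]) (use sup in \<open>auto simp: conv_const_def\<close>)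
qed

end
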